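(* Let $\mathbb{F}$ be an infinite field with $\mathrm{char}(\mathbb{F})>2$, and let $\circledast$ be any involution of the first kind on the algebra $UT_3(\mathbb{F})$ of $3\times 3$ upper triangular matrices over $\mathbb{F}$. Then $Id(UT_3(\mathbb{F}),\circledast)$ is the $T( * )$-ideal of $\mathbb{F}\langle Y\cup Z\rangle$ generated by the following polynomials, where each symbol $x_i$ may be replaced by either $y_i$ or $z_i$ (all choices being included): (i) $z_1[z_2,z_3]-z_2[z_1,z_3]+z_3[z_1,z_2]$; (ii) $(-1)^{|x_1x_2|}[x_1,x_2][x_3,x_4]-(-1)^{|x_3x_4|}[x_3,x_4][x_1,x_2]$; (iii) $(-1)^{|x_1x_2|}[x_1,x_2][x_3,x_4]-(-1)^{|x_1x_3|}[x_1,x_3][x_2,x_4]+(-1)^{|x_1x_4|}[x_1,x_4][x_2,x_3]$; (iv) $z_1[x_3,x_4]z_2+(-1)^{|x_3x_4|}z_2[x_3,x_4]z_1$; (v) $[x_1,x_2]z_5[x_3,x_4]$; (vi) $z_1[x_4,x_5]z_2x_3+(-1)^{|x_3|}x_3z_1[x_4,x_5]z_2$.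
   Context: All algebras are unital and associative over $\mathbb{F}$. An involution of the first kind is an $\mathbb{F}$-linear anti-automorphism of order at most two. $Y=\{y_1,y_2,\ldots\}$ and $Z=\{z_1,z_2,\ldots\}$ are disjoint infinite sets, and $\mathbb{F}\langle Y\cup Z\rangle$ is the free unital associative algebra on $Y\cup Z$ with the involution $*$ determined by $y_i^*=y_i$, $z_i^*=-z_i$. For an algebra with involution $(A,\circledast)$, $A^+$ and $A^-$ denote the sets of symmetric ($a^\circledast=a$) and skew-symmetric ($a^\circledast=-a$) elements, and $Id(A,\circledast)$ is the set of all $f(y_1,\ldots,y_m,z_1,\ldots,z_n)\in\mathbb{F}\langle Y\cup Z\rangle$ with $f(a_1,\ldots,a_m,b_1,\ldots,b_n)=0$ for all $a_i\in A^+$, $b_j\in A^-$. A $T( * )$-ideal is a two-sided ideal of $\mathbb{F}\langle Y\cup Z\rangle$ invariant under all endomorphisms of $\mathbb{F}\langle Y\cup Z\rangle$ commuting with $*$. Commutator: $[a,b]=ab-ba$. Signs: $|h|=1$ if $h$ is symmetric and $|h|=0$ if $h$ is skew-symmetric in $\mathbb{F}\langle Y\cup Z\rangle$, so $|y_i|=1$, $|z_i|=0$; and $|x_ix_j|$ denotes $|[x_i,x_j]|$, i.e. $|x_ix_j|=0$ if $x_i,x_j$ are both in $Y$ or both in $Z$, and $|x_ix_j|=1$ if one is in $Y$ and the other in $Z$. *)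

theory Defs
  imports "HOL-Analysis.Analysis" "HOL-Library.Poly_Mapping"
begin

section \<open>Algebras with involution\<close>

text \<open>An algebra over \<open>'f\<close> is given by a type \<open>'b\<close> of class \<open>ring_1\<close> and a scalar multiplication
  \<open>smul\<close>.  \<^const>\<open>Vector_Spaces.linear\<close> includes that \<open>smul\<close> is a vector space structure.\<close>

definition unital_algebra :: "('f::field \<Rightarrow> 'b::ring_1 \<Rightarrow> 'b) \<Rightarrow> bool" where
  "unital_algebra smul \<longleftrightarrow> vector_space smul \<and>
     (\<forall>c a b. smul c a * b = smul c (a * b)) \<and> (\<forall>c a b. a * smul c b = smul c (a * b))"

definition algebra_hom ::
  "('f::field \<Rightarrow> 'b::ring_1 \<Rightarrow> 'b) \<Rightarrow> ('f \<Rightarrow> 'c::ring_1 \<Rightarrow> 'c) \<Rightarrow> ('b \<Rightarrow> 'c) \<Rightarrow> bool" where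
  "algebra_hom s1 s2 h \<longleftrightarrow> Vector_Spaces.linear s1 s2 h \<and>
     (\<forall>a b. h (a * b) = h a * h b) \<and> h 1 = 1"

definition algebra_involution :: "('f::field \<Rightarrow> 'b::ring_1 \<Rightarrow> 'b) \<Rightarrow> ('b \<Rightarrow> 'b) \<Rightarrow> bool" where
  "algebra_involution smul star \<longleftrightarrow> Vector_Spaces.linear smul smul star \<and>
     (\<forall>a b. star (a * b) = star b * star a) \<and> (\<forall>a. star (star a) = a)"

definition symmetric_elems :: "('b \<Rightarrow> 'b) \<Rightarrow> 'b set" where
  "symmetric_elems star = {a. star a = a}"

definition skew_elems :: "('b::ring_1 \<Rightarrow> 'b) \<Rightarrow> 'b set" where
  "skew_elems star = {a. star a = - a}"

definition comm :: "'b::ring_1 \<Rightarrow> 'b \<Rightarrow> 'b" where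
  "comm a b = a * b - b * a"


section \<open>The free algebra with involution\<close>

text \<open>Words under concatenation are the free monoid, so finitely supported functions from words
  to \<open>'f\<close>, with the convolution product of \<open>Poly_Mapping\<close>, form the free unital algebra.\<close>

instantiation list :: (type) monoid_add
begin

definition zero_list :: "'a list" where "zero_list = []"
definition plus_list :: "'a list \<Rightarrow> 'a list \<Rightarrow> 'a list" where "plus_list = (@)"

instance by standard (simp_all add: zero_list_def plus_list_def)

end

datatype gen = Y nat | Z nat

type_synonym 'f free_alg = "gen list \<Rightarrow>\<^sub>0 'f"

definition free_scale :: "'f::field \<Rightarrow> 'f free_alg \<Rightarrow> 'f free_alg" where
  "free_scale c p = Poly_Mapping.single [] c * p"

definition yv :: "nat \<Rightarrow> 'f::field free_alg" where
  "yv i = Poly_Mapping.single [Y i] 1"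

definition zv :: "nat \<Rightarrow> 'f::field free_alg" where
  "zv i = Poly_Mapping.single [Z i] 1"

fun gen_star :: "gen \<Rightarrow> 'f::field free_alg" where
  "gen_star (Y i) = yv i"
| "gen_star (Z i) = - zv i"

definition free_star :: "'f::field free_alg \<Rightarrow> 'f free_alg" where
  "free_star p = (\<Sum>w\<in>Poly_Mapping.keys p.
     free_scale (Poly_Mapping.lookup p w) (prod_list (map gen_star (rev w))))"

text \<open>\<open>|h|\<close>, meaningful only for nonzero symmetric or skew-symmetric \<open>h\<close>.\<close>

definition par :: "'f::field free_alg \<Rightarrow> nat" where
  "par h = (if h \<in> symmetric_elems free_star then 1 else 0)"

text \<open>The possible values \<open>y\<^sub>i\<close> and \<open>z\<^sub>i\<close> of the symbol \<open>x\<^sub>i\<close>.\<close>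

definition xv :: "nat \<Rightarrow> 'f::field free_alg set" where
  "xv i = {yv i, zv i}"

definition eval_free ::
  "('f::field \<Rightarrow> 'b::ring_1 \<Rightarrow> 'b) \<Rightarrow> (gen \<Rightarrow> 'b) \<Rightarrow> 'f free_alg \<Rightarrow> 'b" where
  "eval_free smul g p = (\<Sum>w\<in>Poly_Mapping.keys p.
     smul (Poly_Mapping.lookup p w) (prod_list (map g w)))"

definition star_identities ::
  "('f::field \<Rightarrow> 'b::ring_1 \<Rightarrow> 'b) \<Rightarrow> ('b \<Rightarrow> 'b) \<Rightarrow> 'f free_alg set" where
  "star_identities smul star =
     {f. \<forall>g. (\<forall>i. g (Y i) \<in> symmetric_elems star) \<and> (\<forall>i. g (Z i) \<in> skew_elems star)
           \<longrightarrow> eval_free smul g f = 0}"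

definition two_sided_ideal :: "'b::ring_1 set \<Rightarrow> bool" where
  "two_sided_ideal I \<longleftrightarrow> 0 \<in> I \<and> (\<forall>a\<in>I. \<forall>b\<in>I. a + b \<in> I) \<and>
     (\<forall>a\<in>I. \<forall>r. r * a \<in> I \<and> a * r \<in> I)"

definition T_star_ideal :: "'f::field free_alg set \<Rightarrow> bool" where
  "T_star_ideal I \<longleftrightarrow> two_sided_ideal I \<and>
     (\<forall>\<phi>. algebra_hom free_scale free_scale \<phi> \<and> (\<forall>p. \<phi> (free_star p) = free_star (\<phi> p))
        \<longrightarrow> \<phi> ` I \<subseteq> I)"


section \<open>Upper triangular matrices\<close>

typedef (overloaded) 'a ut3 = "{A :: 'a::zero^3^3. A$2$1 = 0 \<and> A$3$1 = 0 \<and> A$3$2 = 0}"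
  by (rule exI[of _ "\<chi> i j. 0"]) simp

setup_lifting type_definition_ut3

instantiation ut3 :: (ring_1) ring_1
begin

lift_definition zero_ut3 :: "'a ut3" is 0 by simp
lift_definition one_ut3 :: "'a ut3" is "mat 1" by (simp add: mat_def)
lift_definition plus_ut3 :: "'a ut3 \<Rightarrow> 'a ut3 \<Rightarrow> 'a ut3" is "(+)" by simp
lift_definition minus_ut3 :: "'a ut3 \<Rightarrow> 'a ut3 \<Rightarrow> 'a ut3" is "(-)" by simp
lift_definition uminus_ut3 :: "'a ut3 \<Rightarrow> 'a ut3" is uminus by simp
lift_definition times_ut3 :: "'a ut3 \<Rightarrow> 'a ut3 \<Rightarrow> 'a ut3" is "(**)"
  by (simp add: matrix_matrix_mult_def sum_3)

instance
proof
  fix a b c :: "'a ut3"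
  show "a * b * c = a * (b * c)"
    by transfer (simp add: matrix_mul_assoc)
  show "(a + b) * c = a * c + b * c"
    by transfer (simp add: matrix_matrix_mult_def vec_eq_iff sum_3 algebra_simps)
  show "a * (b + c) = a * b + a * c"
    by transfer (simp add: matrix_matrix_mult_def vec_eq_iff sum_3 algebra_simps)
  show "(0::'a ut3) \<noteq> 1"
    by transfer (auto simp: mat_def vec_eq_iff)
qed (transfer; simp add: algebra_simps)+

end

lift_definition ut3_scale :: "'a::field \<Rightarrow> 'a ut3 \<Rightarrow> 'a ut3" is
  "\<lambda>c A. \<chi> i j. c * A$i$j" by simp


section \<open>The structures above are as intended\<close>

lemma unital_algebra_ut3: "unital_algebra (ut3_scale :: 'f::field \<Rightarrow> _)"
  unfolding unital_algebra_def vector_space_def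
  by (intro conjI allI; transfer)
    (simp_all add: vec_eq_iff matrix_matrix_mult_def sum_distrib_left algebra_simps)

lemma free_alg_induct [case_names single sum]:
  fixes p :: "'f::field free_alg"
  assumes "\<And>w c. P (Poly_Mapping.single w c)" and "\<And>p q. P p \<Longrightarrow> P q \<Longrightarrow> P (p + q)"
  shows "P p"
proof (induction p rule: update_induct)
  case const
  show ?case using assms(1)[of "[]" 0] by simp
next
  case (update f w c)
  have "Poly_Mapping.update w c f = f + Poly_Mapping.single w c"
    using update.hyps
    by (intro poly_mapping_eqI) (auto simp: lookup_update lookup_add lookup_single in_keys_iff when_def)
  then show ?case using assms update.IH by simp
qed

lemma single_Nil_one: "Poly_Mapping.single [] 1 = (1 :: 'f::field free_alg)"
  using single_one[where 'a = "gen list" and 'b = 'f] by (simp add: zero_list_def)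

lemma single_Nil_commute:
  
  fixes p :: "'f::field free_alg"
  shows "Poly_Mapping.single [] c * p = p * Poly_Mapping.single [] c"
proof (induction p rule: free_alg_induct)
  case (single k v)
  show ?case by (simp add: mult_single plus_list_def mult.commute)
next
  case (sum f g)
  then show ?case by (simp add: distrib_left distrib_right)
qed

lemma unital_algebra_free: "unital_algebra (free_scale :: 'f::field \<Rightarrow> _)"
proof -
  have "q * (Poly_Mapping.single [] c * p) = Poly_Mapping.single [] c * (q * p)"
    for c :: 'f and p q :: "'f free_alg"
    by (metis mult.assoc single_Nil_commute)
  then show ?thesis
    by (simp add: single_Nil_one unital_algebra_def vector_space_def free_scale_def single_add distrib_left
        distrib_right mult.assoc[symmetric] mult_single plus_list_def)
qed

interpretation free: vector_space "free_scale :: 'f::field \<Rightarrow> _"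
  by (rule conjunct1[OF unital_algebra_free[unfolded unital_algebra_def]])

lemma free_scale_mult:
  "free_scale c a * b = free_scale c (a * b)" "a * free_scale c b = free_scale c (a * b)"
  using unital_algebra_free unfolding unital_algebra_def by blast+

lemma free_star_single:
  "free_star (Poly_Mapping.single w c) = free_scale c (prod_list (map gen_star (rev w)))"
  by (cases "c = 0") (simp_all add: free_star_def)

lemma free_star_yv: "free_star (yv i) = yv i"
  by (simp add: free_star_single yv_def)

lemma free_star_zv: "free_star (zv i) = - zv i"
  by (simp add: free_star_single zv_def)

lemma free_star_add: "free_star (p + q) = free_star p + free_star q"
proof -
  let ?t = "\<lambda>p w. free_scale (Poly_Mapping.lookup p w) (prod_list (map gen_star (rev w)))"
  have ext: "free_star p = sum (?t p) A" if "finite A" "Poly_Mapping.keys p \<subseteq> A" for p A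
    unfolding free_star_def using that
    by (intro sum.mono_neutral_left) (auto simp: in_keys_iff)
  let ?A = "Poly_Mapping.keys p \<union> Poly_Mapping.keys q"
  have "free_star (p + q) = sum (?t (p + q)) ?A"
    using keys_add[of p q] by (intro ext) auto
  also have "\<dots> = sum (?t p) ?A + sum (?t q) ?A"
    by (simp add: lookup_add free.scale_left_distrib sum.distrib)
  finally show ?thesis
    using ext[of ?A p] ext[of ?A q] by simp
qed

lemma free_star_scale: "free_star (free_scale c p) = free_scale c (free_star p)"
proof (induction p rule: free_alg_induct)
  case (single k v)
  have "free_scale c (Poly_Mapping.single k v) = Poly_Mapping.single k (c * v)"
    by (simp add: free_scale_def mult_single plus_list_def)
  then show ?case
    by (simp add: free_star_single)
next
  case (sum f g)
  then show ?case by (simp add: free_star_add free.scale_right_distrib)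
qed

lemma free_star_mult: "free_star (p * q) = free_star q * free_star p"
proof (induction p rule: free_alg_induct)
  case (single k v)
  show ?case
  proof (induction q rule: free_alg_induct)
    case (single k' v')
    show ?case
      by (simp add: mult_single plus_list_def free_star_single free_scale_mult mult.commute)
  next
    case (sum f g)
    then show ?case by (simp add: distrib_left distrib_right free_star_add)
  qed
next
  case (sum f g)
  then show ?case by (simp add: distrib_left distrib_right free_star_add)
qed

lemma linear_free_star: "Vector_Spaces.linear free_scale free_scale free_star"
  by (simp add: Vector_Spaces.linear_def module_hom_axioms_def module_hom_def free.module_axioms
      free.vector_space_axioms free_star_add free_star_scale)

interpretation free_star: Vector_Spaces.linear free_scale free_scale free_star
  by (rule linear_free_star)

lemma free_star_free_star: "free_star (free_star p) = p"
proof (induction p rule: free_alg_induct)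
  case (single w c)
  have one: "free_star 1 = (1 :: 'a free_alg)"
    by (simp add: free_star_single flip: single_Nil_one)
  have g: "free_star (gen_star x) = (Poly_Mapping.single [x] 1 :: 'a free_alg)" for x
    by (cases x) (simp_all add: free_star_yv free_star_zv free_star.neg, simp_all add: yv_def zv_def)
  have "free_star (prod_list (map gen_star (rev w))) = (Poly_Mapping.single w 1 :: 'a free_alg)"
  proof (induction w)
    case Nil
    show ?case using one by (simp add: single_Nil_one)
  next
    case (Cons x w)
    then show ?case by (simp add: free_star_mult g mult_single plus_list_def)
  qed
  then show ?case
    by (simp add: free_star_single free_star_scale, simp add: free_scale_def mult_single plus_list_def)
next
  case (sum f g)
  then show ?case by (simp add: free_star_add)
qed

lemma algebra_involution_free_star: "algebra_involution free_scale free_star"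
  by (simp add: algebra_involution_def linear_free_star free_star_mult free_star_free_star)

lemma free_star_comm: "free_star (comm p q) = comm (free_star q) (free_star p)"
  by (simp add: comm_def free_star.diff free_star_mult)

lemma par_skew:
  fixes h :: "'f::field free_alg"
  assumes "free_star h = - h" and "Poly_Mapping.lookup h w = 1" and "(2::'f) \<noteq> 0"
  shows "par h = 0"
proof -
  have "- h \<noteq> h"
  proof
    assume "- h = h"
    then have "- Poly_Mapping.lookup h w = Poly_Mapping.lookup h w"
      by (metis lookup_uminus)
    then have "(1::'f) + 1 = 0"
      using assms(2) by (metis add.right_inverse)
    then show False using assms(3) by simp
  qed
  then show ?thesis using assms(1) by (simp add: par_def symmetric_elems_def)
qed

lemma par_yv: "par (yv i) = 1"
  by (simp add: par_def symmetric_elems_def free_star_yv)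

lemma par_zv:
  assumes "(2::'f::field) \<noteq> 0"
  shows "par (zv i :: 'f free_alg) = 0"
  by (rule par_skew[of _ "[Z i]"]) (use assms in \<open>simp_all add: free_star_zv, simp add: zv_def\<close>)

lemma par_comm_mixed: "par (comm (yv i) (zv j)) = 1" "par (comm (zv i) (yv j)) = 1"
proof -
  have "free_star (comm (yv i) (zv j)) = comm (yv i) (zv j)"
    and "free_star (comm (zv i) (yv j)) = comm (zv i) (yv j)"
    unfolding free_star_comm free_star_yv free_star_zv by (simp_all add: comm_def)
  then show "par (comm (yv i) (zv j)) = 1" "par (comm (zv i) (yv j)) = 1"
    by (simp_all add: par_def symmetric_elems_def)
qed

lemma par_comm_same:
  assumes "(2::'f::field) \<noteq> 0" and "i \<noteq> j"
  shows "par (comm (yv i) (yv j) :: 'f free_alg) = 0"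
    and "par (comm (zv i) (zv j) :: 'f free_alg) = 0"
proof -
  have "free_star (comm (yv i) (yv j)) = - (comm (yv i) (yv j) :: 'f free_alg)"
    unfolding free_star_comm free_star_yv by (simp add: comm_def)
  moreover have "Poly_Mapping.lookup (comm (yv i) (yv j)) [Y i, Y j] = (1::'f)"
    using assms
    by (simp add: comm_def yv_def mult_single plus_list_def lookup_minus lookup_single)
  ultimately show "par (comm (yv i) (yv j) :: 'f free_alg) = 0"
    using assms(1) by (rule par_skew)
  have "free_star (comm (zv i) (zv j)) = - (comm (zv i) (zv j) :: 'f free_alg)"
    unfolding free_star_comm free_star_zv by (simp add: comm_def)
  moreover have "Poly_Mapping.lookup (comm (zv i) (zv j)) [Z i, Z j] = (1::'f)"
    using assms
    by (simp add: comm_def zv_def mult_single plus_list_def lookup_minus lookup_single)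
  ultimately show "par (comm (zv i) (zv j) :: 'f free_alg) = 0"
    using assms(1) by (rule par_skew)
qed

end

theory Submission
  imports Defs
begin

text \<open>
  For the reflection along the antidiagonal, the entry \<open>(1, 2)\<close> of a commutator \<open>[x\<^sub>i, x\<^sub>j]\<close> of
  generic matrices is a \<open>2 \<times> 2\<close> determinant \<open>w\<^sub>i\<^sub>j = p\<^sub>i q\<^sub>j - p\<^sub>j q\<^sub>i\<close>, and further bracketing with
  \<open>x\<^sub>k\<close> multiplies it by \<open>q\<^sub>k\<close>; the entry \<open>(1, 3)\<close> of \<open>[x\<^sub>i, x\<^sub>j][x\<^sub>k, x\<^sub>l, \<dots>]\<^sup>*\<close> is \<open>w\<^sub>i\<^sub>j w\<^sub>k\<^sub>l q\<dots>\<close>.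
  The generating identities, written with \<open>h\<^sup>*\<close> instead of signs, are consequences of the symmetry
  and Pluecker relations of these determinants.  Modulo them every polynomial is a combination of
  ordered words, of \<open>y\<dots>[x\<^sub>i, x\<^sub>j, \<dots>]\<close> and \<open>[x\<^sub>i, x\<^sub>j, \<dots>]\<^sup>* y\<dots> z\<close> with \<open>x\<^sub>i\<close> the least letter, of
  \<open>y\<dots> z[y, z]z \<dots>z\<close>, and of \<open>y\<dots>[x\<^sub>i, x\<^sub>j][x\<^sub>k, x\<^sub>l, \<dots>]\<^sup>*\<close> indexed by standard tableaux (the Jacobi
  identity plays the part of the Garnir relations).  Leading monomials of the entries \<open>(1, 1)\<close>,
  \<open>(1, 2)\<close>, \<open>(2, 3)\<close> and \<open>(1, 3)\<close> separate these elements, and over an infinite field a generic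
  matrix identity is an identity of polynomials.  Finally, every involution is conjugate to the
  reflection: it exchanges the first and third diagonal entries, so a suitable idempotent \<open>E\<close>,
  its image and an element of \<open>E A (1 - E - E\<^sup>*)\<close> give new matrix units permuted like the old ones.
\<close>


section \<open>Rings with involution satisfying the relations\<close>

text \<open>The sign of a generating identity depends on the kind of its letters, whereas the star
  does not. Written with stars, the relations are additive in every commutator entry; since 2 is
  invertible they then hold for all entries, not only for symmetric or skew ones, so that products
  can be substituted and expanded by the Leibniz rule. This is why the computation takes place in a
  quotient ring, where the relations are equations. The quotient inherits an involution only if the
  generated ideal is closed under the star. This is not part of the definition of such an ideal and
  has to be derived from the generators. Single commutators need two families because the entries
  (1, 2) and (2, 3) are independent. A skew matrix has (2, 2) entry 0, so a trailing skew letter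
  wipes out the (1, 2) entry and leaves the (2, 3) entry, which the star turns into the same
  determinant. Invertibility of 2 enters twice more: an involution is brought into standard form
  with the help of a halved entry, and the leading coefficient of the family with skew letters on
  both sides is -2.\<close>

locale ut3_star_quotient = vector_space smul
  for smul :: "'f::field \<Rightarrow> 'r::ring_1 \<Rightarrow> 'r" +
  fixes st :: "'r \<Rightarrow> 'r" and x :: "gen \<Rightarrow> 'r"
  assumes smul_mult_left: "smul t a * b = smul t (a * b)"
    and smul_mult_right: "a * smul t b = smul t (a * b)"
    and st_add [simp]: "st (a + b) = st a + st b"
    and st_smul: "st (smul t a) = smul t (st a)"
    and st_mult [simp]: "st (a * b) = st b * st a"
    and st_st [simp]: "st (st a) = a"
    and st_Y [simp]: "st (x (Y n)) = x (Y n)"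
    and st_Z [simp]: "st (x (Z n)) = - x (Z n)"
    and two_neq_zero: "(2::'f) \<noteq> 0"
    and skew_cyclic: "\<lbrakk>st p = - p; st q = - q; st r = - r\<rbrakk> \<Longrightarrow>
          p * comm q r - q * comm p r + r * comm p q = 0"
    and comm_swap: "st (comm a b) * comm c d = st (comm c d) * comm a b"
    and comm_pluecker:
          "st (comm a b) * comm c d - st (comm a c) * comm b d + st (comm a d) * comm b c = 0"
    and skew_comm_skew: "\<lbrakk>st p = - p; st q = - q\<rbrakk> \<Longrightarrow> p * comm a b * q = q * st (comm a b) * p"
    and comm_skew_comm: "st p = - p \<Longrightarrow> comm a b * p * comm c d = 0"
    and skew_comm_skew_mult: "\<lbrakk>st p = - p; st q = - q\<rbrakk> \<Longrightarrow>
          p * comm a b * q * r = st r * (p * comm a b * q)"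
    and span_words: "r \<in> span (range (\<lambda>w. prod_list (map x w)))"
begin

lemma smul_half: "smul (1 / 2) (a + a) = a"
proof -
  have "(1 / 2 + 1 / 2 :: 'f) = 1" using two_neq_zero by (simp flip: mult_2)
  then have "smul (1 / 2) a + smul (1 / 2) a = a" by (metis scale_left_distrib scale_one)
  then show ?thesis by (simp add: scale_right_distrib)
qed

lemma double_zero: "a + a = 0 \<Longrightarrow> a = 0" for a :: 'r
  using smul_half[of a] by simp

lemma st_zero [simp]: "st 0 = 0"
  using st_add[of 0 0] by simp

lemma st_minus [simp]: "st (- a) = - st a"
  using st_add[of a "- a"] by (simp add: eq_neg_iff_add_eq_0 add.commute)

lemma st_diff [simp]: "st (a - b) = st a - st b"
  using st_add[of a "- b"] by simp

lemma st_comm: "st (comm a b) = comm (st b) (st a)"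
  by (simp add: comm_def)

text \<open>By the Leibniz rule \<open>comm a (b * r) = comm a b * r + b * comm a r\<close>, a
  factor next to a commutator can be absorbed into its entries, on either side. This reduces
  everything to \<open>comm_skew_comm\<close>.\<close>

lemma comm_absorb_skew:
  assumes "st p = - p"
  shows "comm a b * r * p * s * comm c d = 0"
proof -
  have 1: "comm a b * r * p * comm c d = 0" for c d
  proof -
    have "comm a b * r * p * comm c d = comm a (b * r) * p * comm c d - b * (comm a r * p * comm c d)"
      unfolding comm_def[of a] by (simp add: algebra_simps)
    then show ?thesis using comm_skew_comm[OF assms] by simp
  qed
  have "s * comm c d = comm (s * c) d - comm s d * c"
    by (simp add: comm_def algebra_simps)
  then have "comm a b * r * p * s * comm c d
      = comm a b * r * p * comm (s * c) d - comm a b * r * p * comm s d * c"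
    by (simp add: mult.assoc right_diff_distrib)
  then show ?thesis using 1 by simp
qed

text \<open>The difference \<open>p - st p\<close> is skew, so between two commutators any factor
  may be starred.\<close>

lemma comm_mid_st:
  "comm a b * r * p * s * comm c d = comm a b * r * st p * s * comm c d"
proof -
  have "comm a b * r * (p - st p) * s * comm c d = 0"
    by (rule comm_absorb_skew) simp
  then show ?thesis by (simp add: algebra_simps)
qed

text \<open>Starring \<open>p\<close> and \<open>q\<close> one at a time turns \<open>p * q\<close>
  into \<open>st p * st q\<close>, and starring the product \<open>q * p\<close> as a whole gives
  the same element. Thus factors between two commutators commute.\<close>

lemma comm_mid_comm:
  fixes a :: 'r
  shows "comm a b * r * comm p q * s * comm c d = 0"
proof -
  have 1: "comm a b * r * p * (q * s) * comm c d = comm a b * r * st p * (q * s) * comm c d" for p q :: 'r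
    by (rule comm_mid_st)
  have 2: "comm a b * (r * st p) * q * s * comm c d = comm a b * (r * st p) * st q * s * comm c d" for p q :: 'r
    by (rule comm_mid_st)
  have "comm a b * r * (p * q) * s * comm c d = comm a b * r * (st p * st q) * s * comm c d"
    using 1[of p q] 2[of p q] by (simp add: mult.assoc)
  also have "\<dots> = comm a b * r * (q * p) * s * comm c d"
    using comm_mid_st[of a b r "q * p" s c d] by simp
  finally have "comm a b * r * (p * q - q * p) * s * comm c d = 0"
    by (simp add: algebra_simps)
  then show ?thesis by (simp add: comm_def)
qed

lemma comm_swap': "comm a b * st (comm c d) = comm c d * st (comm a b)"
  using comm_swap[of "st b" "st a" "st d" "st c"] by (simp add: st_comm)

lemma comm_pluecker':
  "comm a b * st (comm c d) - comm a c * st (comm b d) + comm a d * st (comm b c) = 0"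
proof -
  have m: "comm p q = - comm q p" for p q :: 'r by (simp add: comm_def)
  have "st (comm (st p) (st q)) * comm (st r) (st s) = comm p q * st (comm r s)" for p q r s
    using m[of q p] m[of "st r" "st s"] by (simp add: st_comm)
  then show ?thesis
    using comm_pluecker[of "st a" "st b" "st c" "st d"] by simp
qed

text \<open>Substitute \<open>a * r\<close> for \<open>a\<close> in the Pluecker relation: the
  Leibniz rule splits the result into \<open>a\<close> times the relation for \<open>r\<close>,
  which vanishes, and the relation with \<open>r\<close> inserted.\<close>

lemma comm_pluecker_mid:
  "comm a b * r * st (comm c d) - comm a c * r * st (comm b d) + comm a d * r * st (comm b c) = 0"
proof -
  have "comm (a * r) b = a * comm r b + comm a b * r" for b
    by (simp add: comm_def algebra_simps)
  then have "a * (comm r b * st (comm c d) - comm r c * st (comm b d) + comm r d * st (comm b c))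
     + (comm a b * r * st (comm c d) - comm a c * r * st (comm b d) + comm a d * r * st (comm b c)) = 0"
    using comm_pluecker'[of "a * r" b c d] by (simp add: algebra_simps)
  then show ?thesis using comm_pluecker'[of r b c d] by simp
qed

lemma comm_st_comm_mid_st:
  "comm a b * r * st (comm c d) = comm a b * st r * st (comm c d)"
  using comm_mid_st[of a b 1 r 1 "st d" "st c"] by (simp add: st_comm)

text \<open>The swap relation for \<open>comm ?u r\<close> and \<open>?v\<close> expresses the
  difference of the two sides as \<open>?u * r * st ?v - ?v * r * st ?u\<close>. Exchanging the two
  commutators negates this expression but preserves the difference, so twice the difference is
  0.\<close>

lemma comm_st_comm_commute: "r * (comm a b * st (comm c d)) = comm a b * st (comm c d) * st r"
proof -
  have key: "comm a b * r * st (comm c d) - r * (comm a b * st (comm c d))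
      = comm c d * r * st (comm a b) - comm a b * st (comm c d) * st r" for a b c d
  proof -
    let ?u = "comm a b" and ?v = "comm c d"
    have "comm ?u r * st ?v = ?v * st (comm ?u r)" by (rule comm_swap')
    also have "st (comm ?u r) = st r * st ?u - st ?u * st r"
      unfolding comm_def[of ?u r] by simp
    finally have "?u * r * st ?v - r * (?u * st ?v) = ?v * st r * st ?u - ?v * st ?u * st r"
      unfolding comm_def[of ?u r] by (simp add: algebra_simps)
    then show ?thesis
      by (simp only: comm_st_comm_mid_st[of c d r, symmetric] comm_swap'[of c d])
  qed
  note A = key[of a b c d]
  have B: "comm c d * r * st (comm a b) - r * (comm a b * st (comm c d))
      = comm a b * r * st (comm c d) - comm a b * st (comm c d) * st r"
    using key[of c d a b] by (simp only: comm_swap'[of c d])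
  let ?d = "r * (comm a b * st (comm c d)) - comm a b * st (comm c d) * st r"
  have "?d = comm a b * r * st (comm c d) - comm c d * r * st (comm a b)"
    and "?d = comm c d * r * st (comm a b) - comm a b * r * st (comm c d)"
    using A B by (simp_all only: diff_eq_eq eq_diff_eq) (simp_all add: algebra_simps)
  then have "?d + ?d = (comm a b * r * st (comm c d) - comm c d * r * st (comm a b))
      + (comm c d * r * st (comm a b) - comm a b * r * st (comm c d))"
    by (simp only:)
  then have "?d + ?d = 0" by simp
  then show "r * (comm a b * st (comm c d)) = comm a b * st (comm c d) * st r"
    using double_zero by (metis eq_iff_diff_eq_0)
qed

text \<open>A further bracket may be moved from one commutator to the other. This is why a product
  of two commutators needs a tail on the second one only.\<close>

lemma comm_comm_st: "comm (comm a b) r * st (comm c d) = comm a b * st (comm (comm c d) r)"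
proof -
  let ?u = "comm a b" and ?v = "comm c d"
  have "comm ?u r * st ?v = ?u * r * st ?v - r * (?u * st ?v)"
    unfolding comm_def[of ?u r] by (simp add: algebra_simps)
  also have "\<dots> = ?u * st r * st ?v - ?u * st ?v * st r"
    by (simp add: comm_st_comm_commute comm_st_comm_mid_st[symmetric])
  also have "\<dots> = ?u * st (comm ?v r)"
    unfolding comm_def[of ?v r] by (simp add: algebra_simps)
  finally show ?thesis .
qed

end

section \<open>Products of two commutators\<close>

text \<open>Adjacent transpositions generate all rearrangements. With \<open>S = {0}\<close> this
  yields equalities; with an ideal for \<open>S\<close> it sorts letters up to error terms.\<close>

lemma (in vector_space) span_adjacent_swaps:
  assumes S: "subspace S"
    and swap: "\<And>us a b vs. F (us @ a # b # vs) - F (us @ b # a # vs) \<in> S"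
    and "mset xs = mset ys"
  shows "F xs - F ys \<in> S"
proof -
  have move: "F (us @ a # ps @ qs) - F (us @ ps @ a # qs) \<in> S" for us a ps qs
  proof (induction ps arbitrary: us)
    case Nil
    show ?case using subspace_0[OF S] by simp
  next
    case (Cons p ps)
    have "F (us @ a # p # ps @ qs) - F (us @ p # a # ps @ qs) \<in> S"
      by (rule swap)
    from subspace_add[OF S this Cons.IH[of "us @ [p]"]] show ?case by simp
  qed
  have "F (us @ xs) - F (us @ ys) \<in> S" if "mset xs = mset ys" for us
    using that
  proof (induction xs arbitrary: us ys)
    case Nil
    then show ?case using subspace_0[OF S] by simp
  next
    case (Cons a xs)
    then have "a \<in> set ys" by (metis list.set_intros(1) set_mset_mset)
    then obtain ps qs where ys: "ys = ps @ a # qs" by (meson split_list)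
    then have "mset xs = mset (ps @ qs)" using Cons.prems by simp
    from Cons.IH[OF this, of "us @ [a]"]
    have "F (us @ a # xs) - F (us @ a # ps @ qs) \<in> S" by simp
    from subspace_add[OF S this move[of us a ps qs]] show ?case by (simp add: ys)
  qed
  from this[OF assms(3), of "[]"] show ?thesis by simp
qed

context ut3_star_quotient
begin

lemma span_mult_left:
  assumes "a \<in> span A" "\<And>b. b \<in> A \<Longrightarrow> r * b \<in> span B"
  shows "r * a \<in> span B"
  using assms(1)
proof (induction rule: span_induct_alt)
  case base
  show ?case by (simp add: span_zero)
next
  case (step c p q)
  then show ?case using assms(2)
    by (simp add: distrib_left smul_mult_right span_add span_scale)
qed

lemma span_mult_right:
  assumes "a \<in> span A" "\<And>b. b \<in> A \<Longrightarrow> b * r \<in> span B"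
  shows "a * r \<in> span B"
  using assms(1)
proof (induction rule: span_induct_alt)
  case base
  show ?case by (simp add: span_zero)
next
  case (step c p q)
  then show ?case using assms(2)
    by (simp add: distrib_right smul_mult_left span_add span_scale)
qed

abbreviation word :: "gen list \<Rightarrow> 'r" where
  "word w \<equiv> prod_list (map x w)"

abbreviation yword :: "nat list \<Rightarrow> 'r" where
  "yword ys \<equiv> prod_list (map (\<lambda>n. x (Y n)) ys)"

text \<open>Words span the ring, so closure under multiplication need only be tested on single
  letters. All ideals below are recognised in this way.\<close>

lemma span_ideal_left:
  assumes "\<And>g b. b \<in> B \<Longrightarrow> x g * b \<in> span B" "a \<in> span B"
  shows "r * a \<in> span B"
proof -
  have 1: "word w * a \<in> span B" if "a \<in> span B" for w a
  proof (induction w)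
    case Nil
    show ?case using that by simp
  next
    case (Cons g w)
    then show ?case using span_mult_left[of _ B "x g" B] assms(1)
      by (simp add: mult.assoc)
  qed
  show ?thesis using span_mult_right[OF span_words[of r], of a B] 1 assms(2) by auto
qed

lemma span_ideal_right:
  assumes "\<And>g b. b \<in> B \<Longrightarrow> b * x g \<in> span B" "a \<in> span B"
  shows "a * r \<in> span B"
proof -
  have 1: "a * word w \<in> span B" if "a \<in> span B" for w a
    using that
  proof (induction w arbitrary: a)
    case (Cons g w)
    then show ?case using span_mult_right[of _ B "x g" B] assms(1)
      by (simp flip: mult.assoc)
  qed simp
  show ?thesis using span_mult_left[OF span_words[of r], of a B] 1 assms(2) by auto
qed

definition ad :: "gen list \<Rightarrow> 'r \<Rightarrow> 'r" where
  "ad gs c = foldl (\<lambda>c g. comm c (x g)) c gs"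

lemma ad_Nil [simp]: "ad [] c = c"
  and ad_Cons [simp]: "ad (g # gs) c = ad gs (comm c (x g))"
  and ad_append [simp]: "ad (gs @ hs) c = ad hs (ad gs c)"
  by (simp_all add: ad_def)

lemma comm_add_left: "comm (a + b) c = comm a c + comm b c" for a :: 'r
  by (simp add: comm_def algebra_simps)

lemma ad_add: "ad gs (c + d) = ad gs c + ad gs d"
  by (induction gs arbitrary: c d) (simp_all add: comm_add_left)

lemma ad_zero [simp]: "ad gs 0 = 0"
  using ad_add[of gs 0 0] by simp

lemma ad_minus: "ad gs (- c) = - ad gs c"
  using ad_add[of gs c "- c"] by (simp add: eq_neg_iff_add_eq_0 add.commute)

lemma ad_diff: "ad gs (c - d) = ad gs c - ad gs d"
  using ad_add[of gs c "- d"] by (simp add: ad_minus)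

abbreviation xcomm :: "gen \<Rightarrow> gen \<Rightarrow> 'r" where
  "xcomm i j \<equiv> comm (x i) (x j)"

lemma comm_anti: "comm a b = - comm b a" for a :: 'r
  by (simp add: comm_def)

lemma ad_comm_ex: "\<exists>p q. ad gs (comm a b) = comm p q"
  by (induction gs arbitrary: a b) auto

lemma jacobi: "comm (comm a b) c - comm (comm a c) b + comm (comm b c) a = 0" for a :: 'r
  by (simp add: comm_def algebra_simps)

lemma ad_jacobi: "ad (m # gs) (xcomm k l) - ad (l # gs) (xcomm k m) + ad (k # gs) (xcomm l m) = 0"
  using jacobi[of "x k" "x l" "x m"] by (simp flip: ad_add ad_diff)

lemma st_gen: "st (x g) = x g \<or> st (x g) = - x g"
  by (cases g) auto

lemma st_xcomm: "st (xcomm i j) = xcomm i j \<or> st (xcomm i j) = - xcomm i j"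
  by (cases i; cases j) (auto simp: comm_def)

lemma st_ad_xcomm: "st (ad gs (xcomm i j)) = ad gs (xcomm i j) \<or> st (ad gs (xcomm i j)) = - ad gs (xcomm i j)"
proof (induction gs rule: rev_induct)
  case Nil
  show ?case using st_xcomm by simp
next
  case (snoc g gs)
  then show ?case using st_gen[of g]
    by (auto simp: comm_def)
qed

text \<open>By \<open>st (comm c (x g)) = st (x g) * st c - st c * st (x g)\<close>, every further
  bracket puts a letter either into the middle factor or at the right end. The induction therefore
  needs the hypothesis for every middle factor \<open>r\<close>.\<close>

lemma st_ad_sum_zero:
  assumes "\<And>r. a1 * r * st c1 + a2 * r * st c2 + a3 * r * st c3 = 0"
  shows "a1 * r * st (ad gs c1) + a2 * r * st (ad gs c2) + a3 * r * st (ad gs c3) = 0"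
proof (induction gs arbitrary: r rule: rev_induct)
  case Nil
  show ?case using assms by simp
next
  case (snoc g gs)
  have e: "a * r * st (comm c (x g)) = a * (r * st (x g)) * st c - a * r * st c * st (x g)" for a c
    by (simp add: comm_def algebra_simps)
  have "a1 * r * st (ad (gs @ [g]) c1) + a2 * r * st (ad (gs @ [g]) c2) + a3 * r * st (ad (gs @ [g]) c3)
    = (a1 * (r * st (x g)) * st (ad gs c1) + a2 * (r * st (x g)) * st (ad gs c2) + a3 * (r * st (x g)) * st (ad gs c3))
     - (a1 * r * st (ad gs c1) + a2 * r * st (ad gs c2) + a3 * r * st (ad gs c3)) * st (x g)"
    by (simp add: e distrib_right)
  then show ?case using snoc by simp
qed

lemma comm_mid_comm_st: "comm a b * r * comm p q * s * st (comm c d) = 0"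
  using comm_mid_comm[of a b r p q s "st d" "st c"] by (simp add: st_comm)

text \<open>Exchanging neighbours changes the iterated commutator by one built on
  \<open>comm (comm p q) (comm (x g) (x h))\<close>. Both of its starred products have a commutator
  standing between two commutators, so they vanish.\<close>

lemma comm_st_ad_perm:
  assumes "mset gs = mset hs"
  shows "comm a b * st (ad gs (comm c d)) = comm a b * st (ad hs (comm c d))"
proof -
  have "comm a b * st (ad gs (comm c d)) - comm a b * st (ad hs (comm c d)) \<in> {0}"
  proof (rule span_adjacent_swaps[OF _ _ assms])
    fix us g h vs
    obtain p q where pq: "ad us (comm c d) = comm p q" using ad_comm_ex by blast
    have z: "comm a b * r * st (comm (comm p q) (comm (x g) (x h))) = 0" for r
    proof -
      have "comm a b * r * st (comm (comm p q) (comm (x g) (x h)))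
        = comm a b * r * comm (st (x h)) (st (x g)) * 1 * st (comm p q) - comm a b * r * comm (st q) (st p) * 1 * st (comm (x g) (x h))"
        unfolding comm_def[of "comm p q"] by (simp add: st_comm right_diff_distrib mult.assoc)
      then show ?thesis by (simp only: comm_mid_comm_st diff_zero)
    qed
    have "comm a b * 1 * st (ad vs (comm (comm p q) (comm (x g) (x h)))) = 0"
      using st_ad_sum_zero[of "comm a b" "comm (comm p q) (comm (x g) (x h))" 0 0 0 0 1 vs] z by simp
    also have "comm (comm p q) (comm (x g) (x h)) = comm (comm (comm p q) (x g)) (x h) - comm (comm (comm p q) (x h)) (x g)"
      by (simp add: comm_def algebra_simps)
    finally show "comm a b * st (ad (us @ g # h # vs) (comm c d)) - comm a b * st (ad (us @ h # g # vs) (comm c d)) \<in> {0}"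
      by (simp add: pq ad_diff right_diff_distrib)
  qed simp
  then show ?thesis by simp
qed

text \<open>The tail is handed over letter by letter with \<open>comm_comm_st\<close>. It arrives in
  a different order, which \<open>comm_st_ad_perm\<close> repairs.\<close>

lemma comm_st_ad_swap: "comm a b * st (ad gs (comm c d)) = comm c d * st (ad gs (comm a b))"
proof (induction gs arbitrary: c d)
  case Nil
  show ?case by (simp add: comm_swap'[of a b])
next
  case (Cons g gs)
  obtain p q where pq: "ad gs (comm a b) = comm p q" using ad_comm_ex by blast
  have "comm a b * st (ad (g # gs) (comm c d)) = comm (comm c d) (x g) * st (comm p q)"
    using Cons.IH[of "comm c d" "x g"] by (simp add: pq)
  also have "\<dots> = comm c d * st (ad (gs @ [g]) (comm a b))"
    by (simp add: comm_comm_st pq)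
  also have "\<dots> = comm c d * st (ad (g # gs) (comm a b))"
    by (rule comm_st_ad_perm) simp
  finally show ?case .
qed

definition comm_prod :: "nat list \<Rightarrow> gen \<Rightarrow> gen \<Rightarrow> gen \<Rightarrow> gen \<Rightarrow> gen list \<Rightarrow> 'r" where
  "comm_prod ys i j k l gs = yword ys * (xcomm i j * st (ad gs (xcomm k l)))"

definition comm_prods :: "'r set" where
  "comm_prods = {comm_prod ys i j k l gs |ys i j k l gs. True}"

lemma comm_mid_comm_st_ad: "comm a b * r * comm p q * st (ad gs (comm c d)) = 0"
proof -
  obtain u v where "ad gs (comm c d) = comm u v" using ad_comm_ex by blast
  then show ?thesis using comm_mid_comm_st[of a b r p q 1 u v] by simp
qed

lemma comm_prod_perm:
  assumes "mset ys = mset ys'" "mset gs = mset hs"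
  shows "comm_prod ys i j k l gs = comm_prod ys' i j k l hs"
proof -
  have "comm_prod ys i j k l gs - comm_prod ys' i j k l gs \<in> {0}"
  proof (rule span_adjacent_swaps[OF _ _ assms(1)])
    fix us a b vs
    have "comm_prod (us @ a # b # vs) i j k l gs - comm_prod (us @ b # a # vs) i j k l gs
      = yword us * (comm (x (Y a)) (x (Y b)) * yword vs * xcomm i j * st (ad gs (xcomm k l)))"
      unfolding comm_def[of "x (Y a)"] by (simp add: comm_prod_def algebra_simps)
    then show "comm_prod (us @ a # b # vs) i j k l gs - comm_prod (us @ b # a # vs) i j k l gs \<in> {0}"
      by (simp add: comm_mid_comm_st_ad)
  qed simp
  then show ?thesis using comm_st_ad_perm[OF assms(2)] by (simp add: comm_prod_def)
qed

lemma comm_prod_anti1: "comm_prod ys j i k l gs = - comm_prod ys i j k l gs"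
  using comm_anti[of "x j" "x i"] by (simp add: comm_prod_def)

lemma comm_prod_swap: "comm_prod ys i j k l gs = comm_prod ys k l i j gs"
  by (simp add: comm_prod_def comm_st_ad_swap[of "x i"])

lemma comm_prod_anti2: "comm_prod ys i j l k gs = - comm_prod ys i j k l gs"
  using comm_prod_anti1 comm_prod_swap by metis

lemma comm_prod_jacobi: "comm_prod ys i j k l (m # gs) - comm_prod ys i j k m (l # gs) + comm_prod ys i j l m (k # gs) = 0"
proof -
  have "comm_prod ys i j k l (m # gs) - comm_prod ys i j k m (l # gs) + comm_prod ys i j l m (k # gs) =
     yword ys * (xcomm i j * st (ad (m # gs) (xcomm k l) - ad (l # gs) (xcomm k m) + ad (k # gs) (xcomm l m)))"
    by (simp add: comm_prod_def algebra_simps)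
  then show ?thesis by (simp only: ad_jacobi) simp
qed

lemma comm_prod_pluecker: "comm_prod ys a b c d gs - comm_prod ys a c b d gs + comm_prod ys a d b c gs = 0"
proof -
  have "xcomm a b * r * st (xcomm c d) + (- xcomm a c) * r * st (xcomm b d) + xcomm a d * r * st (xcomm b c) = 0" for r
    using comm_pluecker_mid[of "x a" "x b" r "x c" "x d"] by simp
  from st_ad_sum_zero[OF this, of 1 gs]
  have "yword ys * (xcomm a b * st (ad gs (xcomm c d)) - xcomm a c * st (ad gs (xcomm b d))
      + xcomm a d * st (ad gs (xcomm b c))) = 0"
    by simp
  then show ?thesis by (simp add: comm_prod_def algebra_simps)
qed

lemma yword_commute:
  "r * yword ys * (xcomm i j * st (ad gs (xcomm k l))) = yword ys * r * (xcomm i j * st (ad gs (xcomm k l)))"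
proof -
  have "comm r (yword ys) * 1 * xcomm i j * st (ad gs (xcomm k l)) = 0"
    by (rule comm_mid_comm_st_ad)
  then show ?thesis unfolding comm_def[of r] by (simp add: algebra_simps)
qed

text \<open>In the expanded bracket with \<open>x (Z n)\<close> the product that has the skew letter
  between the commutators is 0. The other one has it at the right end, from where
  \<open>comm_st_comm_commute\<close> brings it to the front. Hence only symmetric letters are
  needed in front of a product of commutators.\<close>

lemma Z_mult_comm_prod: "x (Z n) * comm_prod ys i j k l gs = - comm_prod ys i j k l (gs @ [Z n])"
proof -
  obtain p q where pq: "ad gs (xcomm k l) = comm p q" using ad_comm_ex by blast
  have "xcomm i j * x (Z n) * st (comm p q) = 0"
    using comm_skew_comm[of "x (Z n)" "x i" "x j" "st q" "st p"] by (simp add: st_comm)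
  then have "xcomm i j * st (comm (comm p q) (x (Z n))) = xcomm i j * st (comm p q) * x (Z n)"
    unfolding comm_def[of "comm p q"] by (simp add: algebra_simps)
  also have "\<dots> = - (x (Z n) * (xcomm i j * st (comm p q)))"
    by (simp add: comm_st_comm_commute)
  finally show ?thesis
    using yword_commute[of "x (Z n)" ys i j gs k l] by (simp add: comm_prod_def pq mult.assoc[symmetric])
qed

lemma comm_prods_left: "a \<in> span comm_prods \<Longrightarrow> r * a \<in> span comm_prods"
proof (rule span_ideal_left)
  fix g b assume "b \<in> comm_prods"
  then obtain ys i j k l gs where b: "b = comm_prod ys i j k l gs" by (auto simp: comm_prods_def)
  show "x g * b \<in> span comm_prods"
  proof (cases g)
    case (Y n)
    then have "x g * b = comm_prod (n # ys) i j k l gs" by (simp add: b comm_prod_def mult.assoc)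
    then show ?thesis unfolding comm_prods_def by (intro span_base) blast
  next
    case (Z n)
    have "comm_prod ys i j k l (gs @ [Z n]) \<in> span comm_prods" unfolding comm_prods_def by (intro span_base) blast
    then show ?thesis using Z Z_mult_comm_prod by (simp add: b span_neg)
  qed
qed

lemma comm_prods_right: "a \<in> span comm_prods \<Longrightarrow> a * r \<in> span comm_prods"
proof (rule span_ideal_right)
  fix g b assume bP: "b \<in> comm_prods"
  then obtain ys i j k l gs where b: "b = comm_prod ys i j k l gs" by (auto simp: comm_prods_def)
  obtain p q where pq: "ad gs (xcomm k l) = comm p q" using ad_comm_ex by blast
  have "b * x g = yword ys * (st (x g) * (xcomm i j * st (comm p q)))"
    using comm_st_comm_commute[of "st (x g)" "x i" "x j" p q] by (simp add: b comm_prod_def pq mult.assoc)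
  also have "\<dots> = st (x g) * b"
    using yword_commute[of "st (x g)" ys i j gs k l] by (simp add: b comm_prod_def pq mult.assoc)
  finally show "b * x g \<in> span comm_prods" using comm_prods_left[OF span_base[OF bP]] by simp
qed

section \<open>The commutator ideal, spanned by \<open>comm_words\<close>, and its square\<close>

definition comm_words :: "'r set" where
  "comm_words = {word u * xcomm i j * word v |u i j v. True}"

lemma comm_words_left: "a \<in> span comm_words \<Longrightarrow> r * a \<in> span comm_words"
proof (rule span_ideal_left)
  fix g b assume "b \<in> comm_words"
  then obtain u i j v where "b = word u * xcomm i j * word v" by (auto simp: comm_words_def)
  then have "x g * b = word (g # u) * xcomm i j * word v" by (simp add: mult.assoc)
  then show "x g * b \<in> span comm_words" unfolding comm_words_def by (intro span_base) blast
qed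

lemma comm_words_right: "a \<in> span comm_words \<Longrightarrow> a * r \<in> span comm_words"
proof (rule span_ideal_right)
  fix g b assume "b \<in> comm_words"
  then obtain u i j v where "b = word u * xcomm i j * word v" by (auto simp: comm_words_def)
  then have "b * x g = word u * xcomm i j * word (v @ [g])" by (simp add: mult.assoc)
  then show "b * x g \<in> span comm_words" unfolding comm_words_def by (intro span_base) blast
qed

lemma xcomm_in_comm_words: "xcomm i j \<in> span comm_words"
proof -
  have "word [] * xcomm i j * word [] \<in> span comm_words" unfolding comm_words_def by (intro span_base) blast
  then show ?thesis by simp
qed

lemma comm_in_comm_words: "comm a b \<in> span comm_words"
proof -
  have 1: "comm (word u) (x g) \<in> span comm_words" for u g
  proof (induction u)
    case Nil
    show ?case by (simp add: comm_def span_zero)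
  next
    case (Cons h u)
    have "comm (word (h # u)) (x g) = x h * comm (word u) (x g) + comm (x h) (x g) * word u"
      by (simp add: comm_def algebra_simps)
    then show ?case using Cons comm_words_left comm_words_right xcomm_in_comm_words span_add by metis
  qed
  have 2: "comm (word u) (word v) \<in> span comm_words" for u v
  proof (induction v)
    case Nil
    show ?case by (simp add: comm_def span_zero)
  next
    case (Cons h v)
    have "comm (word u) (word (h # v)) = comm (word u) (x h) * word v + x h * comm (word u) (word v)"
      by (simp add: comm_def algebra_simps)
    then show ?case using Cons comm_words_left comm_words_right 1 span_add by metis
  qed
  have 3: "comm a (word v) \<in> span comm_words" for a v
    using span_words[of a]
  proof (induction rule: span_induct_alt)
    case base
    show ?case by (simp add: comm_def span_zero)
  next
    case (step c p q)
    have "comm (smul c p + q) (word v) = smul c (comm p (word v)) + comm q (word v)"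
      by (simp add: comm_def algebra_simps smul_mult_left smul_mult_right scale_right_diff_distrib)
    then show ?case using step 2 by (auto intro!: span_add span_scale)
  qed
  show ?thesis
    using span_words[of b]
  proof (induction rule: span_induct_alt)
    case base
    show ?case by (simp add: comm_def span_zero)
  next
    case (step c p q)
    have "comm a (smul c p + q) = smul c (comm a p) + comm a q"
      by (simp add: comm_def algebra_simps smul_mult_left smul_mult_right scale_right_diff_distrib)
    then show ?case using step 3 by (auto intro!: span_add span_scale)
  qed
qed

text \<open>The middle word is pulled out to the left by
  \<open>c * x g = x g * c + comm c (x g)\<close>. The second summand lengthens the iterated
  commutator, so the induction has to run over all \<open>gs\<close>.\<close>

lemma xcomm_word_xcomm: "ad gs (xcomm i j) * word w * xcomm k l \<in> span comm_prods"
proof (induction w arbitrary: gs)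
  case Nil
  obtain p q where pq: "ad gs (xcomm i j) = comm p q" using ad_comm_ex by blast
  have "comm p q * st (xcomm k l) = comm_prod [] k l i j gs"
    by (simp add: comm_prod_def pq comm_swap'[of p])
  then have "comm p q * st (xcomm k l) \<in> span comm_prods"
    unfolding comm_prods_def by (intro span_base) blast
  then show ?case using st_xcomm[of k l] span_neg by (auto simp: pq) (metis minus_minus mult_minus_right span_neg)
next
  case (Cons g w)
  have "ad gs (xcomm i j) * word (g # w) * xcomm k l
    = x g * (ad gs (xcomm i j) * word w * xcomm k l) + ad (gs @ [g]) (xcomm i j) * word w * xcomm k l"
    unfolding ad_append ad_Cons ad_Nil comm_def[of "ad gs (xcomm i j)"] by (simp add: algebra_simps)
  then show ?case using Cons.IH[of gs] Cons.IH[of "gs @ [g]"] comm_prods_left span_add by metis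
qed

text \<open>The square of the commutator ideal consists of combinations of
  \<open>comm_prods\<close>. The error terms of most later rearrangements land here.\<close>

lemma comm_words_mult_comm_words:
  assumes "a \<in> span comm_words" "b \<in> span comm_words"
  shows "a * b \<in> span comm_prods"
proof (rule span_mult_right[OF assms(1)])
  fix a assume "a \<in> comm_words"
  then obtain u i j v where a: "a = word u * xcomm i j * word v" by (auto simp: comm_words_def)
  show "a * b \<in> span comm_prods"
  proof (rule span_mult_left[OF assms(2)])
    fix b assume "b \<in> comm_words"
    then obtain u' k l v' where b: "b = word u' * xcomm k l * word v'" by (auto simp: comm_words_def)
    have "a * b = word u * (ad [] (xcomm i j) * word (v @ u') * xcomm k l) * word v'"
      by (simp add: a b mult.assoc)
    then show "a * b \<in> span comm_prods" using xcomm_word_xcomm comm_prods_left comm_prods_right by metis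
  qed
qed

end

section \<open>The commutator ideal\<close>

context ut3_star_quotient
begin

abbreviation zword :: "nat list \<Rightarrow> 'r" where
  "zword \<gamma> \<equiv> prod_list (map (\<lambda>n. x (Z n)) \<gamma>)"

definition sandwich :: "nat list \<Rightarrow> nat \<Rightarrow> nat \<Rightarrow> nat \<Rightarrow> nat \<Rightarrow> nat list \<Rightarrow> 'r" where
  "sandwich ys n a b c \<gamma> = yword ys * (x (Z a) * xcomm (Y n) (Z b) * x (Z c)) * zword \<gamma>"

definition sandwiches :: "'r set" where
  "sandwiches = {sandwich ys n a b c \<gamma> |ys n a b c \<gamma>. True}"

text \<open>The generic matrices of these elements have zero entries (1, 1), (1, 2) and (2, 3), see
  \<open>\<Phi>_sandwich\<close> and \<open>\<Phi>_comm_prod\<close>; only the entry (1, 3)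
  distinguishes them.\<close>

definition kernel_elems :: "'r set" where
  "kernel_elems = sandwiches \<union> comm_prods"

lemma sandwich_in_kernel_elems: "sandwich ys n a b c \<gamma> \<in> span kernel_elems"
  unfolding kernel_elems_def sandwiches_def by (intro span_base) blast

lemma comm_prods_in_kernel_elems: "a \<in> span comm_prods \<Longrightarrow> a \<in> span kernel_elems"
  using span_mono[of comm_prods kernel_elems] unfolding kernel_elems_def by blast

lemma ZCZ_gen: "x (Z a) * xcomm (Y n) (Z b) * x (Z c) \<in> span comm_words"
  by (intro comm_words_left comm_words_right xcomm_in_comm_words)

lemma Z_commute_gen:
  "x (Z a) * xcomm i j * x (Z c) * r = st r * (x (Z a) * xcomm i j * x (Z c))"
  by (rule skew_comm_skew_mult) simp_all

lemma kernel_elems_left: "a \<in> span kernel_elems \<Longrightarrow> r * a \<in> span kernel_elems"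
proof (rule span_ideal_left)
  fix g b assume "b \<in> kernel_elems"
  then consider "b \<in> comm_prods" | ys n a1 a2 a3 \<gamma> where "b = sandwich ys n a1 a2 a3 \<gamma>"
    by (auto simp: kernel_elems_def sandwiches_def)
  then show "x g * b \<in> span kernel_elems"
  proof cases
    case 1
    then show ?thesis by (intro comm_prods_in_kernel_elems comm_prods_left span_base)
  next
    case 2
    show ?thesis
    proof (cases g)
      case (Y k)
      then have "x g * b = sandwich (k # ys) n a1 a2 a3 \<gamma>" by (simp add: 2 sandwich_def mult.assoc)
      then show ?thesis using sandwich_in_kernel_elems by simp
    next
      case (Z k)
      let ?e = "x (Z a1) * xcomm (Y n) (Z a2) * x (Z a3)"
      \<comment> \<open>Passing the letter through the symmetric letters costs a product of two
        elements of the commutator ideal; passing it through the core \<open>?e\<close> is relation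
        (vi).\<close>
      have "x g * b = comm (x g) (yword ys) * (?e * zword \<gamma>) + yword ys * (x g * ?e) * zword \<gamma>"
        unfolding comm_def[of "x g"] by (simp add: 2 sandwich_def algebra_simps)
      also have "x g * ?e = - (?e * x g)"
        using Z Z_commute_gen[of a1 "Y n" "Z a2" a3 "x g"] by simp
      finally have e: "x g * b = comm (x g) (yword ys) * (?e * zword \<gamma>) - sandwich ys n a1 a2 a3 (k # \<gamma>)"
        using Z by (simp add: sandwich_def mult.assoc)
      have "comm (x g) (yword ys) * (?e * zword \<gamma>) \<in> span kernel_elems"
        by (intro comm_prods_in_kernel_elems comm_words_mult_comm_words comm_in_comm_words comm_words_right[OF ZCZ_gen])
      then show ?thesis unfolding e by (intro span_diff sandwich_in_kernel_elems)
    qed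
  qed
qed

lemma kernel_elems_right: "a \<in> span kernel_elems \<Longrightarrow> a * r \<in> span kernel_elems"
proof (rule span_ideal_right)
  fix g b assume "b \<in> kernel_elems"
  then consider "b \<in> comm_prods" | ys n a1 a2 a3 \<gamma> where "b = sandwich ys n a1 a2 a3 \<gamma>"
    by (auto simp: kernel_elems_def sandwiches_def)
  then show "b * x g \<in> span kernel_elems"
  proof cases
    case 1
    then show ?thesis by (intro comm_prods_in_kernel_elems comm_prods_right span_base)
  next
    case 2
    show ?thesis
    proof (cases g)
      case (Z k)
      then have "b * x g = sandwich ys n a1 a2 a3 (\<gamma> @ [k])" by (simp add: 2 sandwich_def mult.assoc)
      then show ?thesis using sandwich_in_kernel_elems by simp
    next
      case (Y k)
      let ?e = "x (Z a1) * xcomm (Y n) (Z a2) * x (Z a3)"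
      have "b * x g = (yword ys * ?e) * comm (zword \<gamma>) (x g) + yword ys * (?e * x g) * zword \<gamma>"
        unfolding comm_def[of "zword \<gamma>"] by (simp add: 2 sandwich_def algebra_simps)
      also have "?e * x g = x g * ?e"
        using Y Z_commute_gen[of a1 "Y n" "Z a2" a3 "x g"] by simp
      finally have e: "b * x g = (yword ys * ?e) * comm (zword \<gamma>) (x g) + sandwich (ys @ [k]) n a1 a2 a3 \<gamma>"
        using Y by (simp add: sandwich_def mult.assoc)
      have "(yword ys * ?e) * comm (zword \<gamma>) (x g) \<in> span kernel_elems"
        by (intro comm_prods_in_kernel_elems comm_words_mult_comm_words comm_in_comm_words comm_words_left[OF ZCZ_gen])
      then show ?thesis unfolding e by (intro span_add sandwich_in_kernel_elems)
    qed
  qed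
qed

text \<open>The cyclic relation for the skew elements \<open>comm a b\<close>, \<open>p\<close>,
  \<open>q\<close>, together with the exchange of outer factors and the commutation of skew
  commutators, gives twice the claim. So a skew commutator between skew letters is merely a product
  of two commutators, and \<open>sandwich\<close> needs only the mixed ones.\<close>

lemma skew_comm_sandwich:
  assumes "st p = - p" "st q = - q" "st (comm a b) = - comm a b"
  shows "p * comm a b * q = comm a b * comm p q"
proof -
  let ?u = "comm a b"
  have 1: "?u * comm p q - p * comm ?u q + q * comm ?u p = 0"
    by (rule skew_cyclic) (use assms in auto)
  have 2: "p * ?u * q = - (q * ?u * p)"
    using skew_comm_skew[OF assms(1,2), of a b] assms(3) by simp
  have "st (comm p q) = - comm p q"
    using assms(1,2) by (simp add: comm_def)
  then have 3: "?u * comm p q = comm p q * ?u"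
    using comm_swap'[of a b p q] assms(3) by simp
  have "?u * comm p q - p * ?u * q + q * ?u * p + comm p q * ?u = 0"
    using 1 unfolding comm_def[of ?u] comm_def[of p q] by (simp add: algebra_simps)
  then have "(?u * comm p q - p * ?u * q) + (?u * comm p q - p * ?u * q) = 0"
    using 2 3 by (simp add: algebra_simps)
  then have "?u * comm p q - p * ?u * q = 0" by (rule double_zero)
  then show ?thesis by simp
qed

lemma ZxcommZ_in_kernel_elems: "x (Z a) * xcomm i j * x (Z b) \<in> span kernel_elems"
proof (cases i; cases j)
  fix n m
  have *: "x (Z a) * xcomm (Y n) (Z m) * x (Z b) \<in> span kernel_elems" for n m
    using sandwich_in_kernel_elems[of "[]" n a m b "[]"] by (simp add: sandwich_def)
  show "x (Z a) * xcomm i j * x (Z b) \<in> span kernel_elems" if "i = Y n" "j = Z m"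
    using * that by simp
  show "x (Z a) * xcomm i j * x (Z b) \<in> span kernel_elems" if "i = Z n" "j = Y m"
    using span_neg[OF *[of m n]] that comm_anti[of "x (Z n)" "x (Y m)"] by simp
  have s: "x (Z a) * xcomm i j * x (Z b) \<in> span kernel_elems" if "st (xcomm i j) = - xcomm i j"
  proof -
    have "xcomm i j * xcomm (Z a) (Z b) \<in> span kernel_elems"
      by (intro comm_prods_in_kernel_elems comm_words_mult_comm_words xcomm_in_comm_words)
    then show ?thesis by (subst skew_comm_sandwich) (use that in auto)
  qed
  show "x (Z a) * xcomm i j * x (Z b) \<in> span kernel_elems" if "i = Y n" "j = Y m"
    by (rule s) (use that in \<open>simp add: comm_def\<close>)
  show "x (Z a) * xcomm i j * x (Z b) \<in> span kernel_elems" if "i = Z n" "j = Z m"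
    by (rule s) (use that in \<open>simp add: comm_def\<close>)
qed

text \<open>The words around the inner commutator are moved outwards past the skew letters; each
  move costs a product of two elements of the commutator ideal.\<close>

lemma ZCZ_in_kernel_elems:
  assumes "c \<in> span comm_words"
  shows "x (Z a) * c * x (Z b) \<in> span kernel_elems"
proof -
  have g: "x (Z a) * c * x (Z b) \<in> span kernel_elems" if "c \<in> comm_words" for c
  proof -
    from that obtain u i j v where c: "c = word u * xcomm i j * word v" by (auto simp: comm_words_def)
    have e: "x (Z a) * c * x (Z b) = word u * (x (Z a) * xcomm i j * x (Z b)) * word v
      + comm (x (Z a)) (word u) * (xcomm i j * (word v * x (Z b)))
      + (word u * (x (Z a) * xcomm i j)) * comm (word v) (x (Z b))"
      unfolding c comm_def[of "x (Z a)"] comm_def[of "word v"] by (simp add: algebra_simps)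
    have 1: "word u * (x (Z a) * xcomm i j * x (Z b)) * word v \<in> span kernel_elems"
      by (intro kernel_elems_left kernel_elems_right ZxcommZ_in_kernel_elems)
    have 2: "comm (x (Z a)) (word u) * (xcomm i j * (word v * x (Z b))) \<in> span kernel_elems"
      by (intro comm_prods_in_kernel_elems comm_words_mult_comm_words comm_in_comm_words comm_words_right xcomm_in_comm_words)
    have 3: "(word u * (x (Z a) * xcomm i j)) * comm (word v) (x (Z b)) \<in> span kernel_elems"
      by (intro comm_prods_in_kernel_elems comm_words_mult_comm_words comm_in_comm_words comm_words_left xcomm_in_comm_words)
    show ?thesis unfolding e by (intro span_add 1 2 3)
  qed
  have "x (Z a) * c \<in> span ((*) (x (Z a)) ` comm_words)"
    by (rule span_mult_left[OF assms]) (intro span_base imageI)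
  then show ?thesis
    by (rule span_mult_right) (use g in auto)
qed

section \<open>A spanning set of the commutator ideal\<close>

definition left_comm :: "nat list \<Rightarrow> gen \<Rightarrow> gen \<Rightarrow> gen list \<Rightarrow> 'r" where
  "left_comm ys i j gs = yword ys * ad gs (xcomm i j)"

text \<open>A single trailing skew letter suffices: of two, the first can be bracketed into the
  commutator, up to terms with skew letters on both sides and products of commutators, all of which
  lie in the span of \<open>kernel_elems\<close>.\<close>

definition right_comm :: "nat list \<Rightarrow> gen \<Rightarrow> gen \<Rightarrow> gen list \<Rightarrow> nat \<Rightarrow> 'r" where
  "right_comm ys i j gs k = st (ad gs (xcomm i j)) * yword ys * x (Z k)"

definition comm_normals :: "'r set" where
  "comm_normals = {left_comm ys i j gs |ys i j gs. True} \<union> {right_comm ys i j gs k |ys i j gs k. True} \<union> kernel_elems"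

lemma left_comm_in_comm_normals: "left_comm ys i j gs \<in> span comm_normals"
  unfolding comm_normals_def by (intro span_base) blast

lemma right_comm_in_comm_normals: "right_comm ys i j gs k \<in> span comm_normals"
  unfolding comm_normals_def by (intro span_base) blast

lemma kernel_elems_in_comm_normals: "a \<in> span kernel_elems \<Longrightarrow> a \<in> span comm_normals"
  using span_mono[of kernel_elems comm_normals] unfolding comm_normals_def by blast

lemma right_comm_in_comm_normals': "ad gs (xcomm i j) * yword ys * x (Z k) \<in> span comm_normals"
  using right_comm_in_comm_normals[of ys i j gs k] span_neg[OF right_comm_in_comm_normals[of ys i j gs k]] st_ad_xcomm[of gs i j]
  unfolding right_comm_def by auto

lemma ad_in_comm_words: "ad gs (xcomm i j) \<in> span comm_words"
  using ad_comm_ex comm_in_comm_words by metis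

text \<open>Symmetric letters in front are pushed through by
  \<open>x (Y n) * c = c * x (Y n) - comm c (x (Y n))\<close>. In front of a trailing skew letter
  they have to stand to the right of the commutator.\<close>

lemma yword_N2_in_comm_normals: "yword ys' * (ad gs (xcomm i j) * yword ys * x (Z k)) \<in> span comm_normals"
proof (induction ys' arbitrary: gs ys rule: rev_induct)
  case Nil
  show ?case using right_comm_in_comm_normals' by simp
next
  case (snoc n ys')
  have "yword (ys' @ [n]) * (ad gs (xcomm i j) * yword ys * x (Z k))
    = yword ys' * (ad gs (xcomm i j) * yword (n # ys) * x (Z k))
      - yword ys' * (ad (gs @ [Y n]) (xcomm i j) * yword ys * x (Z k))"
    unfolding ad_append ad_Cons ad_Nil comm_def[of "ad gs (xcomm i j)"] by (simp add: algebra_simps)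
  then show ?case using snoc[of gs "n # ys"] snoc[of "gs @ [Y n]" ys] span_diff by metis
qed

lemma N1_mult_Z_in_comm_normals: "left_comm ys i j gs * x (Z k) \<in> span comm_normals"
  using yword_N2_in_comm_normals[of ys gs i j "[]" k] by (simp add: left_comm_def mult.assoc)

lemma comm_normals_left: "a \<in> span comm_normals \<Longrightarrow> r * a \<in> span comm_normals"
proof (rule span_ideal_left)
  fix g b assume "b \<in> comm_normals"
  then consider "b \<in> kernel_elems" | ys i j gs where "b = left_comm ys i j gs" | ys i j gs k where "b = right_comm ys i j gs k"
    by (auto simp: comm_normals_def)
  then show "x g * b \<in> span comm_normals"
  proof cases
    case 1
    then show ?thesis by (intro kernel_elems_in_comm_normals kernel_elems_left span_base)
  next
    case 2
    show ?thesis
    proof (cases g)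
      case (Y n)
      then show ?thesis using left_comm_in_comm_normals[of "n # ys" i j gs] by (simp add: 2 left_comm_def mult.assoc)
    next
      case (Z n)
      have e: "x g * b = comm (x g) (yword ys) * ad gs (xcomm i j) + left_comm ys i j gs * x (Z n)
          - left_comm ys i j (gs @ [Z n])"
        unfolding 2 left_comm_def Z ad_append ad_Cons ad_Nil comm_def[of "x (Z n)"] comm_def[of "ad gs (xcomm i j)"]
        by (simp add: algebra_simps)
      show ?thesis unfolding e
        by (intro span_add span_diff left_comm_in_comm_normals N1_mult_Z_in_comm_normals kernel_elems_in_comm_normals comm_prods_in_kernel_elems comm_words_mult_comm_words comm_in_comm_words ad_in_comm_words)
    qed
  next
    case 3
    show ?thesis
    proof (cases g)
      case (Y n)
      have "x g * (ad gs (xcomm i j) * yword ys * x (Z k)) \<in> span comm_normals"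
        using yword_N2_in_comm_normals[of "[n]" gs i j ys k] Y by simp
      from this span_neg[OF this] show ?thesis using st_ad_xcomm[of gs i j]
        unfolding 3 right_comm_def by auto
    next
      case (Z n)
      have "x (Z n) * (ad gs (xcomm i j) * yword ys) * x (Z k) \<in> span comm_normals"
        by (intro kernel_elems_in_comm_normals ZCZ_in_kernel_elems comm_words_right ad_in_comm_words)
      from this span_neg[OF this] show ?thesis using st_ad_xcomm[of gs i j]
        unfolding 3 right_comm_def Z by (auto simp: mult.assoc)
    qed
  qed
qed

lemma comm_normals_right: "a \<in> span comm_normals \<Longrightarrow> a * r \<in> span comm_normals"
proof (rule span_ideal_right)
  fix g b assume "b \<in> comm_normals"
  then consider "b \<in> kernel_elems" | ys i j gs where "b = left_comm ys i j gs" | ys i j gs k where "b = right_comm ys i j gs k"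
    by (auto simp: comm_normals_def)
  then show "b * x g \<in> span comm_normals"
  proof cases
    case 1
    then show ?thesis by (intro kernel_elems_in_comm_normals kernel_elems_right span_base)
  next
    case 2
    show ?thesis
    proof (cases g)
      case (Z n)
      then show ?thesis using N1_mult_Z_in_comm_normals by (simp add: 2)
    next
      case (Y n)
      have e: "b * x g = left_comm (ys @ [n]) i j gs + left_comm ys i j (gs @ [Y n])"
        unfolding 2 left_comm_def Y ad_append ad_Cons ad_Nil comm_def[of "ad gs (xcomm i j)"]
        by (simp add: algebra_simps)
      show ?thesis unfolding e
        by (intro span_add left_comm_in_comm_normals)
    qed
  next
    case 3
    let ?c = "ad gs (xcomm i j)"
    have "?c * yword ys * x (Z k) * x g \<in> span comm_normals"
    proof (cases g)
      case (Y n)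
      have e: "?c * yword ys * x (Z k) * x g = ?c * yword (ys @ [n]) * x (Z k)
          + ?c * (yword ys * comm (x (Z k)) (x (Y n)))"
        unfolding Y comm_def[of "x (Z k)"] by (simp add: algebra_simps)
      show ?thesis unfolding e
        by (intro span_add right_comm_in_comm_normals' kernel_elems_in_comm_normals comm_prods_in_kernel_elems comm_words_mult_comm_words ad_in_comm_words comm_words_left comm_in_comm_words)
    next
      case (Z n)
      \<comment> \<open>The first of the two skew letters is moved to the commutator and through it.
        It either becomes a bracket or ends up on the left, opposite to the other skew
        letter.\<close>
      have e: "?c * yword ys * x (Z k) * x g = ad (gs @ [Z k]) (xcomm i j) * yword ys * x (Z n)
          + x (Z k) * (?c * yword ys) * x (Z n) + ?c * (comm (yword ys) (x (Z k)) * x (Z n))"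
        unfolding Z ad_append ad_Cons ad_Nil comm_def[of "yword ys"] comm_def[of "?c"] by (simp add: algebra_simps)
      show ?thesis unfolding e
        by (intro span_add right_comm_in_comm_normals'; intro kernel_elems_in_comm_normals ZCZ_in_kernel_elems comm_prods_in_kernel_elems comm_words_mult_comm_words ad_in_comm_words comm_words_right comm_in_comm_words)
    qed
    from this span_neg[OF this] show ?thesis using st_ad_xcomm[of gs i j]
      unfolding 3 right_comm_def by auto
  qed
qed

lemma comm_words_in_comm_normals:
  assumes "a \<in> span comm_words"
  shows "a \<in> span comm_normals"
proof -
  have "xcomm i j \<in> span comm_normals" for i j
    using left_comm_in_comm_normals[of "[]" i j "[]"] by (simp add: left_comm_def)
  then have "word u * xcomm i j * word v \<in> span comm_normals" for u i j v
    by (intro comm_normals_left comm_normals_right)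
  then have "comm_words \<subseteq> span comm_normals" by (auto simp: comm_words_def)
  then show ?thesis using assms span_minimal[OF _ subspace_span] by blast
qed

end

section \<open>Straightening\<close>

text \<open>Symmetric letters precede skew ones. So the largest letter of a list containing a skew
  letter is skew, which allows the outer letter of \<open>right_comm\<close> to be the largest; and
  if the least letter is skew, all letters are.\<close>

instantiation gen :: linorder
begin

fun less_eq_gen :: "gen \<Rightarrow> gen \<Rightarrow> bool" where
  "less_eq_gen (Y i) (Y j) = (i \<le> j)"
| "less_eq_gen (Y i) (Z j) = True"
| "less_eq_gen (Z i) (Y j) = False"
| "less_eq_gen (Z i) (Z j) = (i \<le> j)"

definition less_gen :: "gen \<Rightarrow> gen \<Rightarrow> bool" where
  "less_gen g h \<longleftrightarrow> g \<le> h \<and> \<not> h \<le> g"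

instance
proof
  fix g h k :: gen
  show "g < h \<longleftrightarrow> g \<le> h \<and> \<not> h \<le> g" by (rule less_gen_def)
  show "g \<le> g" by (cases g) auto
  show "g \<le> k" if "g \<le> h" "h \<le> k" using that by (cases g; cases h; cases k) auto
  show "g = h" if "g \<le> h" "h \<le> g" using that by (cases g; cases h) auto
  show "g \<le> h \<or> h \<le> g" by (cases g; cases h) auto
qed

end

lemma Z_le_iff: "Z n \<le> g \<longleftrightarrow> (\<exists>m\<ge>n. g = Z m)"
  by (cases g) auto

lemma obtain_min_list:
  fixes xs :: "'a::linorder list"
  assumes "xs \<noteq> []"
  obtains m ys where "m \<in> set xs" "\<And>g. g \<in> set xs \<Longrightarrow> m \<le> g" "mset xs = mset (m # ys)"
proof -
  let ?m = "Min (set xs)"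
  have m: "?m \<in> set xs" using assms by simp
  then obtain ps qs where "xs = ps @ ?m # qs" by (meson split_list)
  then have "mset xs = mset (?m # ps @ qs)" by (metis mset_append mset.simps(2) union_mset_add_mset_right)
  then show ?thesis by (rule that[OF m, rotated]) simp
qed

context ut3_star_quotient
begin

text \<open>These are semistandard tableaux with first row \<open>i\<close>, \<open>k\<close>,
  \<open>gs\<close> and second row \<open>j\<close>, \<open>l\<close>: rows increase weakly, the two
  columns of length two strictly.\<close>

definition std_comm_prods :: "'r set" where
  "std_comm_prods = {comm_prod ys i j k l gs |ys i j k l gs.
     sorted ys \<and> sorted (k # gs) \<and> i < j \<and> k < l \<and> i \<le> k \<and> j \<le> l}"

lemma comm_prod_eq_zero: "comm_prod ys i i k l gs = 0" "comm_prod ys i j k k gs = 0"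
  by (simp_all add: comm_prod_def comm_def flip: comm_def) (simp_all add: comm_def)

lemma comm_prod_standard:
  assumes "i < j" "k < l" "i \<le> k" "j \<le> l" "\<And>g. g \<in> set gs \<Longrightarrow> k \<le> g"
  shows "comm_prod ys i j k l gs \<in> span std_comm_prods"
proof -
  have "comm_prod ys i j k l gs = comm_prod (sort ys) i j k l (sort gs)"
    by (rule comm_prod_perm) auto
  also have "\<dots> \<in> std_comm_prods"
  proof -
    have "sorted (sort ys)" "sorted (k # sort gs)" using assms by auto
    then show ?thesis unfolding std_comm_prods_def using assms by blast
  qed
  finally show ?thesis by (rule span_base)
qed

text \<open>With \<open>i\<close> and \<open>k\<close> as the two least letters only
  \<open>l < j\<close> can go wrong. Pluecker exchanges \<open>j\<close> and \<open>l\<close> at the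
  price of \<open>comm_prod ys i k l j gs\<close>. There a tail letter may be less than
  \<open>l\<close>; the Jacobi identity then puts the least tail letter in the place of
  \<open>l\<close>.\<close>

lemma comm_prod_straighten3:
  assumes "i < j" "k < l" "i \<le> k" "k \<le> j" "\<And>g. g \<in> set gs \<Longrightarrow> k \<le> g"
  shows "comm_prod ys i j k l gs \<in> span std_comm_prods"
proof (cases "j \<le> l")
  case True
  then show ?thesis using comm_prod_standard assms by blast
next
  case False
  have 1: "comm_prod ys i l k j gs \<in> span std_comm_prods"
    by (rule comm_prod_standard) (use assms False in auto)
  have 2: "comm_prod ys i k l j gs \<in> span std_comm_prods"
  proof (cases "i = k")
    case True
    then show ?thesis by (simp add: comm_prod_eq_zero span_zero)
  next
    case ik: False
    show ?thesis
    proof (cases "\<forall>g\<in>set gs. l \<le> g")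
      case True
      then show ?thesis by (intro comm_prod_standard) (use assms False ik in auto)
    next
      case nl: False
      then have "gs \<noteq> []" by auto
      then obtain m hs where m: "m \<in> set gs" "\<And>g. g \<in> set gs \<Longrightarrow> m \<le> g" and hs: "mset gs = mset (m # hs)"
        using obtain_min_list by metis
      have ml: "m < l" using nl m(2) by force
      have hsm: "m \<le> g" if "g \<in> set hs" for g
        using that m(2) hs by (metis list.set_intros(2) set_mset_mset)
      have km: "k \<le> m" using assms(5) m(1) by blast
      have "comm_prod ys i k l j gs = comm_prod ys i k l j (m # hs)"
        by (rule comm_prod_perm) (use hs in auto)
      also have "\<dots> = comm_prod ys i k m j (l # hs) - comm_prod ys i k m l (j # hs)"
        using comm_prod_jacobi[of ys i k l j m hs] comm_prod_anti2[of ys i k m l] comm_prod_anti2[of ys i k m j]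
        by (simp add: algebra_simps)
      also have "\<dots> \<in> span std_comm_prods"
        by (intro span_diff comm_prod_standard) (use assms False ik ml km hsm in auto)
      finally show ?thesis .
    qed
  qed
  have "comm_prod ys i j k l gs = comm_prod ys i l k j gs - comm_prod ys i k l j gs"
    using comm_prod_pluecker[of ys i k l j gs] by (simp add: algebra_simps)
  then show ?thesis using 1 2 span_diff by simp
qed

text \<open>With \<open>i\<close> least, the least letter \<open>n\<close> of the others is brought
  to the third place: by antisymmetry from \<open>l\<close>, by Pluecker from \<open>j\<close>, by
  Jacobi from the tail.\<close>

lemma comm_prod_straighten2:
  assumes "i < j" "i \<le> k" "i \<le> l" "\<And>g. g \<in> set gs \<Longrightarrow> i \<le> g"
  shows "comm_prod ys i j k l gs \<in> span std_comm_prods"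
proof -
  obtain n hs where n: "n \<in> set (j # k # l # gs)" "\<And>g. g \<in> set (j # k # l # gs) \<Longrightarrow> n \<le> g"
    using obtain_min_list[of "j # k # l # gs"] by (metis list.distinct(1))
  have i_n: "i \<le> n" using n(1) assms by auto
  have std: "comm_prod ys i j n p ks \<in> span std_comm_prods" if "n \<le> p" "\<And>g. g \<in> set ks \<Longrightarrow> n \<le> g" for p ks
  proof (cases "n = p")
    case True
    then show ?thesis by (simp add: comm_prod_eq_zero span_zero)
  next
    case False
    then show ?thesis by (intro comm_prod_straighten3) (use that i_n n assms in auto)
  qed
  consider "n = k" | "n = l" | "n = j" | "n \<in> set gs" using n(1) by auto
  then show ?thesis
  proof cases
    case 1
    then show ?thesis using std[of l gs] n(2) by simp
  next
    case 2
    then show ?thesis using span_neg[OF std[of k gs]] n(2) comm_prod_anti2[of ys i j l k] by simp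
  next
    case 3
    have b: "comm_prod ys i p j q gs \<in> span std_comm_prods" if "j \<le> p" "j \<le> q" for p q
    proof (cases "j = q")
      case True
      then show ?thesis by (simp add: comm_prod_eq_zero span_zero)
    next
      case False
      then show ?thesis by (intro comm_prod_straighten3) (use that 3 n(2) assms in auto)
    qed
    have "comm_prod ys i j k l gs = comm_prod ys i k j l gs - comm_prod ys i l j k gs"
      using comm_prod_pluecker[of ys i j k l gs] by (simp add: algebra_simps)
    then show ?thesis using b[of k l] b[of l k] n(2) 3 span_diff by simp
  next
    case 4
    then obtain hs where hs: "mset gs = mset (n # hs)"
      by (metis ex_mset insert_DiffM mset.simps(2) set_mset_mset)
    have hsn: "n \<le> g" if "g \<in> set hs" for g
      using that n(2) hs by (metis list.set_intros(2) set_mset_mset)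
    have "comm_prod ys i j k l gs = comm_prod ys i j k l (n # hs)"
      by (rule comm_prod_perm) (use hs in auto)
    also have "\<dots> = comm_prod ys i j n l (k # hs) - comm_prod ys i j n k (l # hs)"
      using comm_prod_jacobi[of ys i j k l n hs] comm_prod_anti2[of ys i j n k] comm_prod_anti2[of ys i j n l]
      by (simp add: algebra_simps)
    also have "\<dots> \<in> span std_comm_prods"
      by (intro span_diff std) (use n(2) hsn in auto)
    finally show ?thesis .
  qed
qed

text \<open>The least letter of all is brought to the front, by antisymmetry and exchange of the
  commutators, or by Jacobi if it sits in the tail.\<close>

lemma comm_prod_in_span_std_comm_prods: "comm_prod ys i j k l gs \<in> span std_comm_prods"
proof -
  obtain m ks where m: "m \<in> set (i # j # k # l # gs)" "\<And>g. g \<in> set (i # j # k # l # gs) \<Longrightarrow> m \<le> g"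
    using obtain_min_list[of "i # j # k # l # gs"] by (metis list.distinct(1))
  have std: "comm_prod ys m p q r ks \<in> span std_comm_prods" if "m \<le> p" "m \<le> q" "m \<le> r" "\<And>g. g \<in> set ks \<Longrightarrow> m \<le> g" for p q r ks
  proof (cases "m = p")
    case True
    then show ?thesis by (simp add: comm_prod_eq_zero span_zero)
  next
    case False
    then show ?thesis by (intro comm_prod_straighten2) (use that in auto)
  qed
  consider "m = i" | "m = j" | "m = k" | "m = l" | "m \<in> set gs" using m(1) by auto
  then show ?thesis
  proof cases
    case 1
    then show ?thesis using std[of j k l gs] m(2) by simp
  next
    case 2
    then show ?thesis using span_neg[OF std[of i k l gs]] m(2) comm_prod_anti1[of ys i j] by simp
  next
    case 3
    then show ?thesis using std[of l i j gs] m(2) comm_prod_swap[of ys i j] by simp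
  next
    case 4
    then show ?thesis using span_neg[OF std[of k i j gs]] m(2) comm_prod_swap[of ys i j] comm_prod_anti1[of ys k l] by simp
  next
    case 5
    then obtain hs where hs: "mset gs = mset (m # hs)"
      by (metis ex_mset insert_DiffM mset.simps(2) set_mset_mset)
    have hsm: "m \<le> g" if "g \<in> set hs" for g
      using that m(2) hs by (metis list.set_intros(2) set_mset_mset)
    have "comm_prod ys i j k l gs = comm_prod ys i j k l (m # hs)"
      by (rule comm_prod_perm) (use hs in auto)
    also have "\<dots> = comm_prod ys m l i j (k # hs) - comm_prod ys m k i j (l # hs)"
      using comm_prod_jacobi[of ys i j k l m hs] comm_prod_anti1[of ys m k i j] comm_prod_anti1[of ys m l i j]
        comm_prod_swap[of ys i j l m] comm_prod_swap[of ys i j k m]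
      by (simp add: algebra_simps)
    also have "\<dots> \<in> span std_comm_prods"
      by (intro span_diff std) (use m(2) hsm in auto)
    finally show ?thesis .
  qed
qed

lemma comm_prods_in_span_std_comm_prods:
  assumes "a \<in> span comm_prods"
  shows "a \<in> span std_comm_prods"
proof -
  have "comm_prods \<subseteq> span std_comm_prods" by (auto simp: comm_prods_def comm_prod_in_span_std_comm_prods)
  then show ?thesis using assms span_minimal[OF _ subspace_span] by blast
qed

end

section \<open>Straightening of single commutators\<close>

context ut3_star_quotient
begin

lemma span_diff_trans: "a - b \<in> span S \<Longrightarrow> b - c \<in> span S \<Longrightarrow> a - c \<in> span S"
  using span_add[of "a - b" S "b - c"] by simp

lemma span_diff_cong: "a - b \<in> span S \<Longrightarrow> b \<in> span (T \<union> S) \<Longrightarrow> a \<in> span (T \<union> S)"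
  using span_add[of "a - b" "T \<union> S" b] span_mono[of S "T \<union> S"] by auto

lemma comm_comm_words_in_comm_prods: "a \<in> span comm_words \<Longrightarrow> b \<in> span comm_words \<Longrightarrow> comm a b \<in> span comm_prods"
  unfolding comm_def by (intro span_diff comm_words_mult_comm_words)

lemma ad_in_comm_prods: "a \<in> span comm_prods \<Longrightarrow> ad gs a \<in> span comm_prods"
  by (induction gs arbitrary: a) (auto simp: comm_def intro!: span_diff comm_prods_left comm_prods_right)

lemma ad_perm:
  assumes "mset gs = mset hs"
  shows "ad gs (xcomm i j) - ad hs (xcomm i j) \<in> span comm_prods"
proof (rule span_adjacent_swaps[OF _ _ assms])
  fix us a b vs
  have e: "comm (comm c (x a)) (x b) - comm (comm c (x b)) (x a) = comm c (xcomm a b)" for c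
    by (simp add: comm_def algebra_simps)
  have "ad (us @ a # b # vs) (xcomm i j) - ad (us @ b # a # vs) (xcomm i j)
     = ad vs (comm (ad us (xcomm i j)) (xcomm a b))"
    by (simp add: e flip: ad_diff)
  then show "ad (us @ a # b # vs) (xcomm i j) - ad (us @ b # a # vs) (xcomm i j) \<in> span comm_prods"
    by (simp add: ad_in_comm_prods comm_comm_words_in_comm_prods ad_in_comm_words xcomm_in_comm_words)
qed (rule subspace_span)

lemma st_comm_prods:
  assumes "a \<in> span comm_prods"
  shows "st a \<in> span comm_prods"
  using assms
proof (induction rule: span_induct_alt)
  case base
  show ?case by (simp add: span_zero)
next
  case (step c p q)
  then obtain ys i j k l gs where p: "p = comm_prod ys i j k l gs" by (auto simp: comm_prods_def)
  obtain u v where uv: "ad gs (xcomm k l) = comm u v" using ad_comm_ex by blast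
  have "st p = comm_prod [] i j k l gs * st (yword ys)"
    by (simp add: p comm_prod_def uv comm_swap'[of "x i"])
  moreover have "comm_prod [] i j k l gs \<in> span comm_prods" unfolding comm_prods_def by (intro span_base) blast
  ultimately have "st p \<in> span comm_prods" using comm_prods_right by simp
  then show ?case using step by (simp add: st_smul span_add span_scale)
qed

lemma st_ad_in_comm_words: "st (ad gs (xcomm i j)) \<in> span comm_words"
  using ad_comm_ex st_comm comm_in_comm_words by metis

lemma left_comm_perm:
  assumes "mset ys = mset ys'" "mset gs = mset hs"
  shows "left_comm ys i j gs - left_comm ys' i j hs \<in> span comm_prods"
proof (rule span_diff_trans)
  show "left_comm ys i j gs - left_comm ys' i j gs \<in> span comm_prods"
  proof (rule span_adjacent_swaps[OF _ _ assms(1)])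
    fix us a b vs
    have "left_comm (us @ a # b # vs) i j gs - left_comm (us @ b # a # vs) i j gs
      = (yword us * comm (x (Y a)) (x (Y b))) * (yword vs * ad gs (xcomm i j))"
      unfolding comm_def[of "x (Y a)"] by (simp add: left_comm_def algebra_simps)
    also have "\<dots> \<in> span comm_prods" by (intro comm_words_mult_comm_words comm_words_left comm_in_comm_words ad_in_comm_words)
    finally show "left_comm (us @ a # b # vs) i j gs - left_comm (us @ b # a # vs) i j gs \<in> span comm_prods" .
  qed (rule subspace_span)
  have "left_comm ys' i j gs - left_comm ys' i j hs = yword ys' * (ad gs (xcomm i j) - ad hs (xcomm i j))"
    by (simp add: left_comm_def algebra_simps)
  then show "left_comm ys' i j gs - left_comm ys' i j hs \<in> span comm_prods"
    using comm_prods_left ad_perm[OF assms(2)] by simp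
qed

lemma right_comm_perm_aux:
  assumes "mset ys = mset ys'" "mset gs = mset hs"
  shows "right_comm ys i j gs k - right_comm ys' i j hs k \<in> span comm_prods"
proof (rule span_diff_trans)
  show "right_comm ys i j gs k - right_comm ys' i j gs k \<in> span comm_prods"
  proof (rule span_adjacent_swaps[OF _ _ assms(1)])
    fix us a b vs
    have "right_comm (us @ a # b # vs) i j gs k - right_comm (us @ b # a # vs) i j gs k
      = (st (ad gs (xcomm i j)) * (yword us)) * (comm (x (Y a)) (x (Y b)) * (yword vs * x (Z k)))"
      unfolding comm_def[of "x (Y a)"] by (simp add: right_comm_def algebra_simps)
    also have "\<dots> \<in> span comm_prods" by (intro comm_words_mult_comm_words comm_words_right comm_in_comm_words st_ad_in_comm_words)
    finally show "right_comm (us @ a # b # vs) i j gs k - right_comm (us @ b # a # vs) i j gs k \<in> span comm_prods" .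
  qed (rule subspace_span)
  have "right_comm ys' i j gs k - right_comm ys' i j hs k = st (ad gs (xcomm i j) - ad hs (xcomm i j)) * (yword ys' * x (Z k))"
    by (simp add: right_comm_def algebra_simps)
  also have "\<dots> \<in> span comm_prods" by (intro comm_prods_right st_comm_prods ad_perm[OF assms(2)])
  finally show "right_comm ys' i j gs k - right_comm ys' i j hs k \<in> span comm_prods" .
qed

text \<open>Expand the two outermost brackets. Terms with a skew letter on either side of the
  commutator lie in the span of \<open>kernel_elems\<close>; in the others both skew letters stand
  to the right, and their difference is a product of two elements of the commutator ideal.\<close>

lemma right_comm_swap: "right_comm ys i j (gs @ [Z l]) k - right_comm ys i j (gs @ [Z k]) l \<in> span kernel_elems"
proof -
  let ?c = "st (ad gs (xcomm i j))" and ?k = "x (Z k)" and ?l = "x (Z l)" and ?y = "yword ys"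
  have e: "st (comm c (x (Z n))) = st c * x (Z n) - x (Z n) * st c" for c n
    by (simp add: comm_def)
  have eq: "right_comm ys i j (gs @ [Z l]) k - right_comm ys i j (gs @ [Z k]) l
    = (?k * (?c * ?y) * ?l - ?l * (?c * ?y) * ?k) + ?c * (comm ?l ?y * ?k - comm ?k ?y * ?l + ?y * comm ?l ?k)"
    unfolding right_comm_def ad_append ad_Cons ad_Nil e comm_def[of ?l] comm_def[of ?k]
    by (simp add: algebra_simps)
  show ?thesis unfolding eq
    by (intro span_add[OF span_diff]; intro ZCZ_in_kernel_elems comm_words_right st_ad_in_comm_words comm_prods_in_kernel_elems comm_words_mult_comm_words
      span_add[of _ comm_words] span_diff[of _ comm_words] comm_words_left comm_in_comm_words)
qed

lemma right_comm_perm: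
  assumes "mset ys = mset ys'" "mset (gs @ [Z k]) = mset (hs @ [Z l])"
  shows "right_comm ys i j gs k - right_comm ys' i j hs l \<in> span kernel_elems"
proof (cases "k = l")
  case True
  then show ?thesis using right_comm_perm_aux[OF assms(1), of gs hs] assms(2) comm_prods_in_kernel_elems by simp
next
  case False
  then have "add_mset (Z k) (mset gs) = add_mset (Z l) (mset hs)" "Z k \<noteq> Z l" using assms(2) by auto
  then obtain M where M: "mset gs = add_mset (Z l) M" "mset hs = add_mset (Z k) M"
    by (metis add_eq_conv_ex)
  obtain ks where ks: "mset ks = M" using ex_mset by blast
  show ?thesis
  proof (rule span_diff_trans, rule comm_prods_in_kernel_elems, rule right_comm_perm_aux)
    show "mset ys = mset ys'" by fact
    show "mset gs = mset (ks @ [Z l])" using M ks by simp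
    show "right_comm ys' i j (ks @ [Z l]) k - right_comm ys' i j hs l \<in> span kernel_elems"
    proof (rule span_diff_trans, rule right_comm_swap, rule comm_prods_in_kernel_elems, rule right_comm_perm_aux)
      show "mset (ks @ [Z k]) = mset hs" using M ks by simp
    qed simp
  qed
qed

definition std_left_comms :: "'r set" where
  "std_left_comms = {left_comm ys i j gs |ys i j gs. sorted ys \<and> sorted (i # gs) \<and> i < j}"

definition std_right_comms :: "'r set" where
  "std_right_comms = {right_comm ys i j gs k |ys i j gs k. sorted ys \<and> sorted (i # gs @ [Z k]) \<and> i < j}"

lemma left_comm_anti: "left_comm ys j i gs = - left_comm ys i j gs"
  using comm_anti[of "x j" "x i"] by (simp add: left_comm_def ad_minus)

lemma left_comm_eq_zero: "left_comm ys i i gs = 0"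
  by (simp add: left_comm_def comm_def[of "x i"])

lemma left_comm_jacobi: "left_comm ys i j (m # gs) - left_comm ys i m (j # gs) + left_comm ys j m (i # gs) = 0"
proof -
  have "left_comm ys i j (m # gs) - left_comm ys i m (j # gs) + left_comm ys j m (i # gs)
    = yword ys * (ad (m # gs) (xcomm i j) - ad (j # gs) (xcomm i m) + ad (i # gs) (xcomm j m))"
    by (simp add: left_comm_def algebra_simps)
  then show ?thesis by (simp only: ad_jacobi mult_zero_right)
qed

lemma right_comm_anti: "right_comm ys j i gs k = - right_comm ys i j gs k"
  using comm_anti[of "x j" "x i"] by (simp add: right_comm_def ad_minus)

lemma right_comm_eq_zero: "right_comm ys i i gs k = 0"
  by (simp add: right_comm_def comm_def[of "x i"])

lemma right_comm_jacobi: "right_comm ys i j (m # gs) k - right_comm ys i m (j # gs) k + right_comm ys j m (i # gs) k = 0"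
proof -
  have "right_comm ys i j (m # gs) k - right_comm ys i m (j # gs) k + right_comm ys j m (i # gs) k
    = st (ad (m # gs) (xcomm i j) - ad (j # gs) (xcomm i m) + ad (i # gs) (xcomm j m)) * (yword ys * x (Z k))"
    by (simp add: right_comm_def algebra_simps)
  then show ?thesis by (simp only: ad_jacobi st_zero mult_zero_left)
qed

lemma left_comm_standard:
  assumes "i \<le> j" "\<And>g. g \<in> set gs \<Longrightarrow> i \<le> g"
  shows "left_comm ys i j gs \<in> span (std_left_comms \<union> comm_prods)"
proof (cases "i = j")
  case True
  then show ?thesis by (simp add: left_comm_eq_zero span_zero)
next
  case False
  then have ij: "i < j" using assms by simp
  have "sorted (sort ys)" "sorted (i # sort gs)" using assms by auto
  then have "left_comm (sort ys) i j (sort gs) \<in> std_left_comms"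
    unfolding std_left_comms_def using ij by blast
  then show ?thesis
    by (intro span_diff_cong[OF left_comm_perm[of ys "sort ys" gs "sort gs"]] span_base) auto
qed

lemma left_comm_in_span_std_left_comms: "left_comm ys i j gs \<in> span (std_left_comms \<union> comm_prods)"
proof -
  obtain m where m: "m \<in> set (i # j # gs)" "\<And>g. g \<in> set (i # j # gs) \<Longrightarrow> m \<le> g"
    using obtain_min_list[of "i # j # gs"] by (metis list.distinct(1))
  consider "m = i" | "m = j" | "m \<in> set gs" using m(1) by auto
  then show ?thesis
  proof cases
    case 1
    then show ?thesis using m(2) by (intro left_comm_standard) auto
  next
    case 2
    then show ?thesis using m(2) span_neg[OF left_comm_standard[of m i gs ys]] left_comm_anti[of ys i j] by simp
  next
    case 3
    then obtain hs where hs: "mset gs = mset (m # hs)"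
      by (metis ex_mset insert_DiffM mset.simps(2) set_mset_mset)
    have hsm: "m \<le> g" if "g \<in> set hs" for g
      using that m(2) hs by (metis list.set_intros(2) set_mset_mset)
    have "left_comm ys i j (m # hs) = left_comm ys m j (i # hs) - left_comm ys m i (j # hs)"
      using left_comm_jacobi[of ys i j m hs] left_comm_anti[of ys m i] left_comm_anti[of ys m j]
      by (simp add: algebra_simps)
    also have "\<dots> \<in> span (std_left_comms \<union> comm_prods)"
      by (intro span_diff left_comm_standard) (use m(2) hsm in auto)
    finally show ?thesis
      by (rule span_diff_cong[OF left_comm_perm[OF refl hs]])
  qed
qed

lemma right_comm_standard:
  assumes "i \<le> j" "\<And>g. g \<in> set (Z k # gs) \<Longrightarrow> i \<le> g"
  shows "right_comm ys i j gs k \<in> span (std_right_comms \<union> kernel_elems)"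
proof (cases "i = j")
  case True
  then show ?thesis by (simp add: right_comm_eq_zero span_zero)
next
  case False
  then have ij: "i < j" using assms by simp
  define hs where "hs = sort (gs @ [Z k])"
  have hs: "mset hs = mset (gs @ [Z k])" "sorted hs" "hs \<noteq> []"
    by (simp_all add: hs_def) (metis append_is_Nil_conv mset_sort mset_zero_iff not_Cons_self2)
  then obtain ks g where ks: "hs = ks @ [g]" by (metis rev_exhaust)
  \<comment> \<open>The last letter of the sorted list is at least \<open>Z k\<close>, hence skew,
    and can serve as the new outer letter.\<close>
  have "Z k \<in> set hs" using hs(1) by (metis in_set_conv_decomp set_mset_mset)
  then have "Z k \<le> g" using hs(2) ks by (auto simp: sorted_append)
  then obtain l where l: "g = Z l" by (auto simp: Z_le_iff)
  have "set hs = set (gs @ [Z k])" using hs(1) by (metis set_mset_mset)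
  then have "sorted (sort ys)" "sorted (i # ks @ [Z l])" using assms hs(2) ks l by auto
  then have "right_comm (sort ys) i j ks l \<in> std_right_comms"
    unfolding std_right_comms_def using ij by blast
  moreover have "right_comm ys i j gs k - right_comm (sort ys) i j ks l \<in> span kernel_elems"
    by (rule right_comm_perm) (use hs(1) ks l in auto)
  ultimately show ?thesis
    using span_diff_cong span_base by blast
qed

lemma right_comm_straighten_mem:
  assumes "m \<in> set gs" "\<And>g. g \<in> set (i # j # Z k # gs) \<Longrightarrow> m \<le> g"
  shows "right_comm ys i j gs k \<in> span (std_right_comms \<union> kernel_elems)"
proof -
  obtain hs where hs: "mset gs = mset (m # hs)"
    using assms(1) by (metis ex_mset insert_DiffM mset.simps(2) set_mset_mset)
  have hsm: "m \<le> g" if "g \<in> set hs" for g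
    using that assms(2) hs by (metis list.set_intros(2) set_mset_mset)
  have "right_comm ys i j (m # hs) k = right_comm ys m j (i # hs) k - right_comm ys m i (j # hs) k"
    using right_comm_jacobi[of ys i j m hs] right_comm_anti[of ys m i] right_comm_anti[of ys m j]
    by (simp add: algebra_simps)
  also have "\<dots> \<in> span (std_right_comms \<union> kernel_elems)"
    by (intro span_diff right_comm_standard) (use assms(2) hsm in auto)
  finally show ?thesis
    by (rule span_diff_cong[OF comm_prods_in_kernel_elems[OF right_comm_perm_aux[OF refl hs]]])
qed

text \<open>The star of the cyclic relation has its skew letters behind the commutators; inserting
  \<open>yword ys\<close> in between costs products of two commutators.\<close>

lemma right_comm_cyclic:
  "right_comm ys (Z a) (Z b) [] c - (right_comm ys (Z a) (Z c) [] b - right_comm ys (Z b) (Z c) [] a) \<in> span comm_prods"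
proof -
  let ?a = "x (Z a)" and ?b = "x (Z b)" and ?c = "x (Z c)" and ?y = "yword ys"
  have "?a * comm ?b ?c - ?b * comm ?a ?c + ?c * comm ?a ?b = 0"
    by (rule skew_cyclic) auto
  then have "st (?a * comm ?b ?c - ?b * comm ?a ?c + ?c * comm ?a ?b) = 0" by simp
  then have z: "comm ?b ?c * ?a - comm ?a ?c * ?b + comm ?a ?b * ?c = 0"
    by (simp add: comm_def algebra_simps)
  have s: "st (comm (x (Z p)) (x (Z q))) = - comm (x (Z p)) (x (Z q))" for p q
    by (simp add: comm_def)
  have e: "u * ?y * v = u * v * ?y - u * comm v ?y" for u v
    by (simp add: comm_def algebra_simps)
  have eq: "right_comm ys (Z a) (Z b) [] c - (right_comm ys (Z a) (Z c) [] b - right_comm ys (Z b) (Z c) [] a)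
    = comm ?a ?b * comm ?c ?y - comm ?a ?c * comm ?b ?y + comm ?b ?c * comm ?a ?y
      - (comm ?b ?c * ?a - comm ?a ?c * ?b + comm ?a ?b * ?c) * ?y"
    by (simp add: right_comm_def s e) (simp add: algebra_simps)
  show ?thesis unfolding eq z
    by (simp) (intro span_add span_diff comm_words_mult_comm_words comm_in_comm_words)
qed

text \<open>The new difficulty is a least letter \<open>Z k\<close> outside the commutator. Then all
  letters are skew: if there is a tail, \<open>Z k\<close> is exchanged with a tail letter by
  \<open>right_comm_perm\<close>; otherwise \<open>right_comm_cyclic\<close> moves it
  inside.\<close>

lemma right_comm_in_span_std_right_comms: "right_comm ys i j gs k \<in> span (std_right_comms \<union> kernel_elems)"
proof -
  obtain m where m: "m \<in> set (i # j # Z k # gs)" "\<And>g. g \<in> set (i # j # Z k # gs) \<Longrightarrow> m \<le> g"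
    using obtain_min_list[of "i # j # Z k # gs"] by (metis list.distinct(1))
  consider "m = i" | "m = j" | "m \<in> set gs" | "m = Z k" using m(1) by auto
  then show ?thesis
  proof cases
    case 1
    then show ?thesis using m(2) by (intro right_comm_standard) auto
  next
    case 2
    then show ?thesis using m(2) span_neg[OF right_comm_standard[of m i k gs ys]] right_comm_anti[of ys i j] by simp
  next
    case 3
    then show ?thesis using m(2) by (rule right_comm_straighten_mem)
  next
    case 4
    then have "Z k \<le> i" "Z k \<le> j" using m(2) by auto
    then obtain a b where ab: "i = Z a" "j = Z b" "k \<le> a" "k \<le> b"
      by (auto simp: Z_le_iff)
    show ?thesis
    proof (cases gs)
      case Nil
      have "right_comm ys i k' [] l \<in> span (std_right_comms \<union> kernel_elems)" if "i = Z k" "Z k \<le> k'" "k \<le> l" for i k' l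
        by (rule right_comm_standard) (use that in auto)
      from this[of "Z k" "Z a" b] this[of "Z k" "Z b" a] ab
      have "- right_comm ys (Z k) (Z a) [] b + right_comm ys (Z k) (Z b) [] a \<in> span (std_right_comms \<union> kernel_elems)"
        by (intro span_add span_neg) auto
      then have "right_comm ys (Z a) (Z k) [] b - right_comm ys (Z b) (Z k) [] a \<in> span (std_right_comms \<union> kernel_elems)"
        by (simp only: right_comm_anti[of ys "Z a" "Z k"] right_comm_anti[of ys "Z b" "Z k"] diff_minus_eq_add)
      then show ?thesis unfolding Nil ab
        by (rule span_diff_cong[OF comm_prods_in_kernel_elems[OF right_comm_cyclic]])
    next
      case (Cons g hs)
      then have "Z k \<le> g" using m(2) 4 by auto
      then obtain p where p: "g = Z p" by (auto simp: Z_le_iff)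
      have "right_comm ys i j gs k - right_comm ys i j (Z k # hs) p \<in> span kernel_elems"
        by (rule right_comm_perm) (simp_all add: Cons p)
      moreover have "right_comm ys i j (Z k # hs) p \<in> span (std_right_comms \<union> kernel_elems)"
        by (rule right_comm_straighten_mem[of "Z k"]) (use m(2) 4 Cons p in auto)
      ultimately show ?thesis by (rule span_diff_cong)
    qed
  qed
qed

end

section \<open>Standard normal forms\<close>

text \<open>Indices are kept apart from ring elements, which might coincide: a combination is taken
  over a set of indices, and the leading monomial is read off the index.\<close>

datatype nf_index =
    NF_word "gen list"
  | NF_left "nat list" gen gen "gen list"
  | NF_right "nat list" gen gen "gen list" nat
  | NF_sandwich "nat list" nat nat nat nat "nat list"
  | NF_prod "nat list" gen gen gen gen "gen list"

fun nf_standard :: "nf_index \<Rightarrow> bool" where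
  "nf_standard (NF_word w) = sorted w"
| "nf_standard (NF_left ys i j gs) = (sorted ys \<and> sorted (i # gs) \<and> i < j)"
| "nf_standard (NF_right ys i j gs k) = (sorted ys \<and> sorted (i # gs @ [Z k]) \<and> i < j)"
| "nf_standard (NF_sandwich ys n a b c \<gamma>) = (sorted ys \<and> sorted (a # b # c # \<gamma>))"
| "nf_standard (NF_prod ys i j k l gs) =
    (sorted ys \<and> sorted (k # gs) \<and> i < j \<and> k < l \<and> i \<le> k \<and> j \<le> l)"

context ut3_star_quotient
begin

text \<open>The element \<open>y * p + p * y\<close> is again skew. Its cyclic relation, minus the
  one for \<open>p\<close> multiplied by \<open>y\<close> on the left and on the right, consists of
  twice the claimed difference and products of two commutators.\<close>

lemma skew_comm_skew_swap:
  assumes "st y = y" "st p = - p" "st q = - q" "st r = - r"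
  shows "p * comm y q * r - p * comm y r * q \<in> span comm_prods"
proof -
  let ?J = "\<lambda>p q r. p * comm q r - q * comm p r + r * comm p q"
  have 1: "?J (y * p + p * y) q r = 0" by (rule skew_cyclic) (use assms in auto)
  have 2: "?J p q r = 0" by (rule skew_cyclic) (use assms in auto)
  have s: "st (comm y q) = comm y q"
    using assms by (simp add: comm_def)
  have 3: "r * comm y q * p = p * comm y q * r"
    using skew_comm_skew[OF assms(2,4), of y q] s by simp
  have s': "st (comm y r) = comm y r"
    using assms by (simp add: comm_def)
  have 4: "q * comm y r * p = p * comm y r * q"
    using skew_comm_skew[OF assms(2,3), of y r] s' by simp
  let ?X = "p * comm y q * r - p * comm y r * q"
  let ?C = "comm r p * comm y q + comm p q * comm y r + comm y q * comm p r - comm y r * comm p q"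
  have "?J (y * p + p * y) q r - y * ?J p q r - ?J p q r * y
     = p * comm y q * r - p * comm y r * q + (r * comm y q * p - q * comm y r * p) + ?C"
    by (simp add: comm_def algebra_simps)
  then have "?X + ?X = - ?C"
    unfolding 1 2 3 4 by (simp add: algebra_simps eq_neg_iff_add_eq_0)
  then have "?X = smul (1 / 2) (- ?C)"
    using smul_half[of ?X] by simp
  also have "\<dots> \<in> span comm_prods"
    by (intro span_scale span_neg span_add span_diff comm_words_mult_comm_words comm_in_comm_words)
  finally show ?thesis .
qed

text \<open>All skew letters are gathered in one list so that \<open>span_adjacent_swaps\<close>
  applies. The value 0 on lists with fewer than three letters is a dummy.\<close>

fun sandwich_list :: "nat list \<Rightarrow> nat \<Rightarrow> nat list \<Rightarrow> 'r" where
  "sandwich_list ys n (a # b # c # \<gamma>) = sandwich ys n a b c \<gamma>"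
| "sandwich_list ys n _ = 0"

lemma sandwich_list_perm:
  assumes "mset zs = mset zs'"
  shows "sandwich_list ys n zs - sandwich_list ys n zs' \<in> span comm_prods"
proof (rule span_adjacent_swaps[OF subspace_span _ assms])
  fix us vs :: "nat list" and p q
  have sw: "x (Z a) * xcomm (Y n) (Z b) * x (Z c) - x (Z a) * xcomm (Y n) (Z c) * x (Z b) \<in> span comm_prods" for a b c
    by (rule skew_comm_skew_swap) auto
  have sym: "x (Z a) * xcomm (Y n) (Z b) * x (Z c) = x (Z c) * xcomm (Y n) (Z b) * x (Z a)" for a b c
    using skew_comm_skew[of "x (Z a)" "x (Z c)" "x (Y n)" "x (Z b)"] by (simp add: st_comm) (simp add: comm_def)
  have sw1: "x (Z a) * xcomm (Y n) (Z b) * x (Z c) - x (Z b) * xcomm (Y n) (Z a) * x (Z c) \<in> span comm_prods" for a b c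
    using sw[of c b a] by (simp only: sym[of c])
  have gen: "sandwich ys n a b c \<gamma> - sandwich ys n a' b' c' \<gamma> \<in> span comm_prods"
    if "x (Z a) * xcomm (Y n) (Z b) * x (Z c) - x (Z a') * xcomm (Y n) (Z b') * x (Z c') \<in> span comm_prods" for a b c a' b' c' \<gamma>
  proof -
    have "sandwich ys n a b c \<gamma> - sandwich ys n a' b' c' \<gamma> =
       yword ys * (x (Z a) * xcomm (Y n) (Z b) * x (Z c) - x (Z a') * xcomm (Y n) (Z b') * x (Z c')) * zword \<gamma>"
      by (simp add: sandwich_def algebra_simps)
    then show ?thesis using comm_prods_left comm_prods_right that by simp
  qed
  \<comment> \<open>The cases are the positions of the exchanged pair: list too short, first two
    letters, second and third, third letter and tail, inside the tail.\<close>
  consider "us = []" "vs = []" | c \<gamma> where "us = []" "vs = c # \<gamma>" | a where "us = [a]"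
    | a b where "us = [a, b]" | a b c \<gamma> where "us = a # b # c # \<gamma>"
    by (metis (no_types) neq_Nil_conv)
  then show "sandwich_list ys n (us @ p # q # vs) - sandwich_list ys n (us @ q # p # vs) \<in> span comm_prods"
  proof cases
    case 1
    then show ?thesis by (simp add: span_zero)
  next
    case 2
    then show ?thesis using gen[OF sw1] by simp
  next
    case 3
    then show ?thesis using gen[OF sw] by simp
  next
    case 4
    have "sandwich_list ys n (us @ p # q # vs) - sandwich_list ys n (us @ q # p # vs)
      = (yword ys * (x (Z a) * xcomm (Y n) (Z b))) * (xcomm (Z p) (Z q) * zword vs)
      + yword ys * 0"
      unfolding comm_def[of "x (Z p)"] by (simp add: 4 sandwich_def algebra_simps)
    also have "\<dots> \<in> span comm_prods"
      by simp (intro comm_words_mult_comm_words comm_words_left comm_words_right xcomm_in_comm_words)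
    finally show ?thesis .
  next
    case 5
    have "sandwich_list ys n (us @ p # q # vs) - sandwich_list ys n (us @ q # p # vs)
      = (yword ys * (x (Z a) * xcomm (Y n) (Z b) * x (Z c)) * zword \<gamma>) * (xcomm (Z p) (Z q) * zword vs)"
      unfolding comm_def[of "x (Z p)"] by (simp add: 5 sandwich_def algebra_simps)
    also have "\<dots> \<in> span comm_prods"
      by (intro comm_words_mult_comm_words comm_words_right[of _ "zword _"] comm_words_left ZCZ_gen xcomm_in_comm_words)
    finally show ?thesis .
  qed
qed

fun normal_form :: "nf_index \<Rightarrow> 'r" where
  "normal_form (NF_word w) = word w"
| "normal_form (NF_left ys i j gs) = left_comm ys i j gs"
| "normal_form (NF_right ys i j gs k) = right_comm ys i j gs k"
| "normal_form (NF_sandwich ys n a b c \<gamma>) = sandwich ys n a b c \<gamma>"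
| "normal_form (NF_prod ys i j k l gs) = comm_prod ys i j k l gs"

abbreviation standard_nfs :: "'r set" where
  "standard_nfs \<equiv> normal_form ` Collect nf_standard"

lemma comm_prods_in_standard: "a \<in> span comm_prods \<Longrightarrow> a \<in> span standard_nfs"
proof -
  have "std_comm_prods \<subseteq> standard_nfs"
  proof
    fix a assume "a \<in> std_comm_prods"
    then obtain ys i j k l gs where "a = normal_form (NF_prod ys i j k l gs)" "nf_standard (NF_prod ys i j k l gs)"
      unfolding std_comm_prods_def by auto
    then show "a \<in> standard_nfs" by blast
  qed
  then show "a \<in> span comm_prods \<Longrightarrow> a \<in> span standard_nfs"
    using comm_prods_in_span_std_comm_prods span_mono by blast
qed

lemma sandwich_in_standard: "sandwich ys n a b c \<gamma> \<in> span standard_nfs"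
proof -
  have "length (sort (a # b # c # \<gamma>)) = Suc (Suc (Suc (length \<gamma>)))"
    by (simp del: sort_key_simps)
  then obtain a' b' c' \<gamma>' where s: "sort (a # b # c # \<gamma>) = a' # b' # c' # \<gamma>'"
    unfolding length_Suc_conv by blast
  have m: "mset (a # b # c # \<gamma>) = mset (a' # b' # c' # \<gamma>')" using s by (metis mset_sort)
  have 1: "sandwich ys n a b c \<gamma> - sandwich ys n a' b' c' \<gamma>' \<in> span comm_prods"
    using sandwich_list_perm[OF m, of ys n] by simp
  have 2: "sandwich ys n a' b' c' \<gamma>' - sandwich (sort ys) n a' b' c' \<gamma>' \<in> span comm_prods"
  proof (rule span_adjacent_swaps[OF subspace_span])
    fix us p q vs
    have "sandwich (us @ p # q # vs) n a' b' c' \<gamma>' - sandwich (us @ q # p # vs) n a' b' c' \<gamma>'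
      = (yword us * xcomm (Y p) (Y q)) * (yword vs * (x (Z a') * xcomm (Y n) (Z b') * x (Z c')) * zword \<gamma>')"
      unfolding comm_def[of "x (Y p)"] by (simp add: sandwich_def algebra_simps)
    also have "\<dots> \<in> span comm_prods"
      by (intro comm_words_mult_comm_words comm_words_right[of _ "zword _"] comm_words_left ZCZ_gen xcomm_in_comm_words)
    finally show "sandwich (us @ p # q # vs) n a' b' c' \<gamma>' - sandwich (us @ q # p # vs) n a' b' c' \<gamma>' \<in> span comm_prods" .
  qed simp
  have "sorted (a' # b' # c' # \<gamma>')" using s by (metis sorted_sort)
  then have "nf_standard (NF_sandwich (sort ys) n a' b' c' \<gamma>')" by simp
  then have "normal_form (NF_sandwich (sort ys) n a' b' c' \<gamma>') \<in> span standard_nfs"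
    by (intro span_base) blast
  then show ?thesis
    using span_add[OF comm_prods_in_standard[OF span_diff_trans[OF 1 2]], of "sandwich (sort ys) n a' b' c' \<gamma>'"] by simp
qed

lemma kernel_elems_in_standard:
  assumes "a \<in> span kernel_elems"
  shows "a \<in> span standard_nfs"
proof -
  have "kernel_elems \<subseteq> span standard_nfs"
    by (auto simp: kernel_elems_def sandwiches_def sandwich_in_standard intro: comm_prods_in_standard span_base)
  then show ?thesis using assms span_minimal[OF _ subspace_span] by blast
qed

lemma comm_words_in_standard:
  assumes "a \<in> span comm_words"
  shows "a \<in> span standard_nfs"
proof -
  have 1: "std_left_comms \<subseteq> standard_nfs"
  proof
    fix a assume "a \<in> std_left_comms"
    then obtain ys i j gs where "a = normal_form (NF_left ys i j gs)" "nf_standard (NF_left ys i j gs)"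
      unfolding std_left_comms_def by auto
    then show "a \<in> standard_nfs" by blast
  qed
  have 2: "std_right_comms \<subseteq> standard_nfs"
  proof
    fix a assume "a \<in> std_right_comms"
    then obtain ys i j gs k where "a = normal_form (NF_right ys i j gs k)" "nf_standard (NF_right ys i j gs k)"
      unfolding std_right_comms_def by auto
    then show "a \<in> standard_nfs" by blast
  qed
  have "std_left_comms \<subseteq> span standard_nfs" "std_right_comms \<subseteq> span standard_nfs"
    using 1 2 span_superset[of standard_nfs] by auto
  moreover have "comm_prods \<subseteq> span standard_nfs" "kernel_elems \<subseteq> span standard_nfs"
    by (auto intro: comm_prods_in_standard kernel_elems_in_standard span_base)
  ultimately have "std_left_comms \<union> comm_prods \<subseteq> span standard_nfs" "std_right_comms \<union> kernel_elems \<subseteq> span standard_nfs"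
    by simp_all
  then have "span (std_left_comms \<union> comm_prods) \<subseteq> span standard_nfs" "span (std_right_comms \<union> kernel_elems) \<subseteq> span standard_nfs"
    using span_minimal[OF _ subspace_span] by blast+
  then have "comm_normals \<subseteq> span standard_nfs"
    using left_comm_in_span_std_left_comms right_comm_in_span_std_right_comms kernel_elems_in_standard[OF span_base] unfolding comm_normals_def by blast
  then show ?thesis using comm_words_in_comm_normals[OF assms] span_minimal[OF _ subspace_span] by blast
qed

theorem in_span_standard: "r \<in> span standard_nfs"
proof -
  have "word w \<in> span standard_nfs" for w
  proof -
    have "word w - word (sort w) \<in> span comm_words"
    proof (rule span_adjacent_swaps[where F = word, OF subspace_span])
      fix us p q vs
      have "word (us @ p # q # vs) - word (us @ q # p # vs) = word us * xcomm p q * word vs"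
        unfolding comm_def by (simp add: algebra_simps)
      then show "word (us @ p # q # vs) - word (us @ q # p # vs) \<in> span comm_words"
        using comm_words_left comm_words_right xcomm_in_comm_words by simp
    qed simp
    moreover have "normal_form (NF_word (sort w)) \<in> span standard_nfs"
      by (intro span_base imageI) simp
    ultimately show ?thesis
      using span_add[OF comm_words_in_standard, of "word w - word (sort w)" "word (sort w)"] by simp
  qed
  then have "span (range word) \<subseteq> span standard_nfs"
    by (intro span_minimal subspace_span) auto
  then show ?thesis using span_words[of r] by (rule subsetD)
qed

end

section \<open>Evaluation of free polynomials\<close>

lemma unital_algebraD:
  assumes "unital_algebra s"
  shows "vector_space s" "s c a * b = s c (a * b)" "a * s c b = s c (a * b)"
  using assms by (auto simp: unital_algebra_def)

lemma eval_free_single: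
  assumes "unital_algebra s"
  shows "eval_free s g (Poly_Mapping.single w c) = s c (prod_list (map g w))"
proof -
  interpret vector_space s using assms by (rule unital_algebraD)
  show ?thesis by (cases "c = 0") (simp_all add: eval_free_def)
qed

lemma eval_free_add:
  assumes "unital_algebra s"
  shows "eval_free s g (p + q) = eval_free s g p + eval_free s g q"
proof -
  interpret vector_space s using assms by (rule unital_algebraD)
  let ?t = "\<lambda>p w. s (Poly_Mapping.lookup p w) (prod_list (map g w))"
  have ext: "eval_free s g p = sum (?t p) A" if "finite A" "Poly_Mapping.keys p \<subseteq> A" for p A
    unfolding eval_free_def using that
    by (intro sum.mono_neutral_left) (auto simp: in_keys_iff)
  let ?A = "Poly_Mapping.keys p \<union> Poly_Mapping.keys q"
  have "eval_free s g (p + q) = sum (?t (p + q)) ?A"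
    using keys_add[of p q] by (intro ext) auto
  also have "\<dots> = sum (?t p) ?A + sum (?t q) ?A"
    by (simp add: lookup_add scale_left_distrib sum.distrib)
  finally show ?thesis
    using ext[of ?A p] ext[of ?A q] by simp
qed

lemma eval_free_mult:
  assumes "unital_algebra s"
  shows "eval_free s g (p * q) = eval_free s g p * eval_free s g q"
proof (induction p rule: free_alg_induct)
  case (single k v)
  interpret vector_space s using assms by (rule unital_algebraD)
  show ?case
  proof (induction q rule: free_alg_induct)
    case (single k' v')
    show ?case
      by (simp add: mult_single plus_list_def eval_free_single[OF assms] unital_algebraD[OF assms])
  next
    case (sum p q)
    then show ?case by (simp add: distrib_left eval_free_add[OF assms])
  qed
next
  case (sum p q)
  then show ?case by (simp add: distrib_right eval_free_add[OF assms])
qed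

lemma eval_free_scale:
  assumes "unital_algebra s"
  shows "eval_free s g (free_scale c p) = s c (eval_free s g p)"
proof -
  interpret vector_space s using assms by (rule unital_algebraD)
  show ?thesis
    by (simp add: free_scale_def eval_free_mult[OF assms] eval_free_single[OF assms] unital_algebraD[OF assms])
qed

lemma eval_free_one:
  assumes "unital_algebra s"
  shows "eval_free s g 1 = 1"
proof -
  interpret vector_space s using assms by (rule unital_algebraD)
  show ?thesis by (simp add: eval_free_single[OF assms] flip: single_Nil_one)
qed

lemma algebra_homI:
  assumes "vector_space s1" "vector_space s2" "\<And>a b. h (a + b) = h a + h b" "\<And>c a. h (s1 c a) = s2 c (h a)"
    "\<And>a b. h (a * b) = h a * h b" "h 1 = 1"
  shows "algebra_hom s1 s2 h"
  using assms
  by (simp add: algebra_hom_def Vector_Spaces.linear_def module_hom_def module_hom_axioms_def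
      module_iff_vector_space)

lemma algebra_homD:
  assumes "algebra_hom s1 s2 h"
  shows "h (a + b) = h a + h b" "h (s1 c a) = s2 c (h a)" "h (a * b) = h a * h b" "h 1 = 1"
    "h 0 = 0" "h (- a) = - h a" "h (a - b) = h a - h b"
proof -
  interpret Vector_Spaces.linear s1 s2 h using assms by (simp add: algebra_hom_def)
  show "h (a + b) = h a + h b" "h (s1 c a) = s2 c (h a)" "h (a * b) = h a * h b" "h 1 = 1"
    "h 0 = 0" "h (- a) = - h a" "h (a - b) = h a - h b"
    using assms by (simp_all add: algebra_hom_def add scale neg diff)
qed

lemma algebra_hom_comm: "algebra_hom s1 s2 h \<Longrightarrow> h (comm a b) = comm (h a) (h b)"
  by (simp add: comm_def algebra_homD)

lemma algebra_hom_prod_list: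
  "algebra_hom s1 s2 h \<Longrightarrow> h (prod_list (map g w)) = prod_list (map (\<lambda>x. h (g x)) w)"
  by (induction w) (simp_all add: algebra_homD)

lemma algebra_hom_eval_free:
  assumes "unital_algebra s"
  shows "algebra_hom free_scale s (eval_free s g)"
  using assms
  by (intro algebra_homI unital_algebraD(1) unital_algebra_free eval_free_add eval_free_scale
      eval_free_mult eval_free_one)

lemma algebra_hom_eval_free_comp:
  assumes "algebra_hom s1 s2 h"
  shows "h (eval_free s1 g p) = eval_free s2 (\<lambda>x. h (g x)) p"
proof -
  interpret Vector_Spaces.linear s1 s2 h using assms by (simp add: algebra_hom_def)
  show ?thesis
    by (simp add: eval_free_def sum scale algebra_hom_prod_list[OF assms])
qed

lemma eval_free_gens: "eval_free free_scale (\<lambda>x. Poly_Mapping.single [x] 1) p = p"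
proof -
  have 1: "prod_list (map (\<lambda>x. Poly_Mapping.single [x] 1) w) = (Poly_Mapping.single w 1 :: 'f::field free_alg)"
    for w by (induction w) (simp_all add: single_Nil_one mult_single plus_list_def)
  show ?thesis
  proof (induction p rule: free_alg_induct)
    case (single w c)
    show ?case
      by (simp add: eval_free_single[OF unital_algebra_free] 1)
        (simp add: free_scale_def mult_single plus_list_def)
  next
    case (sum p q)
    then show ?case by (simp add: eval_free_add[OF unital_algebra_free])
  qed
qed

lemma algebra_hom_free_eq:
  assumes "algebra_hom free_scale s h"
  shows "h p = eval_free s (\<lambda>x. h (Poly_Mapping.single [x] 1)) p"
  using algebra_hom_eval_free_comp[OF assms, of "\<lambda>x. Poly_Mapping.single [x] 1" p]
  by (simp add: eval_free_gens)

definition admissible :: "('b::ring_1 \<Rightarrow> 'b) \<Rightarrow> (gen \<Rightarrow> 'b) \<Rightarrow> bool" where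
  "admissible st g \<longleftrightarrow> (\<forall>i. st (g (Y i)) = g (Y i)) \<and> (\<forall>i. st (g (Z i)) = - g (Z i))"

lemma star_identities_iff:
  "f \<in> star_identities s st \<longleftrightarrow> (\<forall>g. admissible st g \<longrightarrow> eval_free s g f = 0)"
  by (auto simp: star_identities_def admissible_def symmetric_elems_def skew_elems_def)

lemma algebra_involutionD:
  assumes "algebra_involution s st"
  shows "vector_space s" "st (a + b) = st a + st b" "st (s c a) = s c (st a)" "st (a * b) = st b * st a"
    "st (st a) = a" "st 0 = 0" "st (- a) = - st a" "st (a - b) = st a - st b" "st 1 = 1"
proof -
  interpret Vector_Spaces.linear s s st using assms by (simp add: algebra_involution_def)
  show "st (a + b) = st a + st b" "st (s c a) = s c (st a)" "st 0 = 0" "st (- a) = - st a" "st (a - b) = st a - st b"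
    by (simp_all add: add scale neg diff)
  show "vector_space s" by (rule vs1.vector_space_axioms)
  show "st (a * b) = st b * st a" "st (st a) = a" using assms by (simp_all add: algebra_involution_def)
  have "st 1 * a = a" for a
    using assms by (metis algebra_involution_def mult.right_neutral)
  from this[of 1] show "st 1 = 1" by simp
qed

lemma algebra_involution_comm:
  "algebra_involution s st \<Longrightarrow> st (comm a b) = comm (st b) (st a)"
  by (simp add: comm_def algebra_involutionD)

lemma eval_free_star:
  assumes "unital_algebra s" "algebra_involution s st" "admissible st g"
  shows "eval_free s g (free_star p) = st (eval_free s g p)"
proof (induction p rule: free_alg_induct)
  case (single w c)
  note hom = algebra_hom_eval_free[OF assms(1), of g]
  interpret vector_space s using assms(1) by (rule unital_algebraD)
  have g: "eval_free s g (gen_star x) = st (g x)" for x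
    using assms(3) by (cases x) (simp_all add: algebra_homD[OF hom] admissible_def yv_def zv_def eval_free_single[OF assms(1)])
  have "prod_list (map (\<lambda>x. st (g x)) (rev w)) = st (prod_list (map g w))"
    by (induction w) (simp_all add: algebra_involutionD[OF assms(2)])
  then show ?case
    by (simp add: free_star_single algebra_homD[OF hom] algebra_hom_prod_list[OF hom] g
        eval_free_single[OF assms(1)] algebra_involutionD[OF assms(2)])
next
  case (sum p q)
  then show ?case
    by (simp add: free_star_add eval_free_add[OF assms(1)] algebra_involutionD[OF assms(2)])
qed

lemma admissible_gens: "admissible free_star (\<lambda>x. Poly_Mapping.single [x] 1)"
  by (simp add: admissible_def free_star_yv free_star_zv flip: yv_def zv_def)

lemma
  assumes "unital_algebra s"
  shows eval_free_yv: "eval_free s g (yv i) = g (Y i)"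
    and eval_free_zv: "eval_free s g (zv i) = g (Z i)"
proof -
  interpret vector_space s using assms by (rule unital_algebraD)
  show "eval_free s g (yv i) = g (Y i)" "eval_free s g (zv i) = g (Z i)"
    by (simp_all add: yv_def zv_def eval_free_single[OF assms])
qed

lemma T_star_ideal_star_identities:
  assumes "unital_algebra s" "algebra_involution s st"
  shows "T_star_ideal (star_identities s st)"
proof -
  note hom = algebra_hom_eval_free[OF assms(1)]
  have "two_sided_ideal (star_identities s st)"
    by (auto simp: two_sided_ideal_def star_identities_iff algebra_homD[OF hom])
  moreover have "\<phi> f \<in> star_identities s st"
    if \<phi>: "algebra_hom free_scale free_scale \<phi>" "\<forall>p. \<phi> (free_star p) = free_star (\<phi> p)"
      and f: "f \<in> star_identities s st" for \<phi> f
    unfolding star_identities_iff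
  proof (intro allI impI)
    fix g assume g: "admissible st g"
    let ?g = "\<lambda>x. eval_free s g (\<phi> (Poly_Mapping.single [x] 1))"
    have "eval_free s g (\<phi> f) = eval_free s ?g f"
      by (simp only: algebra_hom_free_eq[OF \<phi>(1), of f] algebra_hom_eval_free_comp[OF hom])
    moreover have "admissible st ?g"
    proof -
      have "st (eval_free s g (\<phi> (yv i))) = eval_free s g (\<phi> (yv i))" for i
        using \<phi>(2)[rule_format, of "yv i"] by (simp add: free_star_yv flip: eval_free_star[OF assms g])
      moreover have "st (eval_free s g (\<phi> (zv i))) = - eval_free s g (\<phi> (zv i))" for i
      proof -
        have "free_star (\<phi> (zv i)) = - \<phi> (zv i)"
          using \<phi>(2)[rule_format, of "zv i"] by (simp add: free_star_zv algebra_homD(6)[OF \<phi>(1)])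
        then show ?thesis
          by (simp add: algebra_homD(6)[OF hom] flip: eval_free_star[OF assms g])
      qed
      ultimately show ?thesis by (simp add: admissible_def yv_def zv_def)
    qed
    ultimately show "eval_free s g (\<phi> f) = 0"
      using f by (simp add: star_identities_iff)
  qed
  ultimately show ?thesis by (auto simp: T_star_ideal_def)
qed

lemma T_star_idealD:
  assumes "T_star_ideal I"
  shows "0 \<in> I" "a \<in> I \<Longrightarrow> b \<in> I \<Longrightarrow> a + b \<in> I" "a \<in> I \<Longrightarrow> r * a \<in> I" "a \<in> I \<Longrightarrow> a * r \<in> I"
    "a \<in> I \<Longrightarrow> - a \<in> I" "a \<in> I \<Longrightarrow> b \<in> I \<Longrightarrow> a - b \<in> I"
    "algebra_hom free_scale free_scale \<phi> \<Longrightarrow> (\<And>p. \<phi> (free_star p) = free_star (\<phi> p)) \<Longrightarrow> a \<in> I \<Longrightarrow> \<phi> a \<in> I"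
proof -
  show *: "0 \<in> I" "a \<in> I \<Longrightarrow> b \<in> I \<Longrightarrow> a + b \<in> I" "a \<in> I \<Longrightarrow> r * a \<in> I" "a \<in> I \<Longrightarrow> a * r \<in> I" for a b r
    using assms by (simp_all add: T_star_ideal_def two_sided_ideal_def)
  show m: "- a \<in> I" if "a \<in> I" for a using *(3)[OF that, of "- 1"] by simp
  show "a \<in> I \<Longrightarrow> b \<in> I \<Longrightarrow> a - b \<in> I" using *(2)[of a "- b"] m by simp
  show "algebra_hom free_scale free_scale \<phi> \<Longrightarrow> (\<And>p. \<phi> (free_star p) = free_star (\<phi> p)) \<Longrightarrow> a \<in> I \<Longrightarrow> \<phi> a \<in> I"
    using assms unfolding T_star_ideal_def image_subset_iff by simp
qed

lemma T_star_idealI: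
  assumes "0 \<in> I" "\<And>a b. a \<in> I \<Longrightarrow> b \<in> I \<Longrightarrow> a + b \<in> I" "\<And>a r. a \<in> I \<Longrightarrow> r * a \<in> I" "\<And>a r. a \<in> I \<Longrightarrow> a * r \<in> I"
    "\<And>\<phi> a. algebra_hom free_scale free_scale \<phi> \<Longrightarrow> (\<And>p. \<phi> (free_star p) = free_star (\<phi> p)) \<Longrightarrow> a \<in> I \<Longrightarrow> \<phi> a \<in> I"
  shows "T_star_ideal I"
  using assms by (simp add: T_star_ideal_def two_sided_ideal_def image_subset_iff)

lemma T_star_ideal_hull: "T_star_ideal (T_star_ideal hull S)"
proof (rule hull_in)
  fix T :: "'f::field free_alg set set"
  assume T: "\<forall>t\<in>T. T_star_ideal t"
  show "T_star_ideal (\<Inter> T)"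
    by (rule T_star_idealI; rule InterI) (simp_all add: T_star_idealD T[rule_format])
qed

text \<open>An admissible substitution into the free algebra itself is an endomorphism commuting
  with the involution.\<close>

lemma eval_free_in_T_star_ideal:
  assumes "T_star_ideal I" "f \<in> I" "admissible free_star g"
  shows "eval_free free_scale g f \<in> I"
  by (rule T_star_idealD(7)[OF assms(1)])
    (use assms(2) in \<open>simp_all add: algebra_hom_eval_free unital_algebra_free
      eval_free_star[OF unital_algebra_free algebra_involution_free_star assms(3)]\<close>)

section \<open>The generating identities\<close>

definition ut3_basis :: "'f::field free_alg set" where
  "ut3_basis =
     ({zv 1 * comm (zv 2) (zv 3) - zv 2 * comm (zv 1) (zv 3) + zv 3 * comm (zv 1) (zv 2)}
    \<union> {(-1) ^ par (comm x1 x2) * comm x1 x2 * comm x3 x4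
         - (-1) ^ par (comm x3 x4) * comm x3 x4 * comm x1 x2 | x1 x2 x3 x4.
         x1 \<in> xv 1 \<and> x2 \<in> xv 2 \<and> x3 \<in> xv 3 \<and> x4 \<in> xv 4}
    \<union> {(-1) ^ par (comm x1 x2) * comm x1 x2 * comm x3 x4
         - (-1) ^ par (comm x1 x3) * comm x1 x3 * comm x2 x4
         + (-1) ^ par (comm x1 x4) * comm x1 x4 * comm x2 x3 | x1 x2 x3 x4.
         x1 \<in> xv 1 \<and> x2 \<in> xv 2 \<and> x3 \<in> xv 3 \<and> x4 \<in> xv 4}
    \<union> {zv 1 * comm x3 x4 * zv 2 + (-1) ^ par (comm x3 x4) * zv 2 * comm x3 x4 * zv 1 | x3 x4.
         x3 \<in> xv 3 \<and> x4 \<in> xv 4}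
    \<union> {comm x1 x2 * zv 5 * comm x3 x4 | x1 x2 x3 x4.
         x1 \<in> xv 1 \<and> x2 \<in> xv 2 \<and> x3 \<in> xv 3 \<and> x4 \<in> xv 4}
    \<union> {zv 1 * comm x4 x5 * zv 2 * x3 + (-1) ^ par x3 * x3 * zv 1 * comm x4 x5 * zv 2 | x3 x4 x5.
         x3 \<in> xv 3 \<and> x4 \<in> xv 4 \<and> x5 \<in> xv 5})"

definition homogeneous :: "('b::ring_1 \<Rightarrow> 'b) \<Rightarrow> 'b \<Rightarrow> bool" where
  "homogeneous st a \<longleftrightarrow> st a = a \<or> st a = - a"

text \<open>The sign \<open>(-1)\<^bsup>|h|\<^esup>\<close> of the generating identities turns \<open>h\<close> into \<open>- h\<^sup>*\<close>.\<close>

definition ut3_relations :: "('b::ring_1 \<Rightarrow> 'b) \<Rightarrow> 'b set \<Rightarrow> bool" where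
  "ut3_relations st V \<longleftrightarrow>
     (\<forall>p q r. st p = - p \<longrightarrow> st q = - q \<longrightarrow> st r = - r \<longrightarrow>
        p * comm q r - q * comm p r + r * comm p q \<in> V) \<and>
     (\<forall>a b c d. homogeneous st a \<longrightarrow> homogeneous st b \<longrightarrow> homogeneous st c \<longrightarrow> homogeneous st d \<longrightarrow>
        st (comm c d) * comm a b - st (comm a b) * comm c d \<in> V) \<and>
     (\<forall>a b c d. homogeneous st a \<longrightarrow> homogeneous st b \<longrightarrow> homogeneous st c \<longrightarrow> homogeneous st d \<longrightarrow>
        st (comm a c) * comm b d - st (comm a b) * comm c d - st (comm a d) * comm b c \<in> V) \<and>
     (\<forall>p q a b. st p = - p \<longrightarrow> st q = - q \<longrightarrow> homogeneous st a \<longrightarrow> homogeneous st b \<longrightarrow>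
        p * comm a b * q - q * st (comm a b) * p \<in> V) \<and>
     (\<forall>p a b c d. st p = - p \<longrightarrow> homogeneous st a \<longrightarrow> homogeneous st b \<longrightarrow> homogeneous st c \<longrightarrow> homogeneous st d \<longrightarrow>
        comm a b * p * comm c d \<in> V) \<and>
     (\<forall>p q a b c. st p = - p \<longrightarrow> st q = - q \<longrightarrow> homogeneous st a \<longrightarrow> homogeneous st b \<longrightarrow> homogeneous st c \<longrightarrow>
        p * comm b c * q * a - st a * p * comm b c * q \<in> V)"

lemma ut3_relationsD:
  assumes "ut3_relations st V"
  shows "st p = - p \<Longrightarrow> st q = - q \<Longrightarrow> st r = - r \<Longrightarrow>
      p * comm q r - q * comm p r + r * comm p q \<in> V"
    and "homogeneous st a \<Longrightarrow> homogeneous st b \<Longrightarrow> homogeneous st c \<Longrightarrow> homogeneous st d \<Longrightarrow>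
      st (comm c d) * comm a b - st (comm a b) * comm c d \<in> V"
    and "homogeneous st a \<Longrightarrow> homogeneous st b \<Longrightarrow> homogeneous st c \<Longrightarrow> homogeneous st d \<Longrightarrow>
      st (comm a c) * comm b d - st (comm a b) * comm c d - st (comm a d) * comm b c \<in> V"
    and "st p = - p \<Longrightarrow> st q = - q \<Longrightarrow> homogeneous st a \<Longrightarrow> homogeneous st b \<Longrightarrow>
      p * comm a b * q - q * st (comm a b) * p \<in> V"
    and "st p = - p \<Longrightarrow> homogeneous st a \<Longrightarrow> homogeneous st b \<Longrightarrow> homogeneous st c \<Longrightarrow> homogeneous st d \<Longrightarrow>
      comm a b * p * comm c d \<in> V"
    and "st p = - p \<Longrightarrow> st q = - q \<Longrightarrow> homogeneous st a \<Longrightarrow> homogeneous st b \<Longrightarrow> homogeneous st c \<Longrightarrow>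
      p * comm b c * q * a - st a * p * comm b c * q \<in> V"
  using assms by (simp_all add: ut3_relations_def)

lemma neg_one_par_comm:
  fixes x1 x2 :: "'f::field free_alg"
  assumes "(2::'f) \<noteq> 0" "x1 \<in> xv i" "x2 \<in> xv j" "i \<noteq> j"
  shows "(-1) ^ par (comm x1 x2) * comm x1 x2 = - free_star (comm x1 x2)"
proof -
  have "comm a b = - comm b a" for a b :: "'f free_alg" by (simp add: comm_def)
  from this[of x2 x1] show ?thesis
    using assms unfolding xv_def
    by (auto simp: par_comm_mixed par_comm_same free_star_comm free_star_yv free_star_zv)
      (simp_all add: comm_def)
qed

lemma neg_one_par:
  fixes x :: "'f::field free_alg"
  assumes "(2::'f) \<noteq> 0" "x \<in> xv i"
  shows "(-1) ^ par x * x = - free_star x"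
  using assms by (auto simp: xv_def par_yv par_zv free_star_yv free_star_zv)

lemma neg_one_power_mult_commute: "(-1) ^ n * a * b = a * ((-1) ^ n * b)" for a b :: "'b::ring_1"
  by (cases "even n") simp_all

context
  fixes s :: "'f::field \<Rightarrow> 'b::ring_1 \<Rightarrow> 'b" and st :: "'b \<Rightarrow> 'b"
  assumes two: "(2::'f) \<noteq> 0" and alg: "unital_algebra s" and inv: "algebra_involution s st"
begin

lemma eval_xv_homogeneous:
  assumes "admissible st g" "x1 \<in> xv i"
  shows "homogeneous st (eval_free s g x1)"
  using assms by (auto simp: xv_def homogeneous_def admissible_def eval_free_yv[OF alg] eval_free_zv[OF alg])

lemma eval_neg_one_par_comm:
  assumes "admissible st g" "x1 \<in> xv i" "x2 \<in> xv j" "i \<noteq> j"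
  shows "eval_free s g ((-1) ^ par (comm x1 x2) * comm x1 x2) = - st (comm (eval_free s g x1) (eval_free s g x2))"
  using algebra_hom_eval_free[OF alg, of g]
  by (simp add: neg_one_par_comm[OF two assms(2-)] eval_free_star[OF alg inv assms(1)] algebra_homD(6) algebra_hom_comm)

lemma eval_neg_one_par:
  assumes "admissible st g" "x1 \<in> xv i"
  shows "eval_free s g ((-1) ^ par x1 * x1) = - st (eval_free s g x1)"
  using algebra_hom_eval_free[OF alg, of g]
  by (simp add: neg_one_par[OF two assms(2)] eval_free_star[OF alg inv assms(1)] algebra_homD(6))

text \<open>Each value is placed on the letter of its own kind, and the other letter of that index
  gets 0. The value 0 counts as skew, so that the last clause holds wherever a relation contains
  explicit letters \<open>zv\<close>.\<close>

lemma admissible_values: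
  assumes "\<And>i. homogeneous st (a i)"
  obtains g X where "admissible st g" "\<And>i. X i \<in> xv i" "\<And>i. eval_free s g (X i) = a i"
    "\<And>i. st (a i) = - a i \<Longrightarrow> X i = zv i"
proof -
  let ?g = "\<lambda>h. case h of Y i \<Rightarrow> if st (a i) = - a i then 0 else a i | Z i \<Rightarrow> if st (a i) = - a i then a i else 0"
  let ?X = "\<lambda>i. if st (a i) = - a i then zv i else yv i"
  show ?thesis
    by (rule that[of ?g ?X])
      (use assms in \<open>auto simp: admissible_def homogeneous_def xv_def algebra_involutionD[OF inv]
        eval_free_yv[OF alg] eval_free_zv[OF alg]\<close>)
qed

text \<open>The set \<open>V\<close> is arbitrary because four cases occur: \<open>{0}\<close> for
  matrices and for the quotient, the ideal in the free algebra, and the preimage of the ideal under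
  the star.\<close>

lemma eval_basis_iff:
  "(\<forall>f\<in>ut3_basis. \<forall>g. admissible st g \<longrightarrow> eval_free s g f \<in> V) \<longleftrightarrow> ut3_relations st V"
proof -
  note hom = algebra_hom_eval_free[OF alg]
  note hom_simps = algebra_homD[OF hom] algebra_hom_comm[OF hom] eval_free_zv[OF alg]
  let ?e = "eval_free s"
  have e2: "?e g ((-1) ^ par (comm x1 x2) * comm x1 x2 * comm x3 x4
         - (-1) ^ par (comm x3 x4) * comm x3 x4 * comm x1 x2)
     = st (comm (?e g x3) (?e g x4)) * comm (?e g x1) (?e g x2) - st (comm (?e g x1) (?e g x2)) * comm (?e g x3) (?e g x4)"
    if "admissible st g" "x1 \<in> xv 1" "x2 \<in> xv 2" "x3 \<in> xv 3" "x4 \<in> xv 4" for g x1 x2 x3 x4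
    using eval_neg_one_par_comm[OF that(1,2,3)] eval_neg_one_par_comm[OF that(1,4,5)]
    by (simp add: hom_simps)
  have e3: "?e g ((-1) ^ par (comm x1 x2) * comm x1 x2 * comm x3 x4
         - (-1) ^ par (comm x1 x3) * comm x1 x3 * comm x2 x4
         + (-1) ^ par (comm x1 x4) * comm x1 x4 * comm x2 x3)
     = st (comm (?e g x1) (?e g x3)) * comm (?e g x2) (?e g x4) - st (comm (?e g x1) (?e g x2)) * comm (?e g x3) (?e g x4)
       - st (comm (?e g x1) (?e g x4)) * comm (?e g x2) (?e g x3)"
    if "admissible st g" "x1 \<in> xv 1" "x2 \<in> xv 2" "x3 \<in> xv 3" "x4 \<in> xv 4" for g x1 x2 x3 x4
    using eval_neg_one_par_comm[OF that(1,2,3)] eval_neg_one_par_comm[OF that(1,2,4)] eval_neg_one_par_comm[OF that(1,2,5)]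
    by (simp add: hom_simps)
  have e4: "?e g (zv 1 * comm x3 x4 * zv 2 + (-1) ^ par (comm x3 x4) * zv 2 * comm x3 x4 * zv 1)
     = g (Z 1) * comm (?e g x3) (?e g x4) * g (Z 2) - g (Z 2) * st (comm (?e g x3) (?e g x4)) * g (Z 1)"
    if "admissible st g" "x3 \<in> xv 3" "x4 \<in> xv 4" for g x3 x4
    unfolding neg_one_power_mult_commute[of _ "zv 2"]
    using eval_neg_one_par_comm[OF that] by (simp add: hom_simps)
  have e6: "?e g (zv 1 * comm x4 x5 * zv 2 * x3 + (-1) ^ par x3 * x3 * zv 1 * comm x4 x5 * zv 2)
     = g (Z 1) * comm (?e g x4) (?e g x5) * g (Z 2) * ?e g x3 - st (?e g x3) * g (Z 1) * comm (?e g x4) (?e g x5) * g (Z 2)"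
    if "admissible st g" "x3 \<in> xv 3" for g x3 x4 x5
    using eval_neg_one_par[OF that] by (simp add: hom_simps)
  have e1: "?e g (zv 1 * comm (zv 2) (zv 3) - zv 2 * comm (zv 1) (zv 3) + zv 3 * comm (zv 1) (zv 2))
     = g (Z 1) * comm (g (Z 2)) (g (Z 3)) - g (Z 2) * comm (g (Z 1)) (g (Z 3)) + g (Z 3) * comm (g (Z 1)) (g (Z 2))" for g
    by (simp add: hom_simps)
  have e5: "?e g (comm x1 x2 * zv 5 * comm x3 x4) = comm (?e g x1) (?e g x2) * g (Z 5) * comm (?e g x3) (?e g x4)" for g x1 x2 x3 x4
    by (simp add: hom_simps)
  have h0: "homogeneous st 0" by (simp add: homogeneous_def algebra_involutionD[OF inv])
  have hs: "homogeneous st p" if "st p = - p" for p using that by (simp add: homogeneous_def)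
  show ?thesis
  proof
    assume R: "ut3_relations st V"
    show "\<forall>f\<in>ut3_basis. \<forall>g. admissible st g \<longrightarrow> ?e g f \<in> V"
    proof (intro ballI allI impI)
      fix f :: "'f free_alg" and g assume f: "f \<in> ut3_basis" and g: "admissible st g"
      have sk: "st (g (Z i)) = - g (Z i)" for i using g by (simp add: admissible_def)
      note hg = eval_xv_homogeneous[OF g]
      from f show "?e g f \<in> V" unfolding ut3_basis_def
        by (elim UnE CollectE exE conjE singletonE; simp only: e1 e2[OF g] e3[OF g] e4[OF g] e5 e6[OF g])
          (rule ut3_relationsD[OF R]; (rule sk | (rule hg, assumption)))+
    qed
  next
    assume B: "\<forall>f\<in>ut3_basis. \<forall>g. admissible st g \<longrightarrow> ?e g f \<in> V"
    have B': "?e g f \<in> V" if "f \<in> ut3_basis" "admissible st g" for f g using B that by blast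
    show "ut3_relations st V" unfolding ut3_relations_def
    proof (intro conjI allI impI)
      fix p q r assume sk: "st p = - p" "st q = - q" "st r = - r"
      \<comment> \<open>Indices that do not occur in the relation get 0, which is
        homogeneous.\<close>
      let ?a = "(\<lambda>_. 0)(1 := p, 2 := q, 3 := r)"
      obtain g X where g: "admissible st g" "\<And>i. X i \<in> xv i" "\<And>i. ?e g (X i) = ?a i"
        "\<And>i. st (?a i) = - ?a i \<Longrightarrow> X i = zv i"
        by (rule admissible_values[of ?a]) (use sk h0 hs in auto)
      have v: "g (Z 1) = p" "g (Z 2) = q" "g (Z 3) = r"
        using g(3)[of 1] g(4)[of 1] g(3)[of 2] g(4)[of 2] g(3)[of 3] g(4)[of 3] sk by (simp_all add: eval_free_zv[OF alg])
      show "p * comm q r - q * comm p r + r * comm p q \<in> V"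
        using B'[OF _ g(1), unfolded ut3_basis_def, OF UnI1, OF UnI1, OF UnI1, OF UnI1, OF UnI1, OF singletonI]
        by (simp only: e1 v)
    next
      fix a b c d assume hh: "homogeneous st a" "homogeneous st b" "homogeneous st c" "homogeneous st d"
      let ?a = "(\<lambda>_. 0)(1 := a, 2 := b, 3 := c, 4 := d)"
      obtain g X where g: "admissible st g" "\<And>i. X i \<in> xv i" "\<And>i. ?e g (X i) = ?a i"
        by (rule admissible_values[of ?a]) (use hh h0 in auto)
      have v: "?e g (X 1) = a" "?e g (X 2) = b" "?e g (X 3) = c" "?e g (X 4) = d"
        using g(3) by simp_all
      have "(-1) ^ par (comm (X 1) (X 2)) * comm (X 1) (X 2) * comm (X 3) (X 4)
         - (-1) ^ par (comm (X 3) (X 4)) * comm (X 3) (X 4) * comm (X 1) (X 2) \<in> ut3_basis"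
        unfolding ut3_basis_def using g(2) by blast
      from B'[OF this g(1)] show "st (comm c d) * comm a b - st (comm a b) * comm c d \<in> V"
        by (simp only: e2[OF g(1) g(2) g(2) g(2) g(2)] v)
    next
      fix a b c d assume hh: "homogeneous st a" "homogeneous st b" "homogeneous st c" "homogeneous st d"
      let ?a = "(\<lambda>_. 0)(1 := a, 2 := b, 3 := c, 4 := d)"
      obtain g X where g: "admissible st g" "\<And>i. X i \<in> xv i" "\<And>i. ?e g (X i) = ?a i"
        by (rule admissible_values[of ?a]) (use hh h0 in auto)
      have v: "?e g (X 1) = a" "?e g (X 2) = b" "?e g (X 3) = c" "?e g (X 4) = d"
        using g(3) by simp_all
      have "(-1) ^ par (comm (X 1) (X 2)) * comm (X 1) (X 2) * comm (X 3) (X 4)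
         - (-1) ^ par (comm (X 1) (X 3)) * comm (X 1) (X 3) * comm (X 2) (X 4)
         + (-1) ^ par (comm (X 1) (X 4)) * comm (X 1) (X 4) * comm (X 2) (X 3) \<in> ut3_basis"
        unfolding ut3_basis_def using g(2) by blast
      from B'[OF this g(1)] show "st (comm a c) * comm b d - st (comm a b) * comm c d - st (comm a d) * comm b c \<in> V"
        by (simp only: e3[OF g(1) g(2) g(2) g(2) g(2)] v)
    next
      fix p q a b assume hh: "st p = - p" "st q = - q" "homogeneous st a" "homogeneous st b"
      let ?a = "(\<lambda>_. 0)(1 := p, 2 := q, 3 := a, 4 := b)"
      obtain g X where g: "admissible st g" "\<And>i. X i \<in> xv i" "\<And>i. ?e g (X i) = ?a i"
        "\<And>i. st (?a i) = - ?a i \<Longrightarrow> X i = zv i"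
        by (rule admissible_values[of ?a]) (use hh h0 hs in auto)
      have v: "g (Z 1) = p" "g (Z 2) = q" "?e g (X 3) = a" "?e g (X 4) = b"
        using g(3)[of 1] g(4)[of 1] g(3)[of 2] g(4)[of 2] g(3)[of 3] g(3)[of 4] hh by (simp_all add: eval_free_zv[OF alg])
      have "zv 1 * comm (X 3) (X 4) * zv 2 + (-1) ^ par (comm (X 3) (X 4)) * zv 2 * comm (X 3) (X 4) * zv 1 \<in> ut3_basis"
        unfolding ut3_basis_def using g(2) by blast
      from B'[OF this g(1)] show "p * comm a b * q - q * st (comm a b) * p \<in> V"
        by (simp only: e4[OF g(1) g(2) g(2)] v)
    next
      fix p a b c d assume hh: "st p = - p" "homogeneous st a" "homogeneous st b" "homogeneous st c" "homogeneous st d"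
      let ?a = "(\<lambda>_. 0)(1 := a, 2 := b, 3 := c, 4 := d, 5 := p)"
      obtain g X where g: "admissible st g" "\<And>i. X i \<in> xv i" "\<And>i. ?e g (X i) = ?a i"
        "\<And>i. st (?a i) = - ?a i \<Longrightarrow> X i = zv i"
        by (rule admissible_values[of ?a]) (use hh h0 hs in auto)
      have v: "?e g (X 1) = a" "?e g (X 2) = b" "?e g (X 3) = c" "?e g (X 4) = d" "g (Z 5) = p"
        using g(3) g(3)[of 5] g(4)[of 5] hh by (simp_all add: eval_free_zv[OF alg])
      have "comm (X 1) (X 2) * zv 5 * comm (X 3) (X 4) \<in> ut3_basis"
        unfolding ut3_basis_def using g(2) by blast
      from B'[OF this g(1)] show "comm a b * p * comm c d \<in> V"
        by (simp only: e5 v)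
    next
      fix p q a b c assume hh: "st p = - p" "st q = - q" "homogeneous st a" "homogeneous st b" "homogeneous st c"
      let ?a = "(\<lambda>_. 0)(1 := p, 2 := q, 3 := a, 4 := b, 5 := c)"
      obtain g X where g: "admissible st g" "\<And>i. X i \<in> xv i" "\<And>i. ?e g (X i) = ?a i"
        "\<And>i. st (?a i) = - ?a i \<Longrightarrow> X i = zv i"
        by (rule admissible_values[of ?a]) (use hh h0 hs in auto)
      have v: "g (Z 1) = p" "g (Z 2) = q" "?e g (X 3) = a" "?e g (X 4) = b" "?e g (X 5) = c"
        using g(3)[of 1] g(4)[of 1] g(3)[of 2] g(4)[of 2] g(3)[of 3] g(3)[of 4] g(3)[of 5] hh by (simp_all add: eval_free_zv[OF alg])
      have "zv 1 * comm (X 4) (X 5) * zv 2 * X 3 + (-1) ^ par (X 3) * X 3 * zv 1 * comm (X 4) (X 5) * zv 2 \<in> ut3_basis"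
        unfolding ut3_basis_def using g(2) by blast
      from B'[OF this g(1)] show "p * comm b c * q * a - st a * p * comm b c * q \<in> V"
        by (simp only: e6[OF g(1) g(2)] v)
    qed
  qed
qed

end

section \<open>Matrices and the reflection\<close>

lift_definition e11 :: "'a::zero ut3 \<Rightarrow> 'a" is "\<lambda>A. A $ 1 $ 1" .
lift_definition e12 :: "'a::zero ut3 \<Rightarrow> 'a" is "\<lambda>A. A $ 1 $ 2" .
lift_definition e13 :: "'a::zero ut3 \<Rightarrow> 'a" is "\<lambda>A. A $ 1 $ 3" .
lift_definition e22 :: "'a::zero ut3 \<Rightarrow> 'a" is "\<lambda>A. A $ 2 $ 2" .
lift_definition e23 :: "'a::zero ut3 \<Rightarrow> 'a" is "\<lambda>A. A $ 2 $ 3" .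
lift_definition e33 :: "'a::zero ut3 \<Rightarrow> 'a" is "\<lambda>A. A $ 3 $ 3" .

lift_definition mk_ut3 :: "'a::zero \<Rightarrow> 'a \<Rightarrow> 'a \<Rightarrow> 'a \<Rightarrow> 'a \<Rightarrow> 'a \<Rightarrow> 'a ut3" is
  "\<lambda>a b c d e f. vector [vector [a, b, c], vector [0, d, e], vector [0, 0, f]]"
  by simp

lemma entries_mk [simp]:
  "e11 (mk_ut3 a b c d e f) = a" "e12 (mk_ut3 a b c d e f) = b" "e13 (mk_ut3 a b c d e f) = c"
  "e22 (mk_ut3 a b c d e f) = d" "e23 (mk_ut3 a b c d e f) = e" "e33 (mk_ut3 a b c d e f) = f"
  by (transfer; simp)+

lemma ut3_eq_iff:
  "A = B \<longleftrightarrow> e11 A = e11 B \<and> e12 A = e12 B \<and> e13 A = e13 B \<and> e22 A = e22 B \<and> e23 A = e23 B \<and> e33 A = e33 B"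
  by transfer (auto simp: vec_eq_iff forall_3)

lemma entries_ring [simp]:
  fixes A B :: "'a::ring_1 ut3"
  shows "e11 (A + B) = e11 A + e11 B" "e12 (A + B) = e12 A + e12 B" "e13 (A + B) = e13 A + e13 B"
    "e22 (A + B) = e22 A + e22 B" "e23 (A + B) = e23 A + e23 B" "e33 (A + B) = e33 A + e33 B"
    "e11 (A - B) = e11 A - e11 B" "e12 (A - B) = e12 A - e12 B" "e13 (A - B) = e13 A - e13 B"
    "e22 (A - B) = e22 A - e22 B" "e23 (A - B) = e23 A - e23 B" "e33 (A - B) = e33 A - e33 B"
    "e11 (- A) = - e11 A" "e12 (- A) = - e12 A" "e13 (- A) = - e13 A"
    "e22 (- A) = - e22 A" "e23 (- A) = - e23 A" "e33 (- A) = - e33 A"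
    "e11 (0 :: 'a ut3) = 0" "e12 (0 :: 'a ut3) = 0" "e13 (0 :: 'a ut3) = 0"
    "e22 (0 :: 'a ut3) = 0" "e23 (0 :: 'a ut3) = 0" "e33 (0 :: 'a ut3) = 0"
    "e11 (1 :: 'a ut3) = 1" "e12 (1 :: 'a ut3) = 0" "e13 (1 :: 'a ut3) = 0"
    "e22 (1 :: 'a ut3) = 1" "e23 (1 :: 'a ut3) = 0" "e33 (1 :: 'a ut3) = 1"
    "e11 (A * B) = e11 A * e11 B"
    "e12 (A * B) = e11 A * e12 B + e12 A * e22 B"
    "e13 (A * B) = e11 A * e13 B + e12 A * e23 B + e13 A * e33 B"
    "e22 (A * B) = e22 A * e22 B"
    "e23 (A * B) = e22 A * e23 B + e23 A * e33 B"
    "e33 (A * B) = e33 A * e33 B"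
  by (transfer; simp add: matrix_matrix_mult_def sum_3 mat_def)+

definition ut3_scalar :: "('f::field \<Rightarrow> 'a::comm_ring_1 \<Rightarrow> 'a) \<Rightarrow> 'f \<Rightarrow> 'a ut3 \<Rightarrow> 'a ut3" where
  "ut3_scalar s c A = mk_ut3 (s c (e11 A)) (s c (e12 A)) (s c (e13 A)) (s c (e22 A)) (s c (e23 A)) (s c (e33 A))"

lemma entries_ut3_scale [simp]:
  "e11 (ut3_scale c A) = c * e11 A" "e12 (ut3_scale c A) = c * e12 A" "e13 (ut3_scale c A) = c * e13 A"
  "e22 (ut3_scale c A) = c * e22 A" "e23 (ut3_scale c A) = c * e23 A" "e33 (ut3_scale c A) = c * e33 A"
  by (transfer; simp)+

lemma unital_algebra_ut3_scalar:
  assumes "unital_algebra s"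
  shows "unital_algebra (ut3_scalar s)"
proof -
  interpret vector_space s using assms by (rule unital_algebraD)
  show ?thesis
    unfolding unital_algebra_def vector_space_def ut3_eq_iff ut3_scalar_def
    by (simp add: scale_right_distrib scale_left_distrib unital_algebraD[OF assms])
qed

definition reflection :: "'a::zero ut3 \<Rightarrow> 'a ut3" where
  "reflection A = mk_ut3 (e33 A) (e23 A) (e13 A) (e22 A) (e12 A) (e11 A)"

lemma entries_reflection [simp]:
  "e11 (reflection A) = e33 A" "e12 (reflection A) = e23 A" "e13 (reflection A) = e13 A"
  "e22 (reflection A) = e22 A" "e23 (reflection A) = e12 A" "e33 (reflection A) = e11 A"
  by (simp_all add: reflection_def)

lemma linearI:
  assumes "vector_space s1" "vector_space s2" "\<And>a b. h (a + b) = h a + h b" "\<And>c a. h (s1 c a) = s2 c (h a)"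
  shows "Vector_Spaces.linear s1 s2 h"
  using assms
  by (simp add: Vector_Spaces.linear_def module_hom_def module_hom_axioms_def module_iff_vector_space)

lemma algebra_involution_reflection_scalar:
  assumes "unital_algebra (s :: 'f::field \<Rightarrow> 'a::comm_ring_1 \<Rightarrow> 'a)"
  shows "algebra_involution (ut3_scalar s) reflection"
  unfolding algebra_involution_def
  by (intro conjI allI linearI unital_algebraD(1) unital_algebra_ut3_scalar assms)
    (simp_all add: ut3_eq_iff ut3_scalar_def algebra_simps)

lemma algebra_involution_reflection: "algebra_involution (ut3_scale :: 'f::field \<Rightarrow> _) reflection"
  unfolding algebra_involution_def
  by (intro conjI allI linearI unital_algebraD(1) unital_algebra_ut3)
    (simp_all add: ut3_eq_iff algebra_simps)

text \<open>Since 2 is nonzero, a skew matrix has diagonal \<open>(s, 0, - s)\<close> and (1, 3)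
  entry 0, while commutators have zero diagonal. What remains is entrywise arithmetic.\<close>

lemma ut3_relations_reflection:
  assumes two: "(2::'f::field) \<noteq> 0"
  shows "ut3_relations (reflection :: 'f ut3 \<Rightarrow> 'f ut3) {0}"
proof -
  have z: "c = 0" if "c = - c" for c :: 'f
  proof -
    have "2 * c = 0" using that by (metis add.right_inverse mult_2)
    then show ?thesis using two by simp
  qed
  have skew: "e22 p = 0 \<and> e13 p = 0 \<and> e33 p = - e11 p \<and> e23 p = - e12 p" if "reflection p = - p" for p :: "'f ut3"
  proof -
    have "e22 p = - e22 p" "e13 p = - e13 p" "e33 p = - e11 p" "e23 p = - e12 p"
      using arg_cong[OF that, of e22] arg_cong[OF that, of e13] arg_cong[OF that, of e11] arg_cong[OF that, of e12]
      by (simp_all only: entries_reflection entries_ring)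
    then show ?thesis using z by blast
  qed
  have com: "e11 (comm a b) = 0" "e22 (comm a b) = 0" "e33 (comm a b) = 0"
    "e23 (comm a b) = (e22 a - e33 a) * e23 b - (e22 b - e33 b) * e23 a" for a b :: "'f ut3"
    by (simp_all add: comm_def algebra_simps)
  show ?thesis unfolding ut3_relations_def singleton_iff
  proof (intro conjI allI impI)
    fix p q r :: "'f ut3" assume "reflection p = - p" "reflection q = - q" "reflection r = - r"
    from this[THEN skew] show "p * comm q r - q * comm p r + r * comm p q = 0"
      by (simp add: ut3_eq_iff comm_def algebra_simps)
  next
    fix a b c d :: "'f ut3"
    show "reflection (comm c d) * comm a b - reflection (comm a b) * comm c d = 0"
      by (simp add: ut3_eq_iff com(1-3))
    show "reflection (comm a c) * comm b d - reflection (comm a b) * comm c d - reflection (comm a d) * comm b c = 0"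
      by (simp add: ut3_eq_iff com(1-3)) (simp only: com(4) ring_distribs, simp add: algebra_simps)
  next
    fix p q a b :: "'f ut3" assume "reflection p = - p" "reflection q = - q"
    from this[THEN skew] show "p * comm a b * q - q * reflection (comm a b) * p = 0"
      by (simp add: ut3_eq_iff com(1-3) algebra_simps)
  next
    fix p a b c d :: "'f ut3" assume "reflection p = - p"
    from skew[OF this] show "comm a b * p * comm c d = 0"
      by (simp add: ut3_eq_iff com(1-3))
  next
    fix p q a b c :: "'f ut3" assume "reflection p = - p" "reflection q = - q"
    from this[THEN skew] show "p * comm b c * q * a - reflection a * p * comm b c * q = 0"
      by (simp add: ut3_eq_iff com(1-3) algebra_simps)
  qed
qed

section \<open>Generic matrices\<close>

text \<open>\<open>VP\<close> is the (1, 2) entry and \<open>VQ\<close> the (2, 2) entry minus the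
  (1, 1) entry, for both kinds of letters. Only symmetric matrices have in addition an independent
  (1, 1) entry \<open>VA\<close> and a (1, 3) entry \<open>VD\<close>.\<close>

datatype var = VA nat | VQ gen | VP gen | VD nat

type_synonym 'f ut3_poly = "var multiset \<Rightarrow>\<^sub>0 'f"

definition pscale :: "'f::field \<Rightarrow> 'f ut3_poly \<Rightarrow> 'f ut3_poly" where
  "pscale c p = Poly_Mapping.single {#} c * p"

lemma ut3_poly_induct [case_names single sum]:
  fixes p :: "'f::field ut3_poly"
  assumes "\<And>m c. P (Poly_Mapping.single m c)" and "\<And>p q. P p \<Longrightarrow> P q \<Longrightarrow> P (p + q)"
  shows "P p"
proof (induction p rule: update_induct)
  case const
  show ?case using assms(1)[of "{#}" 0] by simp
next
  case (update f w c)
  have "Poly_Mapping.update w c f = f + Poly_Mapping.single w c"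
    using update.hyps
    by (intro poly_mapping_eqI) (auto simp: lookup_update lookup_add lookup_single in_keys_iff when_def)
  then show ?case using assms update.IH by simp
qed

lemma unital_algebra_pscale: "unital_algebra (pscale :: 'f::field \<Rightarrow> _)"
proof -
  have "(Poly_Mapping.single {#} 1 :: 'f ut3_poly) = 1"
    using single_one[where 'a = "var multiset" and 'b = 'f] by simp
  then show ?thesis
    by (simp add: unital_algebra_def vector_space_def pscale_def single_add distrib_left distrib_right
        mult_single mult.left_commute flip: mult.assoc)
qed

lemma lookup_pscale: "Poly_Mapping.lookup (pscale c p) m = c * Poly_Mapping.lookup p m"
proof (induction p rule: ut3_poly_induct)
  case (single k v)
  then show ?case by (simp add: pscale_def mult_single lookup_single when_def)
next
  case (sum p q)
  then show ?case by (simp add: pscale_def distrib_left lookup_add)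
qed

abbreviation mon_val :: "(var \<Rightarrow> 'f::field) \<Rightarrow> var multiset \<Rightarrow> 'f" where
  "mon_val v m \<equiv> prod_mset (image_mset v m)"

definition peval :: "(var \<Rightarrow> 'f::field) \<Rightarrow> 'f ut3_poly \<Rightarrow> 'f" where
  "peval v p = (\<Sum>m\<in>Poly_Mapping.keys p. Poly_Mapping.lookup p m * mon_val v m)"

lemma peval_single [simp]: "peval v (Poly_Mapping.single m c) = c * mon_val v m"
  by (cases "c = 0") (simp_all add: peval_def)

lemma peval_add [simp]: "peval v (p + q) = peval v p + peval v q"
proof -
  let ?t = "\<lambda>p m. Poly_Mapping.lookup p m * mon_val v m"
  have ext: "peval v p = sum (?t p) A" if "finite A" "Poly_Mapping.keys p \<subseteq> A" for p A
    unfolding peval_def using that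
    by (intro sum.mono_neutral_left) (auto simp: in_keys_iff)
  let ?A = "Poly_Mapping.keys p \<union> Poly_Mapping.keys q"
  have "peval v (p + q) = sum (?t (p + q)) ?A"
    using keys_add[of p q] by (intro ext) auto
  also have "\<dots> = sum (?t p) ?A + sum (?t q) ?A"
    by (simp add: lookup_add distrib_right sum.distrib)
  finally show ?thesis
    using ext[of ?A p] ext[of ?A q] by simp
qed

lemma peval_mult [simp]: "peval v (p * q) = peval v p * peval v q"
proof (induction p rule: ut3_poly_induct)
  case (single k a)
  show ?case
  proof (induction q rule: ut3_poly_induct)
    case (single k' a')
    show ?case by (simp add: mult_single)
  next
    case (sum p q)
    then show ?case by (simp add: distrib_left)
  qed
next
  case (sum p q)
  then show ?case by (simp add: distrib_right)
qed

lemma peval_pscale: "peval v (pscale c p) = c * peval v p"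
  by (simp add: pscale_def)

lemma peval_one: "peval v 1 = 1"
  using peval_single[of v "{#}" 1] single_one[where 'a = "var multiset"] by simp

lemma peval_zero [simp]: "peval v 0 = 0"
  by (simp add: peval_def)

text \<open>Take a variable with different exponents and set all others to 1. The two powers of
  \<open>t\<close> differ outside the finitely many roots of a nonzero polynomial.\<close>

lemma mon_val_separates:
  assumes "infinite (UNIV :: 'f::field set)" "m \<noteq> n"
  obtains v :: "var \<Rightarrow> 'f::field" where "mon_val v m \<noteq> mon_val v n"
proof -
  obtain x where x: "count m x \<noteq> count n x" using assms(2) by (meson multiset_eqI)
  let ?p = "Polynomial.monom 1 (count m x) - Polynomial.monom 1 (count n x) :: 'f poly"
  have "Polynomial.coeff ?p (count m x) \<noteq> 0" using x by simp
  then have "?p \<noteq> 0" by (metis coeff_0)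
  then have "finite {t. poly ?p t = 0}" by (rule poly_roots_finite)
  then obtain t where "poly ?p t \<noteq> 0" using assms(1) by (metis (mono_tags, lifting) UNIV_I ex_new_if_finite mem_Collect_eq)
  then have t: "t ^ count m x \<noteq> t ^ count n x" by (simp add: poly_monom)
  have "mon_val (\<lambda>y. if y = x then t else 1) k = t ^ count k x" for k
    by (induction k) auto
  then show ?thesis using that[of "\<lambda>y. if y = x then t else 1"] t by simp
qed

text \<open>Dedekind's argument: distinct monomials are distinct characters of the multiplicative
  monoid of all valuations.\<close>

lemma mon_val_independent:
  assumes inf: "infinite (UNIV :: 'f::field set)" and "finite S"
    and "\<And>v. (\<Sum>m\<in>S. c m * mon_val v m) = (0::'f)" and "m \<in> S"
  shows "c m = 0"
  using assms(2-)
proof (induction S arbitrary: c m rule: finite_induct)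
  case empty
  then show ?case by simp
next
  case (insert m0 S)
  have eq: "c m0 * mon_val v m0 + (\<Sum>m\<in>S. c m * mon_val v m) = 0" for v
    using insert.prems(1)[of v] insert.hyps by simp
  then have e: "(\<Sum>m\<in>S. c m * mon_val v m) = - (c m0 * mon_val v m0)" for v
    by (metis add_eq_0_iff)
  have S: "c m = 0" if m: "m \<in> S" for m
  proof -
    obtain w :: "var \<Rightarrow> 'f" where w: "mon_val w m \<noteq> mon_val w m0"
      using mon_val_separates[OF inf, of m m0] insert.hyps m by metis
    have "c m * (mon_val w m - mon_val w m0) = 0"
    proof (rule insert.IH[OF _ m])
      fix v
      have mult: "mon_val (\<lambda>x. v x * w x) k = mon_val v k * mon_val w k" for k
        by (induction k) auto
      have "(\<Sum>m\<in>S. c m * (mon_val w m - mon_val w m0) * mon_val v m)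
        = (\<Sum>m\<in>S. c m * mon_val (\<lambda>x. v x * w x) m) - mon_val w m0 * (\<Sum>m\<in>S. c m * mon_val v m)"
        by (simp add: mult sum_distrib_left sum_subtractf algebra_simps)
      also have "\<dots> = 0" unfolding e by (simp add: mult)
      finally show "(\<Sum>m\<in>S. c m * (mon_val w m - mon_val w m0) * mon_val v m) = 0" .
    qed
    then show ?thesis using w by simp
  qed
  then have "c m0 * mon_val (\<lambda>_. 1) m0 = 0"
    using eq[of "\<lambda>_. 1"] by simp
  then have "c m0 = 0" by simp
  then show ?case using S insert.prems(2) by auto
qed

lemma peval_eq_zero_imp:
  assumes "infinite (UNIV :: 'f::field set)" "\<And>v. peval v (p :: 'f::field ut3_poly) = 0"
  shows "p = 0"
proof -
  have "Poly_Mapping.lookup p m = 0" if "m \<in> Poly_Mapping.keys p" for m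
    using mon_val_independent[OF assms(1), of "Poly_Mapping.keys p" "Poly_Mapping.lookup p" m] assms(2) that
    by (simp add: peval_def)
  then show ?thesis by (metis in_keys_iff keys_eq_empty equals0I)
qed

definition ut3_mono :: "nat multiset \<Rightarrow> gen multiset \<Rightarrow> gen multiset \<Rightarrow> nat multiset \<Rightarrow> var multiset" where
  "ut3_mono a q p d = image_mset VA a + image_mset VQ q + image_mset VP p + image_mset VD d"

lemma ut3_mono_inject [simp]: "ut3_mono a q p d = ut3_mono a' q' p' d' \<longleftrightarrow> a = a' \<and> q = q' \<and> p = p' \<and> d = d'"
proof
  have i: "count (image_mset f M) (f x) = count M x" if "inj f" for f :: "'b \<Rightarrow> var" and M x
    using that by (induction M) (auto dest: injD)
  have z: "count (image_mset f M) v = 0" if "v \<notin> range f" for f :: "'b \<Rightarrow> var" and M v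
    using that by (induction M) auto
  have c: "count (ut3_mono a q p d) (VA n) = count a n" "count (ut3_mono a q p d) (VQ g) = count q g"
    "count (ut3_mono a q p d) (VP g) = count p g" "count (ut3_mono a q p d) (VD n) = count d n" for a q p d n g
    by (simp_all add: ut3_mono_def i z inj_def image_iff)
  assume "ut3_mono a q p d = ut3_mono a' q' p' d'"
  then show "a = a' \<and> q = q' \<and> p = p' \<and> d = d'"
    using c by (metis multiset_eqI)
qed auto

definition pmon :: "nat multiset \<Rightarrow> gen multiset \<Rightarrow> gen multiset \<Rightarrow> nat multiset \<Rightarrow> 'f::field ut3_poly" where
  "pmon a q p d = Poly_Mapping.single (ut3_mono a q p d) 1"

lemma pmon_mult: "pmon a q p d * pmon a' q' p' d' = pmon (a + a') (q + q') (p + p') (d + d')"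
proof -
  have "ut3_mono a q p d + ut3_mono a' q' p' d' = ut3_mono (a + a') (q + q') (p + p') (d + d')"
    by (simp add: ut3_mono_def ac_simps)
  then show ?thesis by (simp add: pmon_def mult_single)
qed

lemma pmon_empty: "pmon {#} {#} {#} {#} = 1"
  using single_one[where 'a = "var multiset"] by (simp add: pmon_def ut3_mono_def)

lemma lookup_pmon: "Poly_Mapping.lookup (pmon a q p d) (ut3_mono a' q' p' d') =
    (if a = a' \<and> q = q' \<and> p = p' \<and> d = d' then 1 else 0)"
  by (simp add: pmon_def lookup_single when_def)

text \<open>With \<open>s = - VQ (Z i)\<close> and \<open>b - a = VQ (Y i)\<close> for the diagonal entries \<open>(a, b, a)\<close> of a symmetric
  and \<open>(s, 0, - s)\<close> of a skew-symmetric matrix, the entry \<open>(1, 2)\<close> of every commutator of two generic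
  matrices is the determinant \<open>VP i * VQ j - VP j * VQ i\<close>.\<close>

fun generic :: "gen \<Rightarrow> 'f::field ut3_poly ut3" where
  "generic (Y i) = mk_ut3 (pmon {#i#} {#} {#} {#}) (pmon {#} {#} {#Y i#} {#}) (pmon {#} {#} {#} {#i#})
     (pmon {#i#} {#} {#} {#} + pmon {#} {#Y i#} {#} {#}) (pmon {#} {#} {#Y i#} {#}) (pmon {#i#} {#} {#} {#})"
| "generic (Z i) = mk_ut3 (- pmon {#} {#Z i#} {#} {#}) (pmon {#} {#} {#Z i#} {#}) 0 0
     (- pmon {#} {#} {#Z i#} {#}) (pmon {#} {#Z i#} {#} {#})"

lemma admissible_generic: "admissible reflection generic"
  by (simp add: admissible_def ut3_eq_iff)

lemma star_identities_reflection_generic: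
  assumes inf: "infinite (UNIV :: 'f::field set)"
    and f: "f \<in> star_identities ut3_scale (reflection :: 'f ut3 \<Rightarrow> _)"
  shows "eval_free (ut3_scalar pscale) generic f = 0"
proof -
  define h where "h v A = mk_ut3 (peval v (e11 A)) (peval v (e12 A)) (peval v (e13 A))
    (peval v (e22 A)) (peval v (e23 A)) (peval v (e33 A))" for v and A :: "'f ut3_poly ut3"
  have hom: "algebra_hom (ut3_scalar pscale) ut3_scale (h v)" for v
    by (intro algebra_homI unital_algebraD(1) unital_algebra_ut3 unital_algebra_ut3_scalar unital_algebra_pscale)
      (simp_all add: h_def ut3_eq_iff ut3_scalar_def peval_pscale peval_one)
  have "h v (eval_free (ut3_scalar pscale) generic f) = 0" for v
  proof -
    have "admissible reflection (\<lambda>x. h v (generic x))"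
      unfolding admissible_def
      by (auto simp: ut3_eq_iff h_def pmon_def algebra_homD[OF hom] simp flip: single_uminus)
    then have "eval_free ut3_scale (\<lambda>x. h v (generic x)) f = 0"
      using f by (simp add: star_identities_iff)
    then show ?thesis by (simp add: algebra_hom_eval_free_comp[OF hom])
  qed
  then show ?thesis
    by (auto simp: ut3_eq_iff h_def intro!: peval_eq_zero_imp[OF inf])
qed

section \<open>Linear independence of the normal forms\<close>

lemma doubleton_mset_eq_iff: "{#a, b#} = {#c, d#} \<longleftrightarrow> a = c \<and> b = d \<or> a = d \<and> b = c"
  by (auto simp: add_eq_conv_diff)

lemma sorted_mset_eq: "sorted xs \<Longrightarrow> sorted ys \<Longrightarrow> mset xs = mset ys \<Longrightarrow> xs = ys"
  using properties_for_sort by metis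

lemma single_term_zero:
  fixes c :: "'i \<Rightarrow> 'f::field"
  assumes "finite T" "t0 \<in> T" "(\<Sum>t\<in>T. c t * L t) = 0"
    and "\<And>t. t \<in> T \<Longrightarrow> t \<noteq> t0 \<Longrightarrow> c t \<noteq> 0 \<Longrightarrow> L t = 0" and "L t0 \<noteq> 0"
  shows "c t0 = 0"
proof -
  have "(\<Sum>t\<in>T - {t0}. c t * L t) = 0"
    by (rule sum.neutral) (use assms(4) in auto)
  then have "c t0 * L t0 = 0"
    using assms(3) sum.remove[OF assms(1,2), of "\<lambda>t. c t * L t"] by simp
  then show ?thesis using assms(5) by simp
qed

definition bracket :: "gen \<Rightarrow> gen \<Rightarrow> 'f::field ut3_poly" where
  "bracket i j = pmon {#} {#j#} {#i#} {#} - pmon {#} {#i#} {#j#} {#}"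

lemma comm_generic:
  "e11 (comm (generic i) (generic j)) = 0" "e22 (comm (generic i) (generic j)) = 0"
  "e33 (comm (generic i) (generic j)) = 0" "e12 (comm (generic i) (generic j)) = bracket i j"
  by (cases i; cases j; simp add: comm_def bracket_def pmon_mult add_mset_commute algebra_simps)+

lemma lookup_mon_bracket:
  "Poly_Mapping.lookup (pmon a q {#} {#} * bracket i j) (ut3_mono a' (add_mset i' q') {#j'#} {#}) =
     (if a = a' \<and> add_mset j q = add_mset i' q' \<and> i = j' then 1 else 0)
     - (if a = a' \<and> add_mset i q = add_mset i' q' \<and> j = j' then 1 else 0)"
  by (simp add: bracket_def right_diff_distrib pmon_mult lookup_minus lookup_pmon conj_commute)

text \<open>The (1, 1) entry of a generic letter is a \<open>VA\<close> for symmetric and minus a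
  \<open>VQ\<close> for skew letters; \<open>y_part\<close> and \<open>z_part\<close> are the
  resulting exponents for a word.\<close>

fun y_part :: "gen list \<Rightarrow> nat multiset" where
  "y_part [] = {#}"
| "y_part (Y i # w) = add_mset i (y_part w)"
| "y_part (Z i # w) = y_part w"

fun z_part :: "gen list \<Rightarrow> gen multiset" where
  "z_part [] = {#}"
| "z_part (Y i # w) = z_part w"
| "z_part (Z i # w) = add_mset (Z i) (z_part w)"

lemma mset_y_part_z_part: "mset w = image_mset Y (y_part w) + z_part w"
  by (induction w rule: y_part.induct) auto

locale ut3_generic_quotient = ut3_star_quotient smul st x
  for smul :: "'f::field \<Rightarrow> 'r::ring_1 \<Rightarrow> 'r" and st :: "'r \<Rightarrow> 'r" and x :: "gen \<Rightarrow> 'r" +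
  fixes \<Phi> :: "'r \<Rightarrow> 'f ut3_poly ut3"
  assumes hom: "algebra_hom smul (ut3_scalar pscale) \<Phi>"
    and \<Phi>_x [simp]: "\<Phi> (x g) = generic g"
    and \<Phi>_st [simp]: "\<Phi> (st r) = reflection (\<Phi> r)"
begin

lemmas \<Phi>_simps [simp] = algebra_homD(1,3-7)[OF hom] algebra_hom_comm[OF hom]

lemma \<Phi>_ad:
  "e11 (\<Phi> (ad gs (xcomm i j))) = 0 \<and> e22 (\<Phi> (ad gs (xcomm i j))) = 0 \<and> e33 (\<Phi> (ad gs (xcomm i j))) = 0 \<and>
   e12 (\<Phi> (ad gs (xcomm i j))) = pmon {#} (mset gs) {#} {#} * bracket i j"
proof (induction gs rule: rev_induct)
  case Nil
  show ?case by (simp add: comm_generic pmon_empty)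
next
  case (snoc g gs)
  have "pmon {#} (mset (gs @ [g])) {#} {#} = (pmon {#} (mset gs) {#} {#} * pmon {#} {#g#} {#} {#} :: 'f ut3_poly)"
    by (simp add: pmon_mult)
  then show ?case using snoc unfolding ad_append ad_Cons ad_Nil \<Phi>_simps comm_def[of _ "\<Phi> (x g)"]
    by (cases g) (simp_all add: algebra_simps)
qed

lemma \<Phi>_yword:
  "e11 (\<Phi> (yword ys)) = pmon (mset ys) {#} {#} {#}" "e33 (\<Phi> (yword ys)) = pmon (mset ys) {#} {#} {#}"
  by (induction ys) (simp_all add: pmon_mult pmon_empty)

lemma \<Phi>_zword: "e33 (\<Phi> (zword \<gamma>)) = pmon {#} (mset (map Z \<gamma>)) {#} {#}"
  by (induction \<gamma>) (simp_all add: pmon_mult pmon_empty)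

lemma \<Phi>_word:
  "e11 (\<Phi> (word w)) = pmon (y_part w) (z_part w) {#} {#} \<or> e11 (\<Phi> (word w)) = - pmon (y_part w) (z_part w) {#} {#}"
  by (induction w rule: y_part.induct) (auto simp: pmon_mult pmon_empty)

lemma \<Phi>_left_comm:
  "e11 (\<Phi> (left_comm ys i j gs)) = 0"
  "e12 (\<Phi> (left_comm ys i j gs)) = pmon (mset ys) (mset gs) {#} {#} * bracket i j"
  using \<Phi>_ad[of gs i j] by (simp_all add: left_comm_def \<Phi>_yword pmon_mult flip: mult.assoc)

lemma \<Phi>_right_comm:
  "e11 (\<Phi> (right_comm ys i j gs k)) = 0" "e12 (\<Phi> (right_comm ys i j gs k)) = 0"
  "e23 (\<Phi> (right_comm ys i j gs k)) = pmon (mset ys) (mset (gs @ [Z k])) {#} {#} * bracket i j"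
proof -
  have "pmon {#} (mset gs) {#} {#} * bracket i j * pmon (mset ys) {#} {#} {#} * pmon {#} {#Z k#} {#} {#}
    = (pmon {#} (mset gs) {#} {#} * pmon (mset ys) {#} {#} {#} * pmon {#} {#Z k#} {#} {#}) * bracket i j"
    by (simp only: ac_simps)
  also have "\<dots> = pmon (mset ys) (mset (gs @ [Z k])) {#} {#} * bracket i j"
    by (simp only: pmon_mult) simp
  finally show "e23 (\<Phi> (right_comm ys i j gs k)) = pmon (mset ys) (mset (gs @ [Z k])) {#} {#} * bracket i j"
    using \<Phi>_ad[of gs i j] by (simp add: right_comm_def \<Phi>_yword)
  show "e11 (\<Phi> (right_comm ys i j gs k)) = 0" "e12 (\<Phi> (right_comm ys i j gs k)) = 0"
    using \<Phi>_ad[of gs i j] by (simp_all add: right_comm_def)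
qed

lemma \<Phi>_comm_prod:
  "e11 (\<Phi> (comm_prod ys i j k l gs)) = 0" "e12 (\<Phi> (comm_prod ys i j k l gs)) = 0" "e23 (\<Phi> (comm_prod ys i j k l gs)) = 0"
  "e13 (\<Phi> (comm_prod ys i j k l gs)) = pmon (mset ys) (mset gs) {#} {#} * (bracket i j * bracket k l)"
proof -
  have "pmon (mset ys) {#} {#} {#} * (bracket i j * (pmon {#} (mset gs) {#} {#} * bracket k l))
    = (pmon (mset ys) {#} {#} {#} * pmon {#} (mset gs) {#} {#}) * (bracket i j * bracket k l)"
    by (simp only: ac_simps)
  also have "\<dots> = pmon (mset ys) (mset gs) {#} {#} * (bracket i j * bracket k l)"
    by (simp only: pmon_mult) simp
  finally show "e13 (\<Phi> (comm_prod ys i j k l gs)) = pmon (mset ys) (mset gs) {#} {#} * (bracket i j * bracket k l)"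
    using \<Phi>_ad[of gs k l] by (simp add: comm_prod_def \<Phi>_yword comm_generic)
  show "e11 (\<Phi> (comm_prod ys i j k l gs)) = 0" "e12 (\<Phi> (comm_prod ys i j k l gs)) = 0" "e23 (\<Phi> (comm_prod ys i j k l gs)) = 0"
    using \<Phi>_ad[of gs k l] by (simp_all add: comm_prod_def comm_generic)
qed

lemma lookup_comm_prod:
  "Poly_Mapping.lookup (e13 (\<Phi> (comm_prod ys i j k l gs))) (ut3_mono a q p d) =
     (if mset ys = a \<and> mset (j # l # gs) = q \<and> {#i, k#} = p \<and> {#} = d then 1 else 0)
   - (if mset ys = a \<and> mset (j # k # gs) = q \<and> {#i, l#} = p \<and> {#} = d then 1 else 0)
   - (if mset ys = a \<and> mset (i # l # gs) = q \<and> {#j, k#} = p \<and> {#} = d then 1 else 0)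
   + (if mset ys = a \<and> mset (i # k # gs) = q \<and> {#j, l#} = p \<and> {#} = d then 1 else 0)"
proof -
  have "pmon (mset ys) (mset gs) {#} {#} * (bracket i j * bracket k l) =
      pmon (mset ys) (mset (j # l # gs)) {#i, k#} {#} - pmon (mset ys) (mset (j # k # gs)) {#i, l#} {#}
      - pmon (mset ys) (mset (i # l # gs)) {#j, k#} {#} + (pmon (mset ys) (mset (i # k # gs)) {#j, l#} {#} :: 'f ut3_poly)"
    by (simp add: bracket_def ring_distribs pmon_mult add_mset_commute)
  then show ?thesis
    by (simp add: \<Phi>_comm_prod lookup_add lookup_minus lookup_pmon)
qed

lemma \<Phi>_sandwich:
  "e11 (\<Phi> (sandwich ys n a b c \<gamma>)) = 0" "e12 (\<Phi> (sandwich ys n a b c \<gamma>)) = 0" "e23 (\<Phi> (sandwich ys n a b c \<gamma>)) = 0"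
proof -
  define C where "C = \<Phi> (xcomm (Y n) (Z b))"
  have C: "e11 C = 0" "e22 C = 0" "e33 C = 0"
    unfolding C_def algebra_hom_comm[OF hom] \<Phi>_x by (rule comm_generic)+
  have "\<Phi> (sandwich ys n a b c \<gamma>) = \<Phi> (yword ys) * (generic (Z a) * C * generic (Z c)) * \<Phi> (zword \<gamma>)"
    by (simp add: sandwich_def C_def)
  then show "e11 (\<Phi> (sandwich ys n a b c \<gamma>)) = 0" "e12 (\<Phi> (sandwich ys n a b c \<gamma>)) = 0" "e23 (\<Phi> (sandwich ys n a b c \<gamma>)) = 0"
    by (simp_all add: C)
qed

text \<open>A monomial with one \<open>VD\<close> and no \<open>VP\<close> can only come from the
  (1, 3) entry \<open>E + E\<close> of the inner commutator; the terms \<open>F1\<close> and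
  \<open>F2\<close> contain \<open>VP\<close>. Hence the coefficient -2, while products of
  commutators contain no \<open>VD\<close> at all.\<close>

lemma lookup_sandwich:
  "Poly_Mapping.lookup (e13 (\<Phi> (sandwich ys n a b c \<gamma>))) (ut3_mono ys' q {#} {#n'#}) =
     (if mset ys = ys' \<and> mset (map Z (a # b # c # \<gamma>)) = q \<and> n = n' then - 2 else 0)"
proof -
  define C where "C = \<Phi> (xcomm (Y n) (Z b))"
  have C: "e11 C = 0" "e22 C = 0" "e33 C = 0" "e12 C = bracket (Y n) (Z b)"
    unfolding C_def algebra_hom_comm[OF hom] \<Phi>_x by (rule comm_generic)+
  define E :: "'f ut3_poly" where "E = pmon {#} {#Z b#} {#} {#n#} - pmon {#} {#} {#Y n, Z b#} {#}"
  have C': "e23 C = bracket (Y n) (Z b)" "e13 C = E + E"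
    by (simp_all add: C_def E_def comm_def bracket_def pmon_mult algebra_simps add_mset_commute)
  let ?m = "ut3_mono ys' q {#} {#n'#}" and ?y = "pmon (mset ys) {#} {#} {#} :: 'f ut3_poly"
    and ?z = "pmon {#} (mset (map Z \<gamma>)) {#} {#} :: 'f ut3_poly"
  define F1 where "F1 = ?y * (pmon {#} {#Z a#} {#} {#} * bracket (Y n) (Z b) * pmon {#} {#} {#Z c#} {#}) * ?z"
  define F2 where "F2 = ?y * (pmon {#} {#} {#Z a#} {#} * bracket (Y n) (Z b) * pmon {#} {#Z c#} {#} {#}) * ?z"
  define F where "F = ?y * (pmon {#} {#Z a#} {#} {#} * E * pmon {#} {#Z c#} {#} {#}) * ?z"
  have "\<Phi> (sandwich ys n a b c \<gamma>) = \<Phi> (yword ys) * (generic (Z a) * C * generic (Z c)) * \<Phi> (zword \<gamma>)"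
    by (simp add: sandwich_def C_def)
  then have "e13 (\<Phi> (sandwich ys n a b c \<gamma>)) = F1 + F2 - (F + F)"
    by (simp add: C C' \<Phi>_yword \<Phi>_zword F1_def F2_def F_def algebra_simps)
  then have "Poly_Mapping.lookup (e13 (\<Phi> (sandwich ys n a b c \<gamma>))) ?m = Poly_Mapping.lookup F1 ?m
      + Poly_Mapping.lookup F2 ?m - (Poly_Mapping.lookup F ?m + Poly_Mapping.lookup F ?m)"
    by (simp only: lookup_add lookup_minus)
  moreover have "Poly_Mapping.lookup F1 ?m = 0" "Poly_Mapping.lookup F2 ?m = 0"
    by (simp_all add: F1_def F2_def bracket_def ring_distribs pmon_mult lookup_minus lookup_pmon)
  moreover have "Poly_Mapping.lookup F ?m =
      (if mset ys = ys' \<and> mset (map Z (a # b # c # \<gamma>)) = q \<and> n = n' then 1 else 0)"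
    by (simp add: F_def E_def ring_distribs pmon_mult lookup_minus lookup_pmon add_mset_commute)
  ultimately show ?thesis by simp
qed

end

lemma sorted_Cons_iff_min:
  assumes "sorted (i # gs)" "sorted (i' # gs')" "add_mset i (mset gs) = add_mset i' (mset gs')"
  shows "i = i' \<and> gs = gs'"
  using sorted_mset_eq[OF assms(1,2)] assms(3) by simp

text \<open>The monomial whose only \<open>VP\<close>-factor is the larger letter of the commutator determines the
  index, since the smaller letter is the least of the remaining ones.\<close>

lemma lookup_mon_bracket_standard:
  assumes "i < j" "sorted (i # gs)" "i' < j'" "sorted (i' # gs')" "sorted ys" "sorted ys'"
  shows "Poly_Mapping.lookup (pmon (mset ys') (mset gs') {#} {#} * bracket i' j')
      (ut3_mono (mset ys) (add_mset i (mset gs)) {#j#} {#})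
    = (if ys = ys' \<and> i = i' \<and> j = j' \<and> gs = gs' then - 1 else 0 :: 'f::field)"
proof -
  have 1: False if "add_mset j' (mset gs') = add_mset i (mset gs)" "i' = j"
  proof -
    have "i \<in># add_mset j' (mset gs')" unfolding that(1) by simp
    then show False using that(2) assms by auto
  qed
  have 2: "ys = ys'" if "mset ys' = mset ys"
    using sorted_mset_eq[OF assms(5,6)] that by simp
  have 3: "i = i' \<and> gs = gs'" if "add_mset i' (mset gs') = add_mset i (mset gs)"
    using sorted_Cons_iff_min[OF assms(2,4)] that by simp
  have A: "\<not> (mset ys' = mset ys \<and> add_mset j' (mset gs') = add_mset i (mset gs) \<and> i' = j)"
    using 1 by blast
  have B: "mset ys' = mset ys \<and> add_mset i' (mset gs') = add_mset i (mset gs) \<and> j' = j \<longleftrightarrow>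
      ys = ys' \<and> i = i' \<and> j = j' \<and> gs = gs'"
    using 2 3 by blast
  show ?thesis unfolding lookup_mon_bracket if_not_P[OF A] B by simp
qed

context ut3_generic_quotient
begin

lemma standard_sum:
  obtains T c where "finite T" "\<And>t. t \<in> T \<Longrightarrow> nf_standard t" "r = (\<Sum>t\<in>T. smul (c t) (normal_form t))"
proof -
  obtain B d where B: "finite B" "B \<subseteq> standard_nfs" "r = (\<Sum>b\<in>B. smul (d b) b)"
    using in_span_standard[of r] unfolding span_explicit by blast
  then obtain T where T: "T \<subseteq> Collect nf_standard" "inj_on normal_form T" "B = normal_form ` T"
    by (meson subset_image_inj)
  show ?thesis
  proof (rule that[of T "\<lambda>t. d (normal_form t)"])
    show "finite T" using B(1) T by (simp add: finite_image_iff)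
    show "nf_standard t" if "t \<in> T" for t using T that by auto
    show "r = (\<Sum>t\<in>T. smul (d (normal_form t)) (normal_form t))"
      using B(3) T by (simp add: sum.reindex)
  qed
qed

abbreviation coef :: "('f ut3_poly ut3 \<Rightarrow> 'f ut3_poly) \<Rightarrow> nf_index \<Rightarrow> var multiset \<Rightarrow> 'f" where
  "coef e t m \<equiv> Poly_Mapping.lookup (e (\<Phi> (normal_form t))) m"

lemma lookup_sum:
  assumes "\<And>A B. e (A + B) = e A + e B" "\<And>c A. e (ut3_scalar pscale c A) = pscale c (e A)" "e 0 = 0"
  shows "Poly_Mapping.lookup (e (\<Phi> (\<Sum>t\<in>T. smul (c t) (normal_form t)))) m
    = (\<Sum>t\<in>T. c t * coef e t m)"
proof (cases "finite T")
  case True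
  then show ?thesis
    by (induction T) (simp_all add: assms lookup_add lookup_pscale algebra_homD(2)[OF hom])
next
  case False
  then show ?thesis by (simp add: assms)
qed

text \<open>The families are eliminated in the order words, left, right, sandwiches, products. The
  coefficient used for each family vanishes on all later ones, and the earlier ones are already
  gone; for example, a left commutator may have a nonzero (2, 3) entry and must precede the right
  ones.\<close>

theorem \<Phi>_eq_zero_imp:
  assumes "\<Phi> r = 0"
  shows "r = 0"
proof -
  obtain T c where fin: "finite T" and std: "\<And>t. t \<in> T \<Longrightarrow> nf_standard t"
    and r: "r = (\<Sum>t\<in>T. smul (c t) (normal_form t))"
    using standard_sum by blast
  have sum0: "(\<Sum>t\<in>T. c t * coef e t m) = 0"
    if "e \<in> {e11, e12, e13, e23}" for e m
    using lookup_sum[of e c T m] that assms unfolding r by (auto simp: ut3_scalar_def)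
  have single: "c t0 = 0"
    if "e \<in> {e11, e12, e13, e23}" "t0 \<in> T"
      "\<And>t. t \<in> T \<Longrightarrow> t \<noteq> t0 \<Longrightarrow> c t \<noteq> 0 \<Longrightarrow> coef e t m = 0"
      "coef e t0 m \<noteq> 0" for e t0 m
    by (rule single_term_zero[where L = "\<lambda>t. coef e t m"])
      (use fin that sum0 in auto)
  have c0: "c (NF_word w) = 0" if w: "NF_word w \<in> T" for w
  proof (rule single[of e11 _ "ut3_mono (y_part w) (z_part w) {#} {#}"])
    let ?m = "ut3_mono (y_part w) (z_part w) {#} {#}"
    show "coef e11 (NF_word w) ?m \<noteq> 0"
      using \<Phi>_word[of w] by (auto simp: lookup_pmon)
    fix t assume t: "t \<in> T" "t \<noteq> NF_word w"
    show "coef e11 t ?m = 0"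
    proof (cases t)
      case (NF_word w')
      have "\<not> (y_part w' = y_part w \<and> z_part w' = z_part w)"
      proof
        assume "y_part w' = y_part w \<and> z_part w' = z_part w"
        then have "mset w' = mset w" by (simp add: mset_y_part_z_part[of w] mset_y_part_z_part[of w'])
        then show False using sorted_mset_eq[of w' w] std[OF t(1)] std[OF w] t(2) NF_word by simp
      qed
      then show ?thesis using \<Phi>_word[of w'] NF_word by (auto simp: lookup_pmon)
    qed (simp_all add: \<Phi>_left_comm \<Phi>_right_comm \<Phi>_sandwich \<Phi>_comm_prod)
  qed (use w in auto)
  have c1: "c (NF_left ys i j gs) = 0" if t0: "NF_left ys i j gs \<in> T" for ys i j gs
  proof (rule single[of e12 _ "ut3_mono (mset ys) (add_mset i (mset gs)) {#j#} {#}"])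
    let ?m = "ut3_mono (mset ys) (add_mset i (mset gs)) {#j#} {#}"
    have s0: "i < j" "sorted (i # gs)" "sorted ys" using std[OF t0] by auto
    show "coef e12 (NF_left ys i j gs) ?m \<noteq> 0"
      using s0 by (simp add: \<Phi>_left_comm lookup_mon_bracket_standard)
    fix t assume t: "t \<in> T" "t \<noteq> NF_left ys i j gs" "c t \<noteq> 0"
    show "coef e12 t ?m = 0"
    proof (cases t)
      case (NF_word w')
      then show ?thesis using c0 t by simp
    next
      case (NF_left ys' i' j' gs')
      then have "i' < j'" "sorted (i' # gs')" "sorted ys'" using std[OF t(1)] by auto
      then show ?thesis using NF_left t(2) s0
        by (simp only: normal_form.simps \<Phi>_left_comm lookup_mon_bracket_standard) auto
    qed (simp_all add: \<Phi>_right_comm \<Phi>_sandwich \<Phi>_comm_prod)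
  qed (use t0 in auto)
  have c2: "c (NF_right ys i j gs k) = 0" if t0: "NF_right ys i j gs k \<in> T" for ys i j gs k
  proof (rule single[of e23 _ "ut3_mono (mset ys) (add_mset i (mset (gs @ [Z k]))) {#j#} {#}"])
    let ?m = "ut3_mono (mset ys) (add_mset i (mset (gs @ [Z k]))) {#j#} {#}"
    have s0: "i < j" "sorted (i # gs @ [Z k])" "sorted ys" using std[OF t0] by auto
    show "coef e23 (NF_right ys i j gs k) ?m \<noteq> 0"
      using s0 by (simp only: normal_form.simps \<Phi>_right_comm lookup_mon_bracket_standard) simp
    fix t assume t: "t \<in> T" "t \<noteq> NF_right ys i j gs k" "c t \<noteq> 0"
    show "coef e23 t ?m = 0"
    proof (cases t)
      case (NF_word w')
      then show ?thesis using c0 t by simp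
    next
      case (NF_left ys' i' j' gs')
      then show ?thesis using c1 t by simp
    next
      case (NF_right ys' i' j' gs' k')
      then have "i' < j'" "sorted (i' # gs' @ [Z k'])" "sorted ys'" using std[OF t(1)] by auto
      then show ?thesis using NF_right t(2) s0
        by (simp only: normal_form.simps \<Phi>_right_comm lookup_mon_bracket_standard) auto
    qed (simp_all add: \<Phi>_sandwich \<Phi>_comm_prod)
  qed (use t0 in auto)
  have cD: "c (NF_sandwich ys n a b d \<gamma>) = 0" if t0: "NF_sandwich ys n a b d \<gamma> \<in> T" for ys n a b d \<gamma>
  proof (rule single[of e13 _ "ut3_mono (mset ys) (mset (map Z (a # b # d # \<gamma>))) {#} {#n#}"])
    let ?m = "ut3_mono (mset ys) (mset (map Z (a # b # d # \<gamma>))) {#} {#n#}"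
    show "coef e13 (NF_sandwich ys n a b d \<gamma>) ?m \<noteq> 0"
      using two_neq_zero by (simp only: normal_form.simps lookup_sandwich) simp
    fix t assume t: "t \<in> T" "t \<noteq> NF_sandwich ys n a b d \<gamma>" "c t \<noteq> 0"
    show "coef e13 t ?m = 0"
    proof (cases t)
      case (NF_word w')
      then show ?thesis using c0 t by simp
    next
      case (NF_left ys' i' j' gs')
      then show ?thesis using c1 t by simp
    next
      case (NF_right ys' i' j' gs' k')
      then show ?thesis using c2 t by simp
    next
      case (NF_sandwich ys' n' a' b' d' \<gamma>')
      have "inj Z" by (simp add: inj_def)
      then have "mset (map Z (a' # b' # d' # \<gamma>')) = mset (map Z (a # b # d # \<gamma>)) \<longleftrightarrow>
          mset (a' # b' # d' # \<gamma>') = mset (a # b # d # \<gamma>)"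
        unfolding mset_map by (rule inj_eq[OF multiset.inj_map])
      moreover have "a' # b' # d' # \<gamma>' = a # b # d # \<gamma>" if "mset (a' # b' # d' # \<gamma>') = mset (a # b # d # \<gamma>)"
        by (rule sorted_mset_eq) (use std[OF t(1)] std[OF t0] NF_sandwich that in auto)
      moreover have "ys' = ys" if "mset ys' = mset ys"
        by (rule sorted_mset_eq) (use std[OF t(1)] std[OF t0] NF_sandwich that in auto)
      ultimately show ?thesis using t(2) unfolding NF_sandwich normal_form.simps lookup_sandwich by auto
    next
      case (NF_prod ys' i' j' k' l' gs')
      then show ?thesis by (simp add: lookup_comm_prod)
    qed
  qed (use t0 in auto)
  define S where "S = {t \<in> T. c t \<noteq> 0}"
  have SP: "\<exists>ys i j k l gs. t = NF_prod ys i j k l gs" if "t \<in> S" for t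
    using that c0 c1 c2 cD by (cases t) (auto simp: S_def)
  have "S = {}"
  proof (rule ccontr)
    assume "S \<noteq> {}"
    have finS: "finite S" using fin by (simp add: S_def)
    define fl where "fl t = (case t of NF_prod ys i j k l gs \<Rightarrow> l)" for t
    define fj where "fj t = (case t of NF_prod ys i j k l gs \<Rightarrow> j)" for t
    have fl: "fl (NF_prod ys i j k l gs) = l" and fj: "fj (NF_prod ys i j k l gs) = j" for ys i j k l gs
      by (simp_all add: fl_def fj_def)
    \<comment> \<open>Take the largest \<open>l\<close> among the remaining products, then the
      largest \<open>j\<close>. By this maximality, in every remaining product the three other terms
      have a \<open>VP\<close>-part different from \<open>{#j0, l0#}\<close>; the term with
      \<open>VP\<close>-part \<open>{#j, l#}\<close> recovers the index.\<close>
    define l0 where "l0 = Max (fl ` S)"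
    define S' where "S' = {t \<in> S. fl t = l0}"
    have l0: "l0 \<in> fl ` S" "\<And>t. t \<in> S \<Longrightarrow> fl t \<le> l0"
      using finS \<open>S \<noteq> {}\<close> by (simp_all add: l0_def)
    then have "S' \<noteq> {}" "finite S'" using finS by (auto simp: S'_def)
    define j0 where "j0 = Max (fj ` S')"
    have j0: "j0 \<in> fj ` S'" "\<And>t. t \<in> S' \<Longrightarrow> fj t \<le> j0"
      using \<open>S' \<noteq> {}\<close> \<open>finite S'\<close> by (simp_all add: j0_def)
    then obtain t0 where t0S': "t0 \<in> S'" "fj t0 = j0" by auto
    then have t0S: "t0 \<in> S" "fl t0 = l0" by (auto simp: S'_def)
    then obtain ys i k gs where t0: "t0 = NF_prod ys i j0 k l0 gs"
      using SP fl fj t0S' by metis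
    have t0T: "t0 \<in> T" "c t0 \<noteq> 0" using t0S by (auto simp: S_def)
    have s0: "sorted ys" "sorted (k # gs)" "i < j0" "k < l0" "i \<le> k" "j0 \<le> l0"
      using std[OF t0T(1)] t0 by auto
    have "c t0 = 0"
    proof (rule single[of e13 _ "ut3_mono (mset ys) (mset (i # k # gs)) {#j0, l0#} {#}"])
      let ?m = "ut3_mono (mset ys) (mset (i # k # gs)) {#j0, l0#} {#}"
      have other: "coef e13 t ?m
          = (if t = t0 then 1 else 0)" if "t \<in> S" for t
      proof -
        obtain ys' i' j' k' l' gs' where t: "t = NF_prod ys' i' j' k' l' gs'" using SP \<open>t \<in> S\<close> by blast
        have tT: "t \<in> T" using that by (simp add: S_def)
        have s: "sorted ys'" "sorted (k' # gs')" "i' < j'" "k' < l'" "i' \<le> k'" "j' \<le> l'"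
          using std[OF tT] t by auto
        have ll: "l' \<le> l0" using l0(2)[OF that] by (simp add: t fl)
        have jj: "j' \<le> j0" if "l' = l0"
          using j0(2)[of t] \<open>t \<in> S\<close> that by (simp add: S'_def t fl fj)
        have n1: "{#i', k'#} \<noteq> {#j0, l0#}" and n2: "{#i', l'#} \<noteq> {#j0, l0#}" and n3: "{#j', k'#} \<noteq> {#j0, l0#}"
          using s s0 ll jj by (auto simp: doubleton_mset_eq_iff)
        have y: "t = t0" if "mset ys' = mset ys" "mset (i' # k' # gs') = mset (i # k # gs)" "{#j', l'#} = {#j0, l0#}"
        proof -
          have "ys' = ys" using sorted_mset_eq s(1) s0(1) that(1) by blast
          moreover have "i' # k' # gs' = i # k # gs"
            by (rule sorted_mset_eq) (use s s0 that(2) in auto)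
          moreover have "j' = j0" "l' = l0" using that(3) s(6) s0(6) by (auto simp: doubleton_mset_eq_iff)
          ultimately show ?thesis by (simp add: t t0)
        qed
        show ?thesis
        proof (cases "t = t0")
          case True
          then have "ys' = ys" "i' = i" "j' = j0" "k' = k" "l' = l0" "gs' = gs" by (simp_all add: t t0)
          then have "coef e13 t ?m = 1"
            unfolding t normal_form.simps lookup_comm_prod using n1 n2 n3 by simp
          then show ?thesis using True by simp
        next
          case False
          then show ?thesis using n1 n2 n3 y unfolding t normal_form.simps lookup_comm_prod by auto
        qed
      qed
      show "coef e13 t0 ?m \<noteq> 0"
        using other[OF t0S(1)] by simp
      fix t assume "t \<in> T" "t \<noteq> t0" "c t \<noteq> 0"
      then show "coef e13 t ?m = 0"
        using other[of t] by (simp add: S_def)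
    qed (use t0T in auto)
    then show False using t0T by simp
  qed
  then have "c t = 0" if "t \<in> T" for t using that by (auto simp: S_def)
  then show ?thesis unfolding r by simp
qed

end

section \<open>Involutions of upper triangular matrices\<close>

lemma star_identities_transfer:
  assumes h: "algebra_hom s1 s2 h" "bij h" and st: "\<And>a. st2 (h a) = h (st1 a)"
  shows "star_identities s2 st2 = star_identities s1 st1"
proof (intro set_eqI iffI)
  note hs = algebra_homD[OF h(1)]
  fix f
  show "f \<in> star_identities s1 st1" if f: "f \<in> star_identities s2 st2"
    unfolding star_identities_iff
  proof (intro allI impI)
    fix g assume "admissible st1 g"
    then have "admissible st2 (\<lambda>x. h (g x))" by (simp add: admissible_def st hs)
    then have "h (eval_free s1 g f) = h 0"
      using f by (simp add: star_identities_iff algebra_hom_eval_free_comp[OF h(1)] hs)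
    then show "eval_free s1 g f = 0" using h(2) by (simp add: bij_def inj_eq)
  qed
  show "f \<in> star_identities s2 st2" if f: "f \<in> star_identities s1 st1"
    unfolding star_identities_iff
  proof (intro allI impI)
    fix g assume g: "admissible st2 g"
    define g' where "g' x = inv h (g x)" for x
    have hg: "h (g' x) = g x" for x using h(2) by (simp add: g'_def bij_def surj_f_inv_f)
    have "h (st1 (g' (Y i))) = h (g' (Y i))" "h (st1 (g' (Z i))) = h (- g' (Z i))" for i
      using g by (simp_all add: hg admissible_def hs flip: st)
    then have "admissible st1 g'" using h(2) by (simp add: admissible_def bij_def inj_eq)
    then have "h (eval_free s1 g' f) = h 0"
      using f by (simp add: star_identities_iff)
    then show "eval_free s2 g f = 0"
      by (simp add: algebra_hom_eval_free_comp[OF h(1)] hg hs)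
  qed
qed

context
  fixes st :: "'f::field ut3 \<Rightarrow> 'f ut3"
  assumes two: "(2::'f) \<noteq> 0" and inv: "algebra_involution ut3_scale st"
begin

lemmas st_simps = algebra_involutionD(2-)[OF inv]

lemma st_eq_iff: "st A = st B \<longleftrightarrow> A = B"
  using st_simps(4) by metis

text \<open>Matrices with zero diagonal are exactly the nilpotent ones, and the involution preserves
  nilpotency.\<close>

lemma st_radical:
  assumes "e11 A = 0" "e22 A = 0" "e33 A = 0"
  shows "e11 (st A) = 0 \<and> e22 (st A) = 0 \<and> e33 (st A) = 0"
proof -
  have "A * A * A = 0" using assms by (simp add: ut3_eq_iff)
  then have "st A * (st A * st A) = 0" by (metis st_simps(3,5))
  then show ?thesis by (simp add: ut3_eq_iff)
qed

lemma st_conjugate_reflection: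
  obtains h where "algebra_hom ut3_scale ut3_scale h" "bij h" "\<And>A. st (h A) = h (reflection A)"
proof -
  \<comment> \<open>A product of two matrices with zero diagonal is a multiple of \<open>U\<close>;
    since \<open>U\<close> is such a product, the involution can only rescale it.\<close>
  define U where "U = (mk_ut3 0 0 1 0 0 0 :: 'f ut3)"
  obtain l where U: "st U = ut3_scale l U" and l: "l \<noteq> 0"
  proof -
    let ?p = "mk_ut3 0 1 0 0 0 0 :: 'f ut3" and ?q = "mk_ut3 0 0 0 0 1 0 :: 'f ut3"
    have "U = ?p * ?q" by (simp add: ut3_eq_iff U_def)
    then have e: "st U = st ?q * st ?p" by (simp add: st_simps)
    have "st U = ut3_scale (e12 (st ?q) * e23 (st ?p)) U"
      unfolding e using st_radical[of ?p] st_radical[of ?q] by (simp add: ut3_eq_iff U_def)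
    moreover have "e12 (st ?q) * e23 (st ?p) \<noteq> 0"
    proof
      assume "e12 (st ?q) * e23 (st ?p) = 0"
      then have "st U = st 0" using calculation by (simp add: ut3_eq_iff st_simps)
      then show False unfolding st_eq_iff by (simp add: ut3_eq_iff U_def)
    qed
    ultimately show ?thesis using that by blast
  qed
  \<comment> \<open>Multiplying \<open>U\<close> by \<open>A\<close> from the left or right reads
    off the first or third diagonal entry, and the involution exchanges the two sides.\<close>
  have diag: "e33 (st A) = e11 A" "e11 (st A) = e33 A" for A
  proof -
    have 1: "A * U = ut3_scale (e11 A) U" "U * A = ut3_scale (e33 A) U" for A
      by (simp_all add: ut3_eq_iff U_def)
    have "st U * st A = ut3_scale (e11 A) (st U)" "st A * st U = ut3_scale (e33 A) (st U)"
      using arg_cong[OF 1(1), of st A] arg_cong[OF 1(2), of st A] by (simp_all add: st_simps)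
    then show "e33 (st A) = e11 A" "e11 (st A) = e33 A"
      unfolding U using l by (simp_all add: ut3_eq_iff U_def)
  qed
  define E where "E = (mk_ut3 1 0 0 0 0 0 :: 'f ut3)"
  define G where "G = (mk_ut3 0 0 0 1 0 0 :: 'f ut3)"
  \<comment> \<open>Otherwise \<open>st G\<close> would have zero diagonal, and so would
    \<open>st (st G)\<close>, which is \<open>G\<close>.\<close>
  have G: "e22 (st G) \<noteq> 0"
  proof
    assume "e22 (st G) = 0"
    moreover have "e11 (st G) = 0" "e33 (st G) = 0" unfolding diag by (simp_all add: G_def)
    ultimately have "e22 (st (st G)) = 0" using st_radical by blast
    then show False by (simp add: st_simps G_def)
  qed
  have "E * G = 0" by (simp add: ut3_eq_iff E_def G_def)
  then have "st G * st E = 0" by (metis st_simps(3,5))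
  then have E22: "e22 (st E) = 0" using G by (simp add: ut3_eq_iff)
  define a where "a = e13 (st E)"
  define y where "y = e23 (st E)"
  have "E * E = E" by (simp add: ut3_eq_iff E_def)
  then have "st E * st E = st E" by (metis st_simps(3))
  then have stE: "st E = mk_ut3 0 0 a 0 y 1"
    using E22 by (simp add: ut3_eq_iff diag a_def y_def E_def)
  define P where "P = (mk_ut3 0 1 0 0 0 0 :: 'f ut3)"
  define q where "q = e23 (st P)"
  define w where "w = e13 (st P)"
  have "E * P = P" by (simp add: ut3_eq_iff E_def P_def)
  then have "st P * st E = st P" by (metis st_simps(3))
  then have stP: "st P = mk_ut3 0 0 w 0 q 0"
    using st_radical[of P] by (simp add: stE ut3_eq_iff q_def w_def P_def)
  have q: "q \<noteq> 0"
  proof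
    assume "q = 0"
    then have "st P = ut3_scale w U" by (simp add: stP ut3_eq_iff U_def)
    then have "P = ut3_scale w (st U)" by (metis st_simps(2,4))
    from arg_cong[OF this, of e12] show False unfolding U by (simp add: U_def P_def)
  qed
  \<comment> \<open>Products of the form \<open>P * st P\<close> are symmetric, which forces the
    scaling factor of \<open>U\<close> to be 1.\<close>
  have "P * st P = ut3_scale q U" by (simp add: ut3_eq_iff stP) (simp add: P_def U_def)
  then have "ut3_scale q U = ut3_scale q (st U)"
    by (metis st_simps(2,3,4))
  then have stU: "st U = U" using q unfolding U by (simp add: ut3_eq_iff U_def)
  \<comment> \<open>The (1, 3) entry of \<open>E1 * E3\<close> is \<open>a + 2 * k\<close>; this
    choice makes the idempotents \<open>E1\<close> and \<open>st E1\<close> orthogonal.\<close>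
  define k where "k = - a / 2"
  have ak: "a + k = - k" using two by (simp add: k_def field_simps)
  define E1 where "E1 = E + ut3_scale k U"
  define E3 where "E3 = st E1"
  define E2 where "E2 = 1 - E1 - E3"
  \<comment> \<open>This is \<open>E1 * P * E2\<close>, the component of \<open>P\<close> between
    the new idempotents.\<close>
  define u where "u = P - ut3_scale y U"
  define v where "v = st u"
  have E1: "E1 = mk_ut3 1 0 k 0 0 0" by (simp add: E1_def E_def U_def ut3_eq_iff)
  have E3: "E3 = mk_ut3 0 0 (- k) 0 y 1"
    by (simp add: E3_def E1_def st_simps stE stU ut3_eq_iff) (simp add: U_def ak)
  have E2: "E2 = mk_ut3 0 0 0 1 (- y) 0" by (simp add: E2_def E1 E3 ut3_eq_iff)
  have u: "u = mk_ut3 0 1 (- y) 0 0 0" by (simp add: u_def P_def U_def ut3_eq_iff)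
  have stE2: "st E2 = E2"
    by (simp add: E2_def st_simps E3_def)
  have v0: "v = mk_ut3 0 0 (w - y) 0 q 0"
    by (simp add: v_def u_def st_simps stP stU ut3_eq_iff) (simp add: U_def)
  have "u * E2 = u" by (simp add: u E2 ut3_eq_iff)
  then have "E2 * v = v" unfolding v_def by (metis st_simps(3) stE2)
  then have v: "v = mk_ut3 0 0 0 0 q 0" by (simp add: v0 E2 ut3_eq_iff)
  \<comment> \<open>The standard matrix units go to \<open>E1\<close>, \<open>u\<close>,
    \<open>u * v\<close>, \<open>E2\<close>, \<open>v\<close>, \<open>E3\<close>, where
    \<open>u * v\<close> is \<open>q\<close> times \<open>U\<close>. The involution permutes these
    as the reflection permutes the standard ones.\<close>
  define h where "h A = mk_ut3 (e11 A) (e12 A) (k * (e11 A - e33 A) - y * e12 A + q * e13 A)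
    (e22 A) (y * (e33 A - e22 A) + q * e23 A) (e33 A)" for A :: "'f ut3"
  have h: "h A = ut3_scale (e11 A) E1 + ut3_scale (e12 A) u + ut3_scale (q * e13 A) U
      + ut3_scale (e22 A) E2 + ut3_scale (e23 A) v + ut3_scale (e33 A) E3" for A
    by (simp add: h_def E1 E2 E3 u v U_def ut3_eq_iff algebra_simps)
  show ?thesis
  proof (rule that)
    show "algebra_hom ut3_scale ut3_scale h"
      by (intro algebra_homI unital_algebraD(1) unital_algebra_ut3)
        (simp_all add: h_def ut3_eq_iff algebra_simps)
    show "st (h A) = h (reflection A)" for A
    proof -
      have "st E3 = E1" "st v = u" "st E1 = E3" "st u = v" by (simp_all add: E3_def v_def st_simps)
      then show ?thesis unfolding h by (simp add: st_simps stE2 stU)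
    qed
    show "bij h"
    proof (rule o_bij)
      let ?h' = "\<lambda>A. mk_ut3 (e11 A) (e12 A) ((e13 A - k * (e11 A - e33 A) + y * e12 A) / q)
        (e22 A) ((e23 A - y * (e33 A - e22 A)) / q) (e33 A)"
      show "?h' \<circ> h = id" "h \<circ> ?h' = id"
        using q by (auto simp: fun_eq_iff h_def ut3_eq_iff field_simps)
    qed
  qed
qed

lemma star_identities_eq_reflection:
  "star_identities ut3_scale st = star_identities ut3_scale reflection"
  using st_conjugate_reflection star_identities_transfer by metis

end

section \<open>The relatively free algebra\<close>

text \<open>Every \<open>a\<close> is the sum of half of \<open>a + st a\<close>, which is
  symmetric, and half of \<open>a - st a\<close>, which is skew.\<close>

lemma additive_zero:
  fixes s :: "'f::field \<Rightarrow> 'b::ring_1 \<Rightarrow> 'b" and F :: "'b \<Rightarrow> 'b"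
  assumes "(2::'f) \<noteq> 0" "unital_algebra s" "algebra_involution s st"
    and add: "\<And>a b. F (a + b) = F a + F b" and hom: "\<And>a. homogeneous st a \<Longrightarrow> F a = 0"
  shows "F a = 0"
proof -
  interpret vector_space s using assms(2) by (rule unital_algebraD)
  note st = algebra_involutionD(2-)[OF assms(3)]
  have "(1 / 2 + 1 / 2 :: 'f) = 1" using assms(1) by (simp flip: mult_2)
  then have "a = s (1 / 2) a + s (1 / 2) a" by (metis scale_left_distrib scale_one)
  then have a: "a = s (1 / 2) (a + st a) + s (1 / 2) (a - st a)"
    by (simp add: scale_right_distrib scale_right_diff_distrib)
  have "F (s (1 / 2) (a + st a)) = 0"
    by (rule hom) (simp add: homogeneous_def st add.commute)
  moreover have "F (s (1 / 2) (a - st a)) = 0"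
    by (rule hom) (simp add: homogeneous_def st flip: scale_minus_right)
  ultimately show ?thesis using add a by (metis add.right_neutral)
qed

context
  fixes s :: "'f::field \<Rightarrow> 'b::ring_1 \<Rightarrow> 'b" and st :: "'b \<Rightarrow> 'b"
  assumes two: "(2::'f) \<noteq> 0" and alg: "unital_algebra s" and inv: "algebra_involution s st"
    and rel: "ut3_relations st {0}"
begin

text \<open>Each relation is additive in every commutator entry and in the outer factor
  \<open>r\<close>, so \<open>additive_zero\<close> removes the homogeneity conditions one argument
  at a time.\<close>

lemma ut3_relations_general:
  shows "st (comm a b) * comm c d = st (comm c d) * comm a b"
    and "st (comm a b) * comm c d - st (comm a c) * comm b d + st (comm a d) * comm b c = 0"
    and "st p = - p \<Longrightarrow> st q = - q \<Longrightarrow> p * comm a b * q = q * st (comm a b) * p"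
    and "st p = - p \<Longrightarrow> comm a b * p * comm c d = 0"
    and "st p = - p \<Longrightarrow> st q = - q \<Longrightarrow> p * comm a b * q * r = st r * (p * comm a b * q)"
proof -
  note az = additive_zero[OF two alg inv]
  note st = algebra_involutionD(2-)[OF inv]
  note R = ut3_relationsD[OF rel, unfolded singleton_iff]
  have four: "F a b c d = 0"
    if add: "\<And>a a' b c d. F (a + a') b c d = F a b c d + F a' b c d"
       "\<And>a b b' c d. F a (b + b') c d = F a b c d + F a b' c d"
       "\<And>a b c c' d. F a b (c + c') d = F a b c d + F a b c' d"
       "\<And>a b c d d'. F a b c (d + d') = F a b c d + F a b c d'"
      and hom: "\<And>a b c d. homogeneous st a \<Longrightarrow> homogeneous st b \<Longrightarrow> homogeneous st c \<Longrightarrow> homogeneous st d \<Longrightarrow> F a b c d = 0"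
    for F :: "'b \<Rightarrow> 'b \<Rightarrow> 'b \<Rightarrow> 'b \<Rightarrow> 'b" and a b c d
  proof -
    have 1: "F a b c d = 0" if "homogeneous st b" "homogeneous st c" "homogeneous st d" for a b c d
      by (rule az[where F = "\<lambda>a. F a b c d"]) (use add hom that in auto)
    have 2: "F a b c d = 0" if "homogeneous st c" "homogeneous st d" for a b c d
      by (rule az[where F = "\<lambda>b. F a b c d"]) (use add 1 that in auto)
    have 3: "F a b c d = 0" if "homogeneous st d" for a b c d
      by (rule az[where F = "\<lambda>c. F a b c d"]) (use add 2 that in auto)
    show ?thesis
      by (rule az[where F = "\<lambda>d. F a b c d"]) (use add 3 in auto)
  qed
  have comm_add: "comm (a + a') b = comm a b + comm a' b" "comm a (b + b') = comm a b + comm a b'" for a a' b b' :: 'b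
    by (simp_all add: comm_def algebra_simps)
  have "st (comm c d) * comm a b - st (comm a b) * comm c d = 0"
    by (rule four[where F = "\<lambda>a b c d. st (comm c d) * comm a b - st (comm a b) * comm c d"])
      (simp_all add: R comm_add st algebra_simps)
  then show "st (comm a b) * comm c d = st (comm c d) * comm a b" by simp
  have "st (comm a c) * comm b d - st (comm a b) * comm c d - st (comm a d) * comm b c = 0"
    by (rule four[where F = "\<lambda>a b c d. st (comm a c) * comm b d - st (comm a b) * comm c d - st (comm a d) * comm b c"])
      (simp_all only: R comm_add st ring_distribs, simp_all add: algebra_simps)
  then show "st (comm a b) * comm c d - st (comm a c) * comm b d + st (comm a d) * comm b c = 0"
    by (simp add: algebra_simps)
  show "comm a b * p * comm c d = 0" if "st p = - p"
  proof (rule four[where F = "\<lambda>a b c d. comm a b * p * comm c d"])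
    fix a b c d
    assume "homogeneous st a" "homogeneous st b" "homogeneous st c" "homogeneous st d"
    then show "comm a b * p * comm c d = 0" by (rule R(5)[OF that])
  qed (simp_all add: comm_add algebra_simps)
  show "p * comm a b * q = q * st (comm a b) * p" if "st p = - p" "st q = - q"
  proof -
    let ?F = "\<lambda>a b. p * comm a b * q - q * st (comm a b) * p"
    have add: "?F (a + a') b = ?F a b + ?F a' b" "?F a (b + b') = ?F a b + ?F a b'" for a a' b b'
      by (simp_all add: comm_add st algebra_simps)
    have 1: "?F a b = 0" if "homogeneous st b" for a b
      by (rule az[where F = "\<lambda>a. ?F a b", OF add(1)]) (rule R(4)[OF \<open>st p = - p\<close> \<open>st q = - q\<close> _ that])
    have "?F a b = 0"
      by (rule az[where F = "\<lambda>b. ?F a b", OF add(2) 1])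
    then show ?thesis by simp
  qed
  show "p * comm a b * q * r = st r * (p * comm a b * q)" if "st p = - p" "st q = - q"
  proof -
    let ?F = "\<lambda>r a b. p * comm a b * q * r - st r * p * comm a b * q"
    have add: "?F (r + r') a b = ?F r a b + ?F r' a b" "?F r (a + a') b = ?F r a b + ?F r a' b"
      "?F r a (b + b') = ?F r a b + ?F r a b'" for r r' a a' b b'
      by (simp_all add: comm_add st algebra_simps)
    have 1: "?F r a b = 0" if "homogeneous st a" "homogeneous st b" for r a b
      by (rule az[where F = "\<lambda>r. ?F r a b", OF add(1)]) (rule R(6)[OF \<open>st p = - p\<close> \<open>st q = - q\<close> _ that])
    have 2: "?F r a b = 0" if "homogeneous st b" for r a b
      by (rule az[where F = "\<lambda>a. ?F r a b", OF add(2) 1[OF _ that]])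
    have "?F r a b = 0"
      by (rule az[where F = "\<lambda>b. ?F r a b", OF add(3) 2])
    then show ?thesis by (simp add: mult.assoc)
  qed
qed

end

definition ut3_ideal :: "'f::field free_alg set" where
  "ut3_ideal = T_star_ideal hull ut3_basis"

lemma T_star_ideal_ut3_ideal: "T_star_ideal ut3_ideal"
  unfolding ut3_ideal_def by (rule T_star_ideal_hull)

lemma ut3_basis_subset_ideal: "ut3_basis \<subseteq> ut3_ideal"
  unfolding ut3_ideal_def by (rule hull_subset)

lemma ut3_ideal_minimal: "T_star_ideal I \<Longrightarrow> ut3_basis \<subseteq> I \<Longrightarrow> ut3_ideal \<subseteq> I"
  unfolding ut3_ideal_def by (rule hull_minimal)

lemmas ut3_idealD = T_star_idealD[OF T_star_ideal_ut3_ideal]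

text \<open>In the field with the identity as involution all commutators vanish, so every generator
  is an identity but 1 is not. The class \<open>ring_1\<close> requires \<open>0 \<noteq> 1\<close>
  in the quotient.\<close>

lemma one_notin_ut3_ideal: "1 \<notin> (ut3_ideal :: 'f::field free_alg set)"
proof
  have alg: "unital_algebra ((*) :: 'f \<Rightarrow> 'f \<Rightarrow> 'f)"
    by (simp add: unital_algebra_def vector_space_def algebra_simps)
  have inv: "algebra_involution ((*) :: 'f \<Rightarrow> 'f \<Rightarrow> 'f) (\<lambda>a. a)"
    unfolding algebra_involution_def
    by (intro conjI allI linearI unital_algebraD(1) alg) (simp_all add: algebra_simps)
  have "comm a b = 0" for a b :: 'f by (simp add: comm_def)
  then have "eval_free (*) g (comm a b) = (0::'f)" for g a b
    by (simp add: algebra_hom_comm[OF algebra_hom_eval_free[OF alg]])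
  then have "ut3_basis \<subseteq> star_identities ((*) :: 'f \<Rightarrow> 'f \<Rightarrow> 'f) (\<lambda>a. a)"
    by (auto simp: ut3_basis_def star_identities_iff algebra_homD[OF algebra_hom_eval_free[OF alg]])
  then have "ut3_ideal \<subseteq> star_identities ((*) :: 'f \<Rightarrow> 'f \<Rightarrow> 'f) (\<lambda>a. a)"
    by (intro ut3_ideal_minimal T_star_ideal_star_identities alg inv)
  moreover assume "1 \<in> (ut3_ideal :: 'f free_alg set)"
  ultimately have "(1 :: 'f free_alg) \<in> star_identities ((*) :: 'f \<Rightarrow> 'f \<Rightarrow> 'f) (\<lambda>a. a)" by blast
  moreover have "admissible (\<lambda>a. a) (\<lambda>_. 0 :: 'f)" by (simp add: admissible_def)
  ultimately show False by (auto simp: star_identities_iff eval_free_one[OF alg])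
qed

quotient_type (overloaded) 'f ut3_quot = "'f::field free_alg" / "\<lambda>p q. p - q \<in> ut3_ideal"
proof (rule equivpI)
  show "reflp (\<lambda>p q :: 'f free_alg. p - q \<in> ut3_ideal)"
    by (simp add: reflp_def ut3_idealD(1))
  show "symp (\<lambda>p q :: 'f free_alg. p - q \<in> ut3_ideal)"
    using ut3_idealD(5) by (fastforce simp: symp_def)
  show "transp (\<lambda>p q :: 'f free_alg. p - q \<in> ut3_ideal)"
    using ut3_idealD(2) by (fastforce simp: transp_def)
qed

instantiation ut3_quot :: (field) ring_1
begin

lift_definition zero_ut3_quot :: "'a ut3_quot" is 0 .
lift_definition one_ut3_quot :: "'a ut3_quot" is 1 .

lift_definition plus_ut3_quot :: "'a ut3_quot \<Rightarrow> 'a ut3_quot \<Rightarrow> 'a ut3_quot" is "(+)"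
proof -
  fix p p' q q' :: "'a free_alg" assume "p - p' \<in> ut3_ideal" "q - q' \<in> ut3_ideal"
  from ut3_idealD(2)[OF this] show "p + q - (p' + q') \<in> ut3_ideal" by (simp add: algebra_simps)
qed

lift_definition minus_ut3_quot :: "'a ut3_quot \<Rightarrow> 'a ut3_quot \<Rightarrow> 'a ut3_quot" is "(-)"
proof -
  fix p p' q q' :: "'a free_alg" assume "p - p' \<in> ut3_ideal" "q - q' \<in> ut3_ideal"
  from ut3_idealD(6)[OF this] show "p - q - (p' - q') \<in> ut3_ideal" by (simp add: algebra_simps)
qed

lift_definition uminus_ut3_quot :: "'a ut3_quot \<Rightarrow> 'a ut3_quot" is uminus
proof -
  fix p p' :: "'a free_alg" assume "p - p' \<in> ut3_ideal"
  from ut3_idealD(5)[OF this] show "- p - - p' \<in> ut3_ideal" by simp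
qed

lift_definition times_ut3_quot :: "'a ut3_quot \<Rightarrow> 'a ut3_quot \<Rightarrow> 'a ut3_quot" is "(*)"
proof -
  fix p p' q q' :: "'a free_alg" assume "p - p' \<in> ut3_ideal" "q - q' \<in> ut3_ideal"
  then have "(p - p') * q + p' * (q - q') \<in> ut3_ideal" by (intro ut3_idealD(2-4))
  then show "p * q - p' * q' \<in> ut3_ideal" by (simp add: algebra_simps)
qed

instance
proof
  show "(0::'a ut3_quot) \<noteq> 1"
    by transfer (use one_notin_ut3_ideal ut3_idealD(5) in fastforce)
qed (transfer; simp add: algebra_simps ut3_idealD(1))+

end

lift_definition quot_scale :: "'f::field \<Rightarrow> 'f ut3_quot \<Rightarrow> 'f ut3_quot" is free_scale
proof -
  fix c and p p' :: "'f free_alg" assume "p - p' \<in> ut3_ideal"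
  then have "Poly_Mapping.single [] c * (p - p') \<in> ut3_ideal" by (rule ut3_idealD(3))
  then show "free_scale c p - free_scale c p' \<in> ut3_ideal" by (simp add: free_scale_def algebra_simps)
qed

lemma unital_algebra_quot: "unital_algebra (quot_scale :: 'f::field \<Rightarrow> _)"
  unfolding unital_algebra_def vector_space_def
  by (intro conjI allI; transfer)
    (simp_all add: free.scale_right_distrib free.scale_left_distrib free_scale_mult ut3_idealD(1))

lemma algebra_hom_abs: "algebra_hom free_scale quot_scale (abs_ut3_quot :: 'f::field free_alg \<Rightarrow> _)"
  by (intro algebra_homI unital_algebraD(1) unital_algebra_quot unital_algebra_free)
    (simp_all add: plus_ut3_quot.abs_eq times_ut3_quot.abs_eq quot_scale.abs_eq one_ut3_quot_def)

lemma abs_eq_zero_iff: "abs_ut3_quot p = 0 \<longleftrightarrow> p \<in> ut3_ideal"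
  by (simp add: zero_ut3_quot_def ut3_quot.abs_eq_iff)

lemma abs_rep_ut3_quot: "abs_ut3_quot (rep_ut3_quot r) = r"
  by (rule Quotient_abs_rep[OF Quotient_ut3_quot])

lemma rep_abs_ut3_quot: "rep_ut3_quot (abs_ut3_quot p) - p \<in> ut3_ideal"
  using abs_rep_ut3_quot[of "abs_ut3_quot p"] by (simp add: ut3_quot.abs_eq_iff)

definition quot_star :: "'f::field ut3_quot \<Rightarrow> 'f ut3_quot" where
  "quot_star r = abs_ut3_quot (free_star (rep_ut3_quot r))"

lemma homogeneous_comm:
  assumes "algebra_involution s st" "homogeneous st a" "homogeneous st b"
  shows "st (comm a b) = comm a b \<or> st (comm a b) = - comm a b"
  unfolding algebra_involution_comm[OF assms(1)]
  using assms(2,3) by (auto simp: homogeneous_def comm_def)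

context
  assumes two: "(2::'f::field) \<noteq> 0"
begin

lemma ut3_relations_ideal: "ut3_relations free_star (ut3_ideal :: 'f free_alg set)"
  using eval_basis_iff[OF two unital_algebra_free algebra_involution_free_star, of ut3_ideal]
    eval_free_in_T_star_ideal[OF T_star_ideal_ut3_ideal] ut3_basis_subset_ideal by blast

text \<open>The polynomials whose star lies in the ideal form an ideal of the same kind. It contains
  the generators, because the star of each generating relation is, up to sign, a combination of
  generating relations.\<close>

lemma free_star_ut3_ideal:
  assumes "f \<in> (ut3_ideal :: 'f free_alg set)"
  shows "free_star f \<in> ut3_ideal"
proof -
  note R = ut3_relationsD[OF ut3_relations_ideal]
  note st = algebra_involutionD(2-)[OF algebra_involution_free_star]
  note hc = homogeneous_comm[OF algebra_involution_free_star]
  let ?V = "{f :: 'f free_alg. free_star f \<in> ut3_ideal}"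
  have "ut3_relations free_star ?V"
    unfolding ut3_relations_def mem_Collect_eq
  proof (intro conjI allI impI)
    fix p q r :: "'f free_alg" assume sk: "free_star p = - p" "free_star q = - q" "free_star r = - r"
    have "free_star (p * comm q r - q * comm p r + r * comm p q) = p * comm q r - q * comm p r + r * comm p q"
      by (simp add: st sk comm_def algebra_simps)
    then show "free_star (p * comm q r - q * comm p r + r * comm p q) \<in> ut3_ideal"
      using R(1) sk by simp
  next
    fix a b c d :: "'f free_alg" assume "homogeneous free_star a" "homogeneous free_star b" "homogeneous free_star c" "homogeneous free_star d"
    then show "free_star (free_star (comm c d) * comm a b - free_star (comm a b) * comm c d) \<in> ut3_ideal"
      using R(2)[of c d a b] by (simp add: st)
  next
    fix a b c d :: "'f free_alg" assume h: "homogeneous free_star a" "homogeneous free_star b" "homogeneous free_star c" "homogeneous free_star d"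
    \<comment> \<open>The star exchanges the two commutators in each product; \<open>?D\<close> is
      the swap relation that restores the order.\<close>
    let ?D = "\<lambda>a b c d. free_star (comm c d) * comm a b - free_star (comm a b) * comm c d"
    have "free_star (free_star (comm a c) * comm b d - free_star (comm a b) * comm c d - free_star (comm a d) * comm b c)
      = (free_star (comm a c) * comm b d - free_star (comm a b) * comm c d - free_star (comm a d) * comm b c)
        + ?D a c b d - ?D a b c d - ?D a d b c"
      by (simp add: st)
    also have "\<dots> \<in> ut3_ideal" by (intro ut3_idealD(2,6) R(2,3) h)
    finally show "free_star (free_star (comm a c) * comm b d - free_star (comm a b) * comm c d - free_star (comm a d) * comm b c) \<in> ut3_ideal" .
  next
    fix p q a b :: "'f free_alg" assume h: "free_star p = - p" "free_star q = - q" "homogeneous free_star a" "homogeneous free_star b"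
    have "free_star (p * comm a b * q - q * free_star (comm a b) * p) = - (p * comm a b * q - q * free_star (comm a b) * p)"
      by (simp add: st h(1,2) mult.assoc)
    then show "free_star (p * comm a b * q - q * free_star (comm a b) * p) \<in> ut3_ideal"
      using ut3_idealD(5)[OF R(4)[OF h]] by simp
  next
    fix p a b c d :: "'f free_alg" assume h: "free_star p = - p" "homogeneous free_star a" "homogeneous free_star b" "homogeneous free_star c" "homogeneous free_star d"
    have "free_star (comm a b * p * comm c d) = comm c d * p * comm a b \<or> free_star (comm a b * p * comm c d) = - (comm c d * p * comm a b)"
      using hc[OF h(2,3)] hc[OF h(4,5)] by (auto simp: st h(1) mult.assoc)
    then show "free_star (comm a b * p * comm c d) \<in> ut3_ideal"
      using R(5)[OF h(1,4,5,2,3)] ut3_idealD(5) by metis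
  next
    fix p q a b c :: "'f free_alg" assume h: "free_star p = - p" "free_star q = - q" "homogeneous free_star a" "homogeneous free_star b" "homogeneous free_star c"
    let ?e = "q * comm b c * p * a - free_star a * q * comm b c * p"
    have "free_star (p * comm b c * q * a - free_star a * p * comm b c * q) = ?e \<or>
        free_star (p * comm b c * q * a - free_star a * p * comm b c * q) = - ?e"
      using hc[OF h(4,5)] by (auto simp: st h(1,2) mult.assoc)
    then show "free_star (p * comm b c * q * a - free_star a * p * comm b c * q) \<in> ut3_ideal"
      using R(6)[OF h(2,1,3,4,5)] ut3_idealD(5) by metis
  qed
  then have B: "eval_free free_scale g f \<in> ?V" if "f \<in> ut3_basis" "admissible free_star g" for f g
    using eval_basis_iff[OF two unital_algebra_free algebra_involution_free_star, of ?V] that by blast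
  have "ut3_basis \<subseteq> ?V"
    using B[OF _ admissible_gens] by (auto simp: eval_free_gens)
  moreover have "T_star_ideal ?V"
    by (rule T_star_idealI) (simp_all add: st ut3_idealD(1-4), metis ut3_idealD(7))
  ultimately show ?thesis using ut3_ideal_minimal[of ?V] assms by blast
qed

lemma quot_star_abs: "quot_star (abs_ut3_quot p) = abs_ut3_quot (free_star (p :: 'f free_alg))"
  using free_star_ut3_ideal[OF rep_abs_ut3_quot[of p]]
  by (simp add: quot_star_def ut3_quot.abs_eq_iff free_star.diff)

lemma algebra_involution_quot: "algebra_involution quot_scale (quot_star :: 'f ut3_quot \<Rightarrow> _)"
proof -
  note st = algebra_involutionD(2-)[OF algebra_involution_free_star]
  note h = algebra_homD[OF algebra_hom_abs, symmetric]
  have 1: "quot_star (r + r') = quot_star r + quot_star r'" for r r' :: "'f ut3_quot"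
    by (induction r; induction r') (simp add: h(1) quot_star_abs st)
  have 2: "quot_star (quot_scale c r) = quot_scale c (quot_star r)" for c and r :: "'f ut3_quot"
    by (induction r) (simp add: h(2) quot_star_abs st)
  have 3: "quot_star (r * r') = quot_star r' * quot_star r" for r r' :: "'f ut3_quot"
    by (induction r; induction r') (simp add: h(3) quot_star_abs st)
  have 4: "quot_star (quot_star r) = r" for r :: "'f ut3_quot"
    by (induction r) (simp add: quot_star_abs st)
  show ?thesis unfolding algebra_involution_def
    by (intro conjI allI linearI unital_algebraD(1) unital_algebra_quot 1 2 3 4)
qed

lemma ut3_relations_quot: "ut3_relations (quot_star :: 'f ut3_quot \<Rightarrow> _) {0}"
proof -
  have "eval_free quot_scale g f = 0" if f: "f \<in> ut3_basis" and g: "admissible quot_star g"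
    for f :: "'f free_alg" and g
  proof -
    note st = algebra_involutionD(2-)[OF algebra_involution_free_star]
    note habs = algebra_homD[OF algebra_hom_abs]
    interpret Q: vector_space "quot_scale :: 'f \<Rightarrow> _" by (rule unital_algebraD[OF unital_algebra_quot])
    \<comment> \<open>Averaging a representative with its star, with the appropriate sign, lifts
      symmetric and skew elements of the quotient to symmetric and skew polynomials.\<close>
    define G where "G x = (case x of
        Y i \<Rightarrow> free_scale (1 / 2) (rep_ut3_quot (g x) + free_star (rep_ut3_quot (g x)))
      | Z i \<Rightarrow> free_scale (1 / 2) (rep_ut3_quot (g x) - free_star (rep_ut3_quot (g x))))" for x
    have "(1 / 2 + 1 / 2 :: 'f) = 1" using two by (simp flip: mult_2)
    then have half: "quot_scale (1 / 2) r + quot_scale (1 / 2) r = r" for r :: "'f ut3_quot"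
      by (metis Q.scale_left_distrib Q.scale_one)
    have G: "abs_ut3_quot (G x) = g x" for x
    proof (cases x)
      case (Y i)
      have "abs_ut3_quot (free_star (rep_ut3_quot (g x))) = g x"
        using g Y by (simp add: admissible_def flip: quot_star_def)
      then show ?thesis by (simp add: G_def Y habs abs_rep_ut3_quot Q.scale_right_distrib half)
    next
      case (Z i)
      have "abs_ut3_quot (free_star (rep_ut3_quot (g x))) = - g x"
        using g Z by (simp add: admissible_def flip: quot_star_def)
      then show ?thesis by (simp add: G_def Z habs abs_rep_ut3_quot Q.scale_right_distrib half)
    qed
    have "admissible free_star G"
      by (simp add: admissible_def G_def st add.commute flip: free.scale_minus_right)
    then have "eval_free free_scale G f \<in> ut3_ideal"
      using eval_free_in_T_star_ideal[OF T_star_ideal_ut3_ideal] ut3_basis_subset_ideal f by blast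
    then have "abs_ut3_quot (eval_free free_scale G f) = 0" by (simp add: abs_eq_zero_iff)
    then show ?thesis by (simp add: algebra_hom_eval_free_comp[OF algebra_hom_abs] G)
  qed
  then show ?thesis
    using eval_basis_iff[OF two unital_algebra_quot algebra_involution_quot, of "{0}"] by blast
qed

abbreviation quot_gen :: "gen \<Rightarrow> 'f ut3_quot" where
  "quot_gen g \<equiv> abs_ut3_quot (Poly_Mapping.single [g] 1)"

lemma ut3_star_quotient_quot: "ut3_star_quotient quot_scale quot_star quot_gen"
proof -
  note inv = algebra_involutionD[OF algebra_involution_quot]
  note gen = ut3_relations_general[OF two unital_algebra_quot algebra_involution_quot ut3_relations_quot]
  interpret Q: vector_space "quot_scale :: 'f \<Rightarrow> _" by (rule unital_algebraD[OF unital_algebra_quot])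
  show ?thesis
  proof
    show "quot_star (quot_gen (Y n)) = quot_gen (Y n)" for n
      by (simp add: quot_star_abs free_star_yv[unfolded yv_def])
    show "quot_star (quot_gen (Z n)) = - quot_gen (Z n)" for n
      by (simp add: quot_star_abs free_star_zv[unfolded zv_def] algebra_homD[OF algebra_hom_abs])
    show "p * comm q r - q * comm p r + r * comm p q = 0"
      if "quot_star p = - p" "quot_star q = - q" "quot_star r = - r" for p q r :: "'f ut3_quot"
      using ut3_relationsD(1)[OF ut3_relations_quot that] by simp
    show "r \<in> Q.span (range (\<lambda>w. prod_list (map quot_gen w)))" for r
    proof (induction r)
      fix p :: "'f free_alg"
      have "abs_ut3_quot p = eval_free quot_scale quot_gen p"
        by (rule algebra_hom_free_eq[OF algebra_hom_abs])
      also have "\<dots> \<in> Q.span (range (\<lambda>w. prod_list (map quot_gen w)))"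
        unfolding eval_free_def by (intro Q.span_sum Q.span_scale Q.span_base rangeI)
      finally show "abs_ut3_quot p \<in> Q.span (range (\<lambda>w. prod_list (map quot_gen w)))" .
    qed
  qed (use two inv unital_algebraD[OF unital_algebra_quot] gen in \<open>auto simp: Q.vector_space_axioms\<close>)
qed

section \<open>The ideal of identities of the reflection\<close>

lemma ut3_ideal_subset_reflection: "ut3_ideal \<subseteq> star_identities ut3_scale (reflection :: 'f ut3 \<Rightarrow> _)"
proof (rule ut3_ideal_minimal)
  show "T_star_ideal (star_identities ut3_scale (reflection :: 'f ut3 \<Rightarrow> _))"
    by (rule T_star_ideal_star_identities[OF unital_algebra_ut3 algebra_involution_reflection])
  show "ut3_basis \<subseteq> star_identities ut3_scale (reflection :: 'f ut3 \<Rightarrow> _)"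
    using eval_basis_iff[OF two unital_algebra_ut3 algebra_involution_reflection, of "{0}"]
      ut3_relations_reflection[OF two] by (auto simp: star_identities_iff)
qed

lemma star_identities_reflection_eq_ideal:
  assumes inf: "infinite (UNIV :: 'f set)"
  shows "star_identities ut3_scale (reflection :: 'f ut3 \<Rightarrow> _) = ut3_ideal"
proof
  define \<Psi> where "\<Psi> = eval_free (ut3_scalar pscale) (generic :: gen \<Rightarrow> 'f ut3_poly ut3)"
  note alg = unital_algebra_ut3_scalar[OF unital_algebra_pscale]
  have homP: "algebra_hom free_scale (ut3_scalar pscale) \<Psi>"
    unfolding \<Psi>_def by (rule algebra_hom_eval_free[OF alg])
  have \<Psi>0: "\<Psi> f = 0" if "f \<in> star_identities ut3_scale (reflection :: 'f ut3 \<Rightarrow> _)" for f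
    unfolding \<Psi>_def by (rule star_identities_reflection_generic[OF inf that])
  \<comment> \<open>Elements of the ideal are identities of the reflection, so \<open>\<Psi>\<close>
    kills them and the choice of representative is immaterial. Injectivity of \<open>\<Phi>\<close>
    then gives the converse inclusion.\<close>
  define \<Phi> where "\<Phi> r = \<Psi> (rep_ut3_quot r)" for r
  have \<Phi>: "\<Phi> (abs_ut3_quot p) = \<Psi> p" for p
    using \<Psi>0[OF subsetD[OF ut3_ideal_subset_reflection rep_abs_ut3_quot[of p]]]
    by (simp add: \<Phi>_def algebra_homD[OF homP])
  interpret ut3_star_quotient "quot_scale :: 'f \<Rightarrow> _" quot_star quot_gen
    by (rule ut3_star_quotient_quot)
  interpret ut3_generic_quotient "quot_scale :: 'f \<Rightarrow> _" quot_star quot_gen \<Phi>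
  proof
    note h = algebra_homD[OF algebra_hom_abs, symmetric]
    have 1: "\<Phi> (r + r') = \<Phi> r + \<Phi> r'" for r r'
      by (induction r; induction r') (simp add: h(1) \<Phi> algebra_homD[OF homP])
    have 2: "\<Phi> (quot_scale c r) = ut3_scalar pscale c (\<Phi> r)" for c r
      by (induction r) (simp add: h(2) \<Phi> algebra_homD[OF homP])
    have 3: "\<Phi> (r * r') = \<Phi> r * \<Phi> r'" for r r'
      by (induction r; induction r') (simp add: h(3) \<Phi> algebra_homD[OF homP])
    have 4: "\<Phi> 1 = 1"
      by (simp add: h(4) \<Phi> algebra_homD[OF homP])
    show "algebra_hom quot_scale (ut3_scalar pscale) \<Phi>"
      by (intro algebra_homI unital_algebraD(1) unital_algebra_quot alg 1 2 3 4)
    show "\<Phi> (quot_gen g) = generic g" for g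
      by (cases g) (simp_all add: \<Phi> \<Psi>_def eval_free_yv[OF alg] eval_free_zv[OF alg] flip: yv_def zv_def)
    show "\<Phi> (quot_star r) = reflection (\<Phi> r)" for r
      by (induction r) (simp add: quot_star_abs \<Phi> \<Psi>_def eval_free_star[OF alg
            algebra_involution_reflection_scalar[OF unital_algebra_pscale] admissible_generic])
  qed
  show "star_identities ut3_scale (reflection :: 'f ut3 \<Rightarrow> _) \<subseteq> ut3_ideal"
  proof
    fix f assume "f \<in> star_identities ut3_scale (reflection :: 'f ut3 \<Rightarrow> _)"
    then have "\<Phi> (abs_ut3_quot f) = 0" by (simp add: \<Phi> \<Psi>0)
    then have "abs_ut3_quot f = 0" by (rule \<Phi>_eq_zero_imp)
    then show "f \<in> ut3_ideal" by (simp add: abs_eq_zero_iff)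
  qed
qed (rule ut3_ideal_subset_reflection)

end

theorem theorem3p43:
  fixes star :: "'f::field ut3 \<Rightarrow> 'f ut3"
  assumes "infinite (UNIV :: 'f set)"
    and "CHAR('f) > 2"
    and "algebra_involution ut3_scale star"
  shows "star_identities ut3_scale star =
    T_star_ideal hull
     ({zv 1 * comm (zv 2) (zv 3) - zv 2 * comm (zv 1) (zv 3) + zv 3 * comm (zv 1) (zv 2)}
    \<union> {(-1) ^ par (comm x1 x2) * comm x1 x2 * comm x3 x4
         - (-1) ^ par (comm x3 x4) * comm x3 x4 * comm x1 x2 | x1 x2 x3 x4.
         x1 \<in> xv 1 \<and> x2 \<in> xv 2 \<and> x3 \<in> xv 3 \<and> x4 \<in> xv 4}
    \<union> {(-1) ^ par (comm x1 x2) * comm x1 x2 * comm x3 x4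
         - (-1) ^ par (comm x1 x3) * comm x1 x3 * comm x2 x4
         + (-1) ^ par (comm x1 x4) * comm x1 x4 * comm x2 x3 | x1 x2 x3 x4.
         x1 \<in> xv 1 \<and> x2 \<in> xv 2 \<and> x3 \<in> xv 3 \<and> x4 \<in> xv 4}
    \<union> {zv 1 * comm x3 x4 * zv 2 + (-1) ^ par (comm x3 x4) * zv 2 * comm x3 x4 * zv 1 | x3 x4.
         x3 \<in> xv 3 \<and> x4 \<in> xv 4}
    \<union> {comm x1 x2 * zv 5 * comm x3 x4 | x1 x2 x3 x4.
         x1 \<in> xv 1 \<and> x2 \<in> xv 2 \<and> x3 \<in> xv 3 \<and> x4 \<in> xv 4}
    \<union> {zv 1 * comm x4 x5 * zv 2 * x3 + (-1) ^ par x3 * x3 * zv 1 * comm x4 x5 * zv 2 | x3 x4 x5.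
         x3 \<in> xv 3 \<and> x4 \<in> xv 4 \<and> x5 \<in> xv 5})"
proof -
  have two: "(2::'f) \<noteq> 0"
  proof
    assume "(2::'f) = 0"
    then have "of_nat 2 = (0::'f)" by simp
    then have "CHAR('f) dvd 2" by (simp only: of_nat_eq_0_iff_char_dvd)
    then show False using assms(2) dvd_imp_le by fastforce
  qed
  have "star_identities ut3_scale star = (ut3_ideal :: 'f free_alg set)"
    unfolding star_identities_eq_reflection[OF two assms(3)]
    by (rule star_identities_reflection_eq_ideal[OF two assms(1)])
  then show ?thesis unfolding ut3_ideal_def ut3_basis_def .
qed

end
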